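(* Let $\mathcal{B}$ be a unital separable C*-algebra and let $\mathcal{A}$ be a unital commutative norm-closed (not necessarily selfadjoint) subalgebra of $\mathcal{B}$ with $\mathcal{Z}(\mathcal{B})\subseteq\mathcal{A}$. Suppose $\{\mathcal{J}_i:i\in I\}$ is a family of closed two-sided ideals of $\mathcal{B}$ such that 1. if $i\neq j$ are in $I$, then $(\mathcal{Z}(\mathcal{B})\cap\mathcal{J}_i)+(\mathcal{Z}(\mathcal{B})\cap\mathcal{J}_j)=\mathcal{Z}(\mathcal{B})$; 2. $\mathcal{A}/(\mathcal{A}\cap\mathcal{J}_i)$ is approximately normal in $\mathcal{B}/\mathcal{J}_i$ for each $i\in I$; 3. if $\mathcal{J}$ is a primitive ideal in $\mathcal{B}$, then there is an $i\in I$ such that $\mathcal{J}_i\subseteq\mathcal{J}$. Then $\mathcal{A}$ is approximately normal in $\mathcal{B}$.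
   Context: $\mathcal{Z}(\mathcal{B})$ is the center of $\mathcal{B}$; unital subalgebras contain the unit of $\mathcal{B}$. A primitive ideal is the kernel of an irreducible representation. $\mathcal{A}/(\mathcal{A}\cap\mathcal{J}_i)$ is identified with the image of $\mathcal{A}$ under the quotient map $\mathcal{B}\to\mathcal{B}/\mathcal{J}_i$. For a unital C*-algebra $\mathcal{B}$ and $\mathcal{S}\subseteq\mathcal{B}$, the relative approximate double commutant $\mathrm{Appr}(\mathcal{S},\mathcal{B})''$ is the set of all $T\in\mathcal{B}$ such that $\|TA_\lambda-A_\lambda T\|\to 0$ for every bounded net $\{A_\lambda\}$ in $\mathcal{B}$ for which $\|SA_\lambda-A_\lambda S\|\to 0$ for every $S\in\mathcal{S}$. A subalgebra $\mathcal{A}$ of $\mathcal{B}$ (selfadjoint or not) is approximately normal in $\mathcal{B}$ if $\mathcal{A}=\mathrm{Appr}(\mathcal{A},\mathcal{B})''$. *)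

theory Defs
  imports "HOL-Analysis.Analysis"
begin

section \<open>Unital C*-algebras\<close>

text \<open>
  The class does not assume 0 to differ from 1, so the zero algebra is included.
\<close>

class unital_cstar_algebra = real_normed_algebra + banach + monoid_mult +
  fixes scaleC :: "complex \<Rightarrow> 'a \<Rightarrow> 'a"  (infixr \<open>*\<^sub>C\<close> 75)
    and adj :: "'a \<Rightarrow> 'a"
  assumes scaleR_scaleC: "scaleR r x = complex_of_real r *\<^sub>C x"
    and scaleC_add_right: "c *\<^sub>C (x + y) = c *\<^sub>C x + c *\<^sub>C y"
    and scaleC_add_left: "(c + d) *\<^sub>C x = c *\<^sub>C x + d *\<^sub>C x"
    and scaleC_scaleC: "c *\<^sub>C d *\<^sub>C x = (c * d) *\<^sub>C x"
    and mult_scaleC_left: "(c *\<^sub>C x) * y = c *\<^sub>C (x * y)"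
    and mult_scaleC_right: "x * (c *\<^sub>C y) = c *\<^sub>C (x * y)"
    and norm_scaleC: "norm (c *\<^sub>C x) = cmod c * norm x"
    and adj_adj: "adj (adj x) = x"
    and adj_add: "adj (x + y) = adj x + adj y"
    and adj_scaleC: "adj (c *\<^sub>C x) = cnj c *\<^sub>C adj x"
    and adj_mult: "adj (x * y) = adj y * adj x"
    and cstar_identity: "norm (adj x * x) = (norm x)\<^sup>2"

instantiation complex :: unital_cstar_algebra
begin
definition scaleC_complex :: "complex \<Rightarrow> complex \<Rightarrow> complex" where "scaleC_complex = (*)"
definition adj_complex :: "complex \<Rightarrow> complex" where "adj_complex = cnj"
instance
  by standard
    (simp_all add: scaleC_complex_def adj_complex_def algebra_simps scaleR_conv_of_real
      norm_mult power2_eq_square)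
end

definition center :: "'a::unital_cstar_algebra set" where
  "center = {z. \<forall>b. z * b = b * z}"

definition complex_subspace :: "'a::unital_cstar_algebra set \<Rightarrow> bool" where
  "complex_subspace V \<longleftrightarrow>
     0 \<in> V \<and> (\<forall>x\<in>V. \<forall>y\<in>V. x + y \<in> V) \<and> (\<forall>c. \<forall>x\<in>V. c *\<^sub>C x \<in> V)"

definition unital_subalgebra :: "'a::unital_cstar_algebra set \<Rightarrow> bool" where
  "unital_subalgebra A \<longleftrightarrow> complex_subspace A \<and> 1 \<in> A \<and> (\<forall>x\<in>A. \<forall>y\<in>A. x * y \<in> A)"

definition commutative_set :: "'a::unital_cstar_algebra set \<Rightarrow> bool" where
  "commutative_set A \<longleftrightarrow> (\<forall>x\<in>A. \<forall>y\<in>A. x * y = y * x)"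

definition closed_ideal :: "'a::unital_cstar_algebra set \<Rightarrow> bool" where
  "closed_ideal J \<longleftrightarrow> closed J \<and> complex_subspace J \<and> (\<forall>b. \<forall>x\<in>J. b * x \<in> J \<and> x * b \<in> J)"


section \<open>Quotients\<close>

text \<open>
  A quotient depends on an ideal and therefore is not a type. The record collects the
  part of the structure of a C*-algebra to which the approximate double commutant
  refers; it serves both the algebra itself and its quotients.
\<close>

record 'x normed_alg =
  acarrier :: "'x set"
  amult :: "'x \<Rightarrow> 'x \<Rightarrow> 'x"
  aminus :: "'x \<Rightarrow> 'x \<Rightarrow> 'x"
  anorm :: "'x \<Rightarrow> real"

definition whole :: "'a::unital_cstar_algebra normed_alg" where
  "whole = \<lparr>acarrier = UNIV, amult = (*), aminus = (-), anorm = norm\<rparr>"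

definition coset :: "'a::unital_cstar_algebra set \<Rightarrow> 'a \<Rightarrow> 'a set" where
  "coset J x = {x + j | j. j \<in> J}"

definition quotient_alg :: "'a::unital_cstar_algebra set \<Rightarrow> 'a set normed_alg" where
  "quotient_alg J =
     \<lparr>acarrier = range (coset J),
      amult = (\<lambda>X Y. {x * y + j | x y j. x \<in> X \<and> y \<in> Y \<and> j \<in> J}),
      aminus = (\<lambda>X Y. {x - y | x y. x \<in> X \<and> y \<in> Y}),
      anorm = (\<lambda>X. INF x\<in>X. norm x)\<rparr>"

lemma closed_ideal_uminus: "closed_ideal J \<Longrightarrow> j \<in> J \<Longrightarrow> - j \<in> J"
  for J :: "'a::unital_cstar_algebra set"
  unfolding closed_ideal_def by (metis mult_1_left mult_minus_left)

lemma coset_minus: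
  assumes "closed_ideal J"
  shows "aminus (quotient_alg J) (coset J x) (coset J y) = coset J (x - y)"
proof -
  have add: "j + k \<in> J" if "j \<in> J" "k \<in> J" for j k
    using assms that by (auto simp: closed_ideal_def complex_subspace_def)
  have zero: "0 \<in> J" using assms by (auto simp: closed_ideal_def complex_subspace_def)
  have "\<exists>l. (x + j) - (y + k) = x - y + l \<and> l \<in> J" if "j \<in> J" "k \<in> J" for j k
    using add[OF that(1) closed_ideal_uminus[OF assms that(2)]]
    by (intro exI[of _ "j + - k"]) (simp add: algebra_simps)
  moreover have "\<exists>u v. x - y + j = u - v \<and> (\<exists>k. u = x + k \<and> k \<in> J) \<and> (\<exists>k. v = y + k \<and> k \<in> J)"
    if "j \<in> J" for j
    using that zero by (intro exI[of _ "x + j"] exI[of _ "y"]) (auto simp: algebra_simps)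
  ultimately show ?thesis
    unfolding quotient_alg_def coset_def by (auto; blast)
qed

lemma coset_mult:
  assumes "closed_ideal J"
  shows "amult (quotient_alg J) (coset J x) (coset J y) = coset J (x * y)"
proof -
  have add: "j + k \<in> J" if "j \<in> J" "k \<in> J" for j k
    using assms that by (auto simp: closed_ideal_def complex_subspace_def)
  have zero: "0 \<in> J" using assms by (auto simp: closed_ideal_def complex_subspace_def)
  have ml: "b * j \<in> J" and mr: "j * b \<in> J" if "j \<in> J" for b j
    using assms that by (auto simp: closed_ideal_def)
  have "\<exists>m. (x + j) * (y + k) + l = x * y + m \<and> m \<in> J" if "j \<in> J" "k \<in> J" "l \<in> J" for j k l
    using add[OF add[OF add[OF ml[OF that(2), of x] mr[OF that(1), of y]] ml[OF that(2), of j]] that(3)]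
    by (intro exI[of _ "x * k + j * y + j * k + l"]) (simp add: algebra_simps)
  moreover have "\<exists>u v l. x * y + j = u * v + l \<and> (\<exists>k. u = x + k \<and> k \<in> J) \<and>
      (\<exists>k. v = y + k \<and> k \<in> J) \<and> l \<in> J" if "j \<in> J" for j
    using that zero by (intro exI[of _ x] exI[of _ y] exI[of _ j]) auto
  ultimately show ?thesis
    unfolding quotient_alg_def coset_def by (auto; blast)
qed


section \<open>Nets and the relative approximate double commutant\<close>

definition directed :: "'l set \<Rightarrow> ('l \<Rightarrow> 'l \<Rightarrow> bool) \<Rightarrow> bool" where
  "directed D le \<longleftrightarrow> D \<noteq> {} \<and> reflp_on D le \<and> transp_on D le \<and>
     (\<forall>l\<in>D. \<forall>m\<in>D. \<exists>n\<in>D. le l n \<and> le m n)"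

definition net_limit :: "'l set \<Rightarrow> ('l \<Rightarrow> 'l \<Rightarrow> bool) \<Rightarrow> ('l \<Rightarrow> real) \<Rightarrow> real \<Rightarrow> bool" where
  "net_limit D le f c \<longleftrightarrow> (\<forall>e>0. \<exists>l\<^sub>0\<in>D. \<forall>l\<in>D. le l\<^sub>0 l \<longrightarrow> \<bar>f l - c\<bar> < e)"

definition bounded_net ::
  "'x normed_alg \<Rightarrow> 'l set \<Rightarrow> ('l \<Rightarrow> 'l \<Rightarrow> bool) \<Rightarrow> ('l \<Rightarrow> 'x) \<Rightarrow> bool" where
  "bounded_net B D le N \<longleftrightarrow> directed D le \<and>
     (\<exists>M. \<forall>l\<in>D. N l \<in> acarrier B \<and> anorm B (N l) \<le> M)"

definition asymp_commutes ::
  "'x normed_alg \<Rightarrow> 'l set \<Rightarrow> ('l \<Rightarrow> 'l \<Rightarrow> bool) \<Rightarrow> ('l \<Rightarrow> 'x) \<Rightarrow> 'x \<Rightarrow> bool" where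
  "asymp_commutes B D le N S \<longleftrightarrow>
     net_limit D le (\<lambda>l. anorm B (aminus B (amult B S (N l)) (amult B (N l) S))) 0"

text \<open>
  A definition cannot quantify over the types of index sets of nets. The index type
  \<open>'x set \<times> 'x\<close> loses nothing: every net in \<open>'x\<close> has the same tails as one
  indexed by the pairs of a tail and an element of it. See \<open>appr_double_commutant_any_net\<close>.
\<close>

definition appr_double_commutant :: "'x normed_alg \<Rightarrow> 'x set \<Rightarrow> 'x set" where
  "appr_double_commutant B \<S> =
     {T \<in> acarrier B. \<forall>(D :: ('x set \<times> 'x) set) le N.
        bounded_net B D le N \<longrightarrow> (\<forall>S\<in>\<S>. asymp_commutes B D le N S) \<longrightarrow>
        asymp_commutes B D le N T}"

definition approximately_normal :: "'x normed_alg \<Rightarrow> 'x set \<Rightarrow> bool" where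
  "approximately_normal B A \<longleftrightarrow> A = appr_double_commutant B A"

lemma appr_double_commutant_any_net:
  fixes D :: "'l set" and B :: "'x normed_alg"
  assumes T: "T \<in> appr_double_commutant B \<S>"
    and bn: "bounded_net B D le N"
    and comm: "\<forall>S\<in>\<S>. asymp_commutes B D le N S"
  shows "asymp_commutes B D le N T"
proof -
  define tl where "tl l = N ` {m\<in>D. le l m}" for l
  define D' where "D' = {(tl l, x) | l x. l \<in> D \<and> x \<in> tl l}"
  define le' :: "'x set \<times> 'x \<Rightarrow> 'x set \<times> 'x \<Rightarrow> bool"
    where "le' = (\<lambda>p q. fst q \<subseteq> fst p)"
  have dir: "directed D le" using bn by (simp add: bounded_net_def)
  have refl: "le l l" if "l \<in> D" for l
    using dir that by (auto simp: directed_def reflp_on_def)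
  have trans: "le l n" if "le l m" "le m n" "l \<in> D" "m \<in> D" "n \<in> D" for l m n
    using dir that unfolding directed_def transp_on_def by blast
  have tl_ne: "N l \<in> tl l" if "l \<in> D" for l using that refl by (auto simp: tl_def)
  have tl_mono: "tl m \<subseteq> tl l" if "le l m" "l \<in> D" "m \<in> D" for l m
    using that trans by (auto simp: tl_def)
  have lim: "net_limit D' le' (\<lambda>p. f (snd p)) 0 \<longleftrightarrow> net_limit D le (\<lambda>l. f (N l)) 0"
    for f :: "'x \<Rightarrow> real"
  proof
    assume L: "net_limit D' le' (\<lambda>p. f (snd p)) 0"
    show "net_limit D le (\<lambda>l. f (N l)) 0"
      unfolding net_limit_def
    proof (intro allI impI)
      fix e :: real assume "e > 0"
      then obtain p where p: "p \<in> D'" "\<forall>q\<in>D'. le' p q \<longrightarrow> \<bar>f (snd q) - 0\<bar> < e"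
        using L unfolding net_limit_def by blast
      then obtain l where l: "l \<in> D" "fst p = tl l" by (auto simp: D'_def)
      have "\<bar>f (N m) - 0\<bar> < e" if m: "m \<in> D" "le l m" for m
      proof -
        have "(tl m, N m) \<in> D'" using m tl_ne by (auto simp: D'_def)
        moreover have "le' p (tl m, N m)" using tl_mono l m by (simp add: le'_def)
        ultimately show ?thesis using p(2) by fastforce
      qed
      then show "\<exists>l\<^sub>0\<in>D. \<forall>l\<in>D. le l\<^sub>0 l \<longrightarrow> \<bar>f (N l) - 0\<bar> < e" using l by blast
    qed
  next
    assume L: "net_limit D le (\<lambda>l. f (N l)) 0"
    show "net_limit D' le' (\<lambda>p. f (snd p)) 0"
      unfolding net_limit_def
    proof (intro allI impI)
      fix e :: real assume "e > 0"
      then obtain l where l: "l \<in> D" "\<forall>m\<in>D. le l m \<longrightarrow> \<bar>f (N m) - 0\<bar> < e"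
        using L unfolding net_limit_def by blast
      have mem: "(tl l, N l) \<in> D'" using l tl_ne by (auto simp: D'_def)
      have "\<bar>f (snd q) - 0\<bar> < e" if q: "q \<in> D'" "le' (tl l, N l) q" for q
      proof -
        have "snd q \<in> fst q" using q by (auto simp: D'_def)
        then have "snd q \<in> tl l" using q by (auto simp: le'_def)
        then show ?thesis using l(2) by (auto simp: tl_def)
      qed
      then show "\<exists>p\<in>D'. \<forall>q\<in>D'. le' p q \<longrightarrow> \<bar>f (snd q) - 0\<bar> < e" using mem by blast
    qed
  qed
  have "directed D' le'"
    unfolding directed_def
  proof (intro conjI ballI)
    show "D' \<noteq> {}" using dir tl_ne by (fastforce simp: directed_def D'_def)
    show "reflp_on D' le'" "transp_on D' le'"
      by (auto simp: le'_def reflp_on_def transp_on_def)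
    fix p q assume "p \<in> D'" "q \<in> D'"
    then obtain l m where lm: "l \<in> D" "m \<in> D" "fst p = tl l" "fst q = tl m"
      by (auto simp: D'_def)
    then obtain n where n: "n \<in> D" "le l n" "le m n" using dir unfolding directed_def by blast
    then have "(tl n, N n) \<in> D'" "le' p (tl n, N n)" "le' q (tl n, N n)"
      using lm tl_ne tl_mono by (auto simp: D'_def le'_def)
    then show "\<exists>r\<in>D'. le' p r \<and> le' q r" by blast
  qed
  moreover have "\<exists>M. \<forall>p\<in>D'. snd p \<in> acarrier B \<and> anorm B (snd p) \<le> M"
    using bn by (fastforce simp: bounded_net_def D'_def tl_def)
  ultimately have "bounded_net B D' le' snd" by (simp add: bounded_net_def)
  moreover have eq: "asymp_commutes B D' le' snd S \<longleftrightarrow> asymp_commutes B D le N S" for S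
    unfolding asymp_commutes_def
    using lim[of "\<lambda>x. anorm B (aminus B (amult B S x) (amult B x S))"] by simp
  ultimately show ?thesis
    using T comm unfolding appr_double_commutant_def by blast
qed


section \<open>Hilbert spaces and primitive ideals\<close>

record 'h hilbert =
  hcarrier :: "'h set"
  hzero :: 'h
  hadd :: "'h \<Rightarrow> 'h \<Rightarrow> 'h"
  hscale :: "complex \<Rightarrow> 'h \<Rightarrow> 'h"
  hinner :: "'h \<Rightarrow> 'h \<Rightarrow> complex"

definition hnorm :: "'h hilbert \<Rightarrow> 'h \<Rightarrow> real" where
  "hnorm H x = sqrt (Re (hinner H x x))"

definition hdist :: "'h hilbert \<Rightarrow> 'h \<Rightarrow> 'h \<Rightarrow> real" where
  "hdist H x y = hnorm H (hadd H x (hscale H (-1) y))"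

locale complex_hilbert_space =
  fixes H :: "'h hilbert"
  assumes zero_closed: "hzero H \<in> hcarrier H"
    and add_closed: "\<lbrakk>x \<in> hcarrier H; y \<in> hcarrier H\<rbrakk> \<Longrightarrow> hadd H x y \<in> hcarrier H"
    and scale_closed: "x \<in> hcarrier H \<Longrightarrow> hscale H c x \<in> hcarrier H"
    and add_assoc: "\<lbrakk>x \<in> hcarrier H; y \<in> hcarrier H; z \<in> hcarrier H\<rbrakk>
          \<Longrightarrow> hadd H (hadd H x y) z = hadd H x (hadd H y z)"
    and add_commute: "\<lbrakk>x \<in> hcarrier H; y \<in> hcarrier H\<rbrakk> \<Longrightarrow> hadd H x y = hadd H y x"
    and add_zero: "x \<in> hcarrier H \<Longrightarrow> hadd H x (hzero H) = x"
    and add_uminus: "x \<in> hcarrier H \<Longrightarrow> hadd H x (hscale H (-1) x) = hzero H"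
    and scale_add_right: "\<lbrakk>x \<in> hcarrier H; y \<in> hcarrier H\<rbrakk>
          \<Longrightarrow> hscale H c (hadd H x y) = hadd H (hscale H c x) (hscale H c y)"
    and scale_add_left: "x \<in> hcarrier H
          \<Longrightarrow> hscale H (c + d) x = hadd H (hscale H c x) (hscale H d x)"
    and scale_scale: "x \<in> hcarrier H \<Longrightarrow> hscale H c (hscale H d x) = hscale H (c * d) x"
    and scale_one: "x \<in> hcarrier H \<Longrightarrow> hscale H 1 x = x"
    and inner_add_left: "\<lbrakk>x \<in> hcarrier H; y \<in> hcarrier H; z \<in> hcarrier H\<rbrakk>
          \<Longrightarrow> hinner H (hadd H x y) z = hinner H x z + hinner H y z"
    and inner_scale_left: "\<lbrakk>x \<in> hcarrier H; y \<in> hcarrier H\<rbrakk>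
          \<Longrightarrow> hinner H (hscale H c x) y = c * hinner H x y"
    and inner_commute: "\<lbrakk>x \<in> hcarrier H; y \<in> hcarrier H\<rbrakk>
          \<Longrightarrow> hinner H y x = cnj (hinner H x y)"
    and inner_nonneg: "x \<in> hcarrier H \<Longrightarrow> 0 \<le> Re (hinner H x x)"
    and inner_definite: "\<lbrakk>x \<in> hcarrier H; hinner H x x = 0\<rbrakk> \<Longrightarrow> x = hzero H"
    and complete: "\<lbrakk>\<And>n. X n \<in> hcarrier H;
            \<And>e. e > 0 \<Longrightarrow> \<exists>K. \<forall>m\<ge>K. \<forall>n\<ge>K. hdist H (X m) (X n) < e\<rbrakk>
          \<Longrightarrow> \<exists>x\<in>hcarrier H. (\<lambda>n. hdist H (X n) x) \<longlonglongrightarrow> 0"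

definition closed_hsubspace :: "'h hilbert \<Rightarrow> 'h set \<Rightarrow> bool" where
  "closed_hsubspace H K \<longleftrightarrow> K \<subseteq> hcarrier H \<and> hzero H \<in> K \<and>
     (\<forall>x\<in>K. \<forall>y\<in>K. hadd H x y \<in> K) \<and> (\<forall>c. \<forall>x\<in>K. hscale H c x \<in> K) \<and>
     (\<forall>X. \<forall>x\<in>hcarrier H. (\<forall>n. X n \<in> K) \<and> (\<lambda>n. hdist H (X n) x) \<longlonglongrightarrow> 0 \<longrightarrow> x \<in> K)"

lemma closed_hsubspaceI:
  assumes "K \<subseteq> hcarrier H" "hzero H \<in> K"
    and "\<And>x y. \<lbrakk>x \<in> K; y \<in> K\<rbrakk> \<Longrightarrow> hadd H x y \<in> K"
    and "\<And>c x. x \<in> K \<Longrightarrow> hscale H c x \<in> K"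
    and "\<And>X x. \<lbrakk>x \<in> hcarrier H; \<forall>n. X n \<in> K; (\<lambda>n. hdist H (X n) x) \<longlonglongrightarrow> 0\<rbrakk> \<Longrightarrow> x \<in> K"
  shows "closed_hsubspace H K"
  unfolding closed_hsubspace_def
proof (intro conjI allI ballI impI)
  show "x \<in> K" if "x \<in> hcarrier H" "(\<forall>n. X n \<in> K) \<and> (\<lambda>n. hdist H (X n) x) \<longlonglongrightarrow> 0" for X x
    using assms(5)[of x X] that by blast
qed (simp_all add: assms(1-4))

lemma closed_hsubspace_limit:
  assumes "closed_hsubspace H K" "x \<in> hcarrier H" "\<forall>n. X n \<in> K"
    "(\<lambda>n. hdist H (X n) x) \<longlonglongrightarrow> 0"
  shows "x \<in> K"
proof -
  have "\<forall>X. \<forall>x\<in>hcarrier H. (\<forall>n. X n \<in> K) \<and> (\<lambda>n. hdist H (X n) x) \<longlonglongrightarrow> 0 \<longrightarrow> x \<in> K"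
    using assms(1) unfolding closed_hsubspace_def by (elim conjE)
  then show ?thesis using assms(2-4) by (elim allE[of _ X] ballE[of _ _ x] impE) auto
qed

definition bounded_operator :: "'h hilbert \<Rightarrow> ('h \<Rightarrow> 'h) \<Rightarrow> bool" where
  "bounded_operator H T \<longleftrightarrow> (\<forall>x\<in>hcarrier H. T x \<in> hcarrier H) \<and>
     (\<forall>x\<in>hcarrier H. \<forall>y\<in>hcarrier H. T (hadd H x y) = hadd H (T x) (T y)) \<and>
     (\<forall>c. \<forall>x\<in>hcarrier H. T (hscale H c x) = hscale H c (T x)) \<and>
     (\<exists>M. \<forall>x\<in>hcarrier H. hnorm H (T x) \<le> M * hnorm H x)"

text \<open>
  Requiring \<open>\<pi> 1\<close> to be the identity only excludes the zero representation on a
  one-dimensional space among those without proper closed invariant subspaces.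
\<close>

definition star_representation ::
  "'h hilbert \<Rightarrow> ('a::unital_cstar_algebra \<Rightarrow> 'h \<Rightarrow> 'h) \<Rightarrow> bool" where
  "star_representation H \<pi> \<longleftrightarrow>
     (\<forall>a. bounded_operator H (\<pi> a)) \<and>
     (\<forall>x\<in>hcarrier H.
        \<pi> 1 x = x \<and>
        (\<forall>a b. \<pi> (a + b) x = hadd H (\<pi> a x) (\<pi> b x)) \<and>
        (\<forall>c a. \<pi> (c *\<^sub>C a) x = hscale H c (\<pi> a x)) \<and>
        (\<forall>a b. \<pi> (a * b) x = \<pi> a (\<pi> b x)) \<and>
        (\<forall>a. \<forall>y\<in>hcarrier H. hinner H (\<pi> a x) y = hinner H x (\<pi> (adj a) y)))"

definition irreducible_representation ::
  "'h hilbert \<Rightarrow> ('a::unital_cstar_algebra \<Rightarrow> 'h \<Rightarrow> 'h) \<Rightarrow> bool" where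
  "irreducible_representation H \<pi> \<longleftrightarrow> star_representation H \<pi> \<and> hcarrier H \<noteq> {hzero H} \<and>
     (\<forall>K. closed_hsubspace H K \<and> (\<forall>a. \<forall>x\<in>K. \<pi> a x \<in> K) \<longrightarrow>
        K = {hzero H} \<or> K = hcarrier H)"

definition rep_kernel ::
  "'h hilbert \<Rightarrow> ('a::unital_cstar_algebra \<Rightarrow> 'h \<Rightarrow> 'h) \<Rightarrow> 'a set" where
  "rep_kernel H \<pi> = {a. \<forall>x\<in>hcarrier H. \<pi> a x = hzero H}"

text \<open>
  As for nets, a type has to be fixed for the elements of the Hilbert spaces. Given an
  irreducible representation and a nonzero vector \<open>v\<close>, the map that takes \<open>x\<close>
  to the function \<open>\<lambda>b. \<langle>x, \<pi>(b) v\<rangle>\<close> is injective; so a copy of every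
  irreducible representation lives on a subset of \<open>'a \<Rightarrow> complex\<close>, and no
  primitive ideal is lost. See \<open>primitive_ideal_rep_kernel\<close>.
\<close>

definition primitive_ideal :: "'a::unital_cstar_algebra set \<Rightarrow> bool" where
  "primitive_ideal J \<longleftrightarrow> (\<exists>(H :: ('a \<Rightarrow> complex) hilbert) \<pi>.
     complex_hilbert_space H \<and> irreducible_representation H \<pi> \<and> J = rep_kernel H \<pi>)"

context complex_hilbert_space
begin

lemma inner_add_right:
  assumes "x \<in> hcarrier H" "y \<in> hcarrier H" "z \<in> hcarrier H"
  shows "hinner H x (hadd H y z) = hinner H x y + hinner H x z"
  using assms inner_commute[of "hadd H y z" x] inner_commute[of y x] inner_commute[of z x]
  by (simp add: inner_add_left add_closed)

lemma inner_scale_right: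
  assumes "x \<in> hcarrier H" "y \<in> hcarrier H"
  shows "hinner H x (hscale H c y) = cnj c * hinner H x y"
  using assms inner_commute[of "hscale H c y" x] inner_commute[of y x]
  by (simp add: inner_scale_left scale_closed)

lemma inner_self: "x \<in> hcarrier H \<Longrightarrow> hinner H x x = complex_of_real (Re (hinner H x x))"
  using inner_commute[of x x] by (simp add: complex_eq_iff)

lemma scale_zero_left: "x \<in> hcarrier H \<Longrightarrow> hscale H 0 x = hzero H"
  using scale_add_left[of x 1 "-1"] scale_one add_uminus by simp

lemma scale_zero_right: "hscale H c (hzero H) = hzero H"
  using scale_scale[OF zero_closed, of c 0] scale_zero_left[OF zero_closed] by simp

lemma inner_zero_left: "x \<in> hcarrier H \<Longrightarrow> hinner H (hzero H) x = 0"
  using inner_scale_left[of x x 0] scale_zero_left by simp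

lemma cauchy_schwarz:
  assumes x: "x \<in> hcarrier H" and y: "y \<in> hcarrier H"
  shows "cmod (hinner H x y) \<le> hnorm H x * hnorm H y"
proof (cases "Re (hinner H y y) = 0")
  case True
  then have "hinner H y y = 0" using inner_self[OF y] by simp
  then have "y = hzero H" using y inner_definite by blast
  then have "hinner H x y = 0"
    using inner_zero_left[OF x] inner_commute[OF zero_closed x] by simp
  then show ?thesis using x y by (simp add: hnorm_def inner_nonneg)
next
  case False
  define p q s where "p = Re (hinner H x x)" and "q = Re (hinner H y y)" and "s = hinner H x y"
  have q: "q > 0" using False inner_nonneg[OF y] by (simp add: q_def)
  define c where "c = - s / complex_of_real q"
  define w where "w = hadd H x (hscale H c y)"
  have w: "w \<in> hcarrier H" using x y by (simp add: w_def add_closed scale_closed)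
  have yx: "hinner H y x = cnj s" using inner_commute[OF x y] by (simp add: s_def)
  have "hinner H w w = hinner H x x + cnj c * s + c * cnj s + c * cnj c * hinner H y y"
    unfolding w_def using x y
    by (simp add: inner_add_left inner_add_right inner_scale_left inner_scale_right
        add_closed scale_closed s_def[symmetric] yx algebra_simps)
  also have "\<dots> = complex_of_real (p - (cmod s)\<^sup>2 / q)"
  proof -
    have ss: "s * cnj s = complex_of_real ((cmod s)\<^sup>2)" by (rule complex_norm_square[symmetric])
    have 1: "cnj c * s = - complex_of_real ((cmod s)\<^sup>2) / complex_of_real q"
      using ss by (simp add: c_def mult.commute)
    have 2: "c * cnj s = - complex_of_real ((cmod s)\<^sup>2) / complex_of_real q"
      using ss by (simp add: c_def)
    have 3: "c * cnj c * complex_of_real q = complex_of_real ((cmod s)\<^sup>2) / complex_of_real q"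
      using ss q by (simp add: c_def power2_eq_square)
    show ?thesis
      using inner_self[OF x] inner_self[OF y] 1 2 3 unfolding p_def[symmetric] q_def[symmetric]
      by simp
  qed
  finally have "Re (hinner H w w) = p - (cmod s)\<^sup>2 / q" by simp
  then have "(cmod s)\<^sup>2 / q \<le> p" using inner_nonneg[OF w] by linarith
  then have "(cmod s)\<^sup>2 \<le> p * q" using q by (simp add: divide_le_eq)
  then have "cmod s \<le> sqrt (p * q)" by (simp add: real_le_rsqrt)
  then show ?thesis by (simp add: hnorm_def p_def q_def s_def real_sqrt_mult)
qed

end

lemma irreducible_transport:
  fixes H :: "'h hilbert" and \<pi> :: "'a::unital_cstar_algebra \<Rightarrow> 'h \<Rightarrow> 'h" and \<phi> :: "'h \<Rightarrow> 'k"
  assumes hs: "complex_hilbert_space H" and irr: "irreducible_representation H \<pi>"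
    and inj: "inj_on \<phi> (hcarrier H)"
  shows "\<exists>(H' :: 'k hilbert) \<pi>'. complex_hilbert_space H' \<and>
           irreducible_representation H' \<pi>' \<and> rep_kernel H' \<pi>' = rep_kernel H \<pi>"
proof -
  interpret complex_hilbert_space H by (rule hs)
  define \<psi> where "\<psi> = inv_into (hcarrier H) \<phi>"
  have psi [simp]: "\<psi> (\<phi> x) = x" if "x \<in> hcarrier H" for x
    using inj that by (simp add: \<psi>_def)
  define H' where "H' = \<lparr>hcarrier = \<phi> ` hcarrier H, hzero = \<phi> (hzero H),
     hadd = (\<lambda>x y. \<phi> (hadd H (\<psi> x) (\<psi> y))), hscale = (\<lambda>c x. \<phi> (hscale H c (\<psi> x))),
     hinner = (\<lambda>x y. hinner H (\<psi> x) (\<psi> y))\<rparr>"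
  define \<pi>' where "\<pi>' = (\<lambda>a x. \<phi> (\<pi> a (\<psi> x)))"
  have sel: "hcarrier H' = \<phi> ` hcarrier H" "hzero H' = \<phi> (hzero H)"
    "hadd H' = (\<lambda>x y. \<phi> (hadd H (\<psi> x) (\<psi> y)))"
    "hscale H' = (\<lambda>c x. \<phi> (hscale H c (\<psi> x)))"
    "hinner H' = (\<lambda>x y. hinner H (\<psi> x) (\<psi> y))"
    by (simp_all add: H'_def)
  note cl = zero_closed add_closed scale_closed
  have norm': "hnorm H' (\<phi> x) = hnorm H x" if "x \<in> hcarrier H" for x
    using that by (simp add: hnorm_def sel)
  have dist': "hdist H' (\<phi> x) (\<phi> y) = hdist H x y"
    if "x \<in> hcarrier H" "y \<in> hcarrier H" for x y
    using that by (simp add: hdist_def hnorm_def sel cl)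
  have hs': "complex_hilbert_space H'"
  proof
    fix X :: "nat \<Rightarrow> 'k"
    assume X: "\<And>n. X n \<in> hcarrier H'"
      and cau: "\<And>e. e > 0 \<Longrightarrow> \<exists>K. \<forall>m\<ge>K. \<forall>n\<ge>K. hdist H' (X m) (X n) < e"
    define Y where "Y n = \<psi> (X n)" for n
    have Y: "Y n \<in> hcarrier H" "X n = \<phi> (Y n)" for n
      using X[of n] by (auto simp: Y_def sel)
    have "\<exists>x\<in>hcarrier H. (\<lambda>n. hdist H (Y n) x) \<longlonglongrightarrow> 0"
      using cau Y dist' by (intro complete) simp_all
    then obtain x where "x \<in> hcarrier H" "(\<lambda>n. hdist H (Y n) x) \<longlonglongrightarrow> 0" by blast
    then have "\<phi> x \<in> hcarrier H'" "(\<lambda>n. hdist H' (X n) (\<phi> x)) \<longlonglongrightarrow> 0"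
      using Y dist' by (simp_all add: sel)
    then show "\<exists>x\<in>hcarrier H'. (\<lambda>n. hdist H' (X n) x) \<longlonglongrightarrow> 0" by blast
  next
    fix x y assume "x \<in> hcarrier H'" "y \<in> hcarrier H'"
    then show "hadd H' x y = hadd H' y x" by (auto simp: sel add_commute)
  next
    fix x y assume "x \<in> hcarrier H'" "y \<in> hcarrier H'"
    then show "hinner H' y x = cnj (hinner H' x y)"
      by (auto simp: sel intro: inner_commute)
  next
    fix x assume "x \<in> hcarrier H'" "hinner H' x x = 0"
    then show "x = hzero H'" using inner_definite by (auto simp: sel)
  qed (auto simp: sel cl add_assoc add_zero add_uminus scale_add_right scale_add_left
         scale_scale scale_one inner_add_left inner_scale_left inner_nonneg)
  have rep: "star_representation H \<pi>" and ne: "hcarrier H \<noteq> {hzero H}"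
    and noinv: "\<And>K. closed_hsubspace H K \<Longrightarrow> (\<And>a x. x \<in> K \<Longrightarrow> \<pi> a x \<in> K) \<Longrightarrow>
        K = {hzero H} \<or> K = hcarrier H"
    using irr by (auto simp: irreducible_representation_def)
  have pc: "\<pi> a x \<in> hcarrier H" if "x \<in> hcarrier H" for a x
    using rep that by (auto simp: star_representation_def bounded_operator_def)
  have "bounded_operator H' (\<pi>' a)" for a
  proof -
    have b: "bounded_operator H (\<pi> a)" using rep by (simp add: star_representation_def)
    then obtain M where "\<forall>x\<in>hcarrier H. hnorm H (\<pi> a x) \<le> M * hnorm H x"
      by (auto simp: bounded_operator_def)
    then have "\<forall>x\<in>hcarrier H'. hnorm H' (\<pi>' a x) \<le> M * hnorm H' x"
      using pc norm' by (auto simp: sel \<pi>'_def)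
    then show ?thesis
      using b pc unfolding bounded_operator_def by (auto simp: sel \<pi>'_def cl)
  qed
  then have rep': "star_representation H' \<pi>'"
    using rep pc unfolding star_representation_def by (auto simp: sel \<pi>'_def)
  have "K = {hzero H'} \<or> K = hcarrier H'"
    if K: "closed_hsubspace H' K" and inv: "\<forall>a. \<forall>x\<in>K. \<pi>' a x \<in> K" for K
  proof -
    define L where "L = {x \<in> hcarrier H. \<phi> x \<in> K}"
    have KL: "K = \<phi> ` L" using K by (auto simp: closed_hsubspace_def sel L_def)
    have lim: "x \<in> L" if "x \<in> hcarrier H" "\<forall>n. X n \<in> L" "(\<lambda>n. hdist H (X n) x) \<longlonglongrightarrow> 0" for X x
    proof -
      have XL: "X n \<in> hcarrier H" for n using that(2) by (simp add: L_def)
      then have "(\<lambda>n. hdist H' (\<phi> (X n)) (\<phi> x)) \<longlonglongrightarrow> 0" using that dist' by simp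
      moreover have "\<forall>n. \<phi> (X n) \<in> K" using that(2) by (simp add: L_def)
      moreover have "\<phi> x \<in> hcarrier H'" using that by (simp add: sel)
      ultimately have "\<phi> x \<in> K" by (intro closed_hsubspace_limit[OF K])
      then show ?thesis using that by (simp add: L_def)
    qed
    have 0: "hzero H \<in> L" using K by (auto simp: closed_hsubspace_def sel L_def cl)
    have 1: "hadd H x y \<in> L" if "x \<in> L" "y \<in> L" for x y
    proof -
      have "hadd H' (\<phi> x) (\<phi> y) \<in> K" using K that by (simp add: closed_hsubspace_def L_def)
      then show ?thesis using that by (simp add: sel L_def cl)
    qed
    have 2: "hscale H c x \<in> L" if "x \<in> L" for c x
    proof -
      have "hscale H' c (\<phi> x) \<in> K" using K that by (simp add: closed_hsubspace_def L_def)
      then show ?thesis using that by (simp add: sel L_def cl)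
    qed
    have "L \<subseteq> hcarrier H" by (auto simp: L_def)
    then have "closed_hsubspace H L" using 0 1 2 lim by (rule closed_hsubspaceI)
    moreover have "\<pi> a x \<in> L" if "x \<in> L" for a x
    proof -
      have "\<pi>' a (\<phi> x) \<in> K" using inv that by (simp add: L_def)
      then show ?thesis using that pc by (simp add: \<pi>'_def L_def)
    qed
    ultimately have "L = {hzero H} \<or> L = hcarrier H" by (rule noinv)
    then show ?thesis by (auto simp: KL sel)
  qed
  moreover have "hcarrier H' \<noteq> {hzero H'}"
  proof
    assume A: "hcarrier H' = {hzero H'}"
    have "x = hzero H" if "x \<in> hcarrier H" for x
      using A that inj_onD[OF inj _ that zero_closed] by (auto simp: sel)
    then show False using ne zero_closed by blast
  qed
  ultimately have "irreducible_representation H' \<pi>'"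
    using rep' by (auto simp: irreducible_representation_def)
  moreover have "rep_kernel H' \<pi>' = rep_kernel H \<pi>"
    using inj_onD[OF inj _ pc zero_closed] by (auto simp: rep_kernel_def sel \<pi>'_def)
  ultimately show ?thesis using hs' by blast
qed

lemma primitive_ideal_rep_kernel:
  fixes H :: "'h hilbert" and \<pi> :: "'a::unital_cstar_algebra \<Rightarrow> 'h \<Rightarrow> 'h"
  assumes hs: "complex_hilbert_space H" and irr: "irreducible_representation H \<pi>"
  shows "primitive_ideal (rep_kernel H \<pi>)"
proof -
  interpret complex_hilbert_space H by (rule hs)
  have rep: "star_representation H \<pi>" and ne: "hcarrier H \<noteq> {hzero H}"
    and noinv: "\<And>K. closed_hsubspace H K \<Longrightarrow> (\<And>a x. x \<in> K \<Longrightarrow> \<pi> a x \<in> K) \<Longrightarrow>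
        K = {hzero H} \<or> K = hcarrier H"
    using irr by (auto simp: irreducible_representation_def)
  have pc: "\<pi> a x \<in> hcarrier H" if "x \<in> hcarrier H" for a x
    using rep that by (auto simp: star_representation_def bounded_operator_def)
  obtain v where v: "v \<in> hcarrier H" "v \<noteq> hzero H" using ne zero_closed by blast
  define \<phi> where "\<phi> = (\<lambda>x b. hinner H x (\<pi> b v))"
  define K where "K = {x \<in> hcarrier H. \<forall>b. hinner H x (\<pi> b v) = 0}"
  have "x \<in> K" if x: "x \<in> hcarrier H" and X: "\<forall>n. X n \<in> K"
    and lim: "(\<lambda>n. hdist H (X n) x) \<longlonglongrightarrow> 0" for X x
  proof -
    have "hinner H x (\<pi> b v) = 0" for b
    proof -
      let ?y = "\<pi> b v"
      have y: "?y \<in> hcarrier H" using v pc by blast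
      have "cmod (hinner H x ?y) \<le> hdist H (X n) x * hnorm H ?y" for n
      proof -
        have Xn: "X n \<in> hcarrier H" "hinner H (X n) ?y = 0" using X by (auto simp: K_def)
        have "hinner H (hadd H (X n) (hscale H (-1) x)) ?y = - hinner H x ?y"
          using x y Xn by (simp add: inner_add_left inner_scale_left scale_closed)
        then show ?thesis
          using cauchy_schwarz[OF add_closed[OF Xn(1) scale_closed[OF x, of "-1"]] y]
          by (simp add: hdist_def)
      qed
      moreover have "(\<lambda>n. hdist H (X n) x * hnorm H ?y) \<longlonglongrightarrow> 0"
        using tendsto_mult_right[OF lim, of "hnorm H ?y"] by simp
      ultimately have "cmod (hinner H x ?y) \<le> 0"
        by (intro LIMSEQ_le_const) auto
      then show ?thesis by simp
    qed
    then show ?thesis using x by (simp add: K_def)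
  qed
  note lim = this
  have "closed_hsubspace H K"
  proof (rule closed_hsubspaceI)
    show "K \<subseteq> hcarrier H" "hzero H \<in> K"
      using v pc by (auto simp: K_def zero_closed inner_zero_left)
    show "hadd H x y \<in> K" if "x \<in> K" "y \<in> K" for x y
      using that v pc by (simp add: K_def add_closed inner_add_left)
    show "hscale H c x \<in> K" if "x \<in> K" for c x
      using that v pc by (simp add: K_def scale_closed inner_scale_left)
  qed (rule lim)
  moreover have "\<pi> a x \<in> K" if "x \<in> K" for a x
  proof -
    have "hinner H (\<pi> a x) (\<pi> b v) = hinner H x (\<pi> (adj a * b) v)" for b
      using rep that v pc unfolding star_representation_def by (simp add: K_def)
    then show ?thesis using that pc by (simp add: K_def)
  qed
  moreover have "v \<notin> K"
  proof
    assume "v \<in> K"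
    then have "hinner H v (\<pi> 1 v) = 0" by (simp add: K_def)
    moreover have "\<pi> 1 v = v" using rep v by (simp add: star_representation_def)
    ultimately show False using inner_definite v by simp
  qed
  ultimately have K0: "K = {hzero H}" using noinv v by blast
  have "inj_on \<phi> (hcarrier H)"
  proof (rule inj_onI)
    fix x y assume x: "x \<in> hcarrier H" and y: "y \<in> hcarrier H" and eq: "\<phi> x = \<phi> y"
    let ?m = "hscale H (-1) y"
    have m: "?m \<in> hcarrier H" using y scale_closed by blast
    have "hinner H (hadd H x ?m) (\<pi> b v) = 0" for b
      using fun_cong[OF eq, of b] x y m v pc
      by (simp add: \<phi>_def inner_add_left inner_scale_left)
    then have "hadd H x ?m = hzero H" using x m K0 add_closed by (auto simp: K_def)
    then have "hadd H (hadd H x ?m) y = y"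
      using y add_commute[OF zero_closed y] add_zero by simp
    moreover have "hadd H (hadd H x ?m) y = x"
      using x y m add_assoc[OF x m y] add_commute[OF m y] add_uminus[OF y] add_zero by simp
    ultimately show "x = y" by simp
  qed
  from irreducible_transport[OF hs irr this] show ?thesis
    unfolding primitive_ideal_def by metis
qed

end

theory Submission
  imports Defs
begin

text \<open>
  If \<open>P\<close> is a primitive ideal that does not contain \<open>J\<^sub>i\<close>, then it contains some other \<open>J\<^sub>j\<close>, so the
  image of \<open>\<Z> \<inter> J\<^sub>i\<close> in the quotient by \<open>P\<close> contains the unit. Since closed ideals are
  intersections of primitive ideals, \<open>J\<^sub>i\<close> is therefore generated by its central part and has
  approximate units \<open>1 - g\<close> with \<open>g\<close> central. Multiplication by such \<open>g\<close> lifts a bounded net that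
  asymptotically commutes with \<open>A\<close> modulo \<open>J\<^sub>i\<close> to one that does so in the whole algebra. Hence
  every \<open>T\<close> in the approximate double commutant lies in \<open>A + J\<^sub>i\<close> for all \<open>i\<close>, and the
  approximations \<open>a\<^sub>i \<in> A\<close> of \<open>T\<close> are glued with a central partition of unity.

  Primitive ideals come from extreme states. Positivity of \<open>h\<close> is expressed by
  \<open>\<parallel>t - h\<parallel> \<le> t\<close>, which avoids the functional calculus, and separability allows extreme
  states to be built by countably many one-step extensions instead of by compactness.
\<close>

section \<open>The order of a C*-algebra\<close>

text \<open>No partition of unity is written down. Local approximations of \<open>T\<close> come
  with central positive weights, and weights can be added. For each primitive ideal some square of a
  selfadjoint central element is a weight while the element itself lies outside the ideal. So the
  closed ideal generated by all weights lies in no primitive ideal, it contains 1, and a single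
  weight \<open>w\<close> satisfies \<open>M * w \<ge> 1\<close>. This argument takes the place of
  compactness of the spectrum of the center. Dividing the accumulated combination of elements of
  \<open>A\<close> by \<open>w\<close> stays in \<open>A\<close> because
  \<open>center \<subseteq> A\<close>. The obstacle is the error estimate: adding norms of the terms
  \<open>(T - a) * u\<close> would lose a factor that grows with their number. Operator inequalities
  between squares add without loss, and convexity of the square carries them over to the quotient by
  \<open>w\<close>. Central weights make this possible: they commute past \<open>T\<close> and
  \<open>a\<close>, and the elements \<open>x\<close> with \<open>adj x * x \<le> M * w\<close> are
  stable under multiplication on both sides.\<close>

lemma adj_one [simp]: "adj (1::'a::unital_cstar_algebra) = 1"
  by (metis adj_adj adj_mult mult_1_left mult_1_right)

lemma adj_scaleR: "adj (r *\<^sub>R x) = r *\<^sub>R adj x" for x :: "'a::unital_cstar_algebra"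
  by (simp add: scaleR_scaleC adj_scaleC)

lemma adj_zero [simp]: "adj (0::'a::unital_cstar_algebra) = 0"
  using adj_scaleR[of 0 "0::'a"] by simp

lemma adj_minus: "adj (- x) = - adj x" for x :: "'a::unital_cstar_algebra"
  using adj_scaleR[of "-1" x] by simp

lemma adj_diff: "adj (x - y) = adj x - adj y" for x :: "'a::unital_cstar_algebra"
  using adj_add[of x "- y"] by (simp add: adj_minus)

lemmas adj_simps = adj_add adj_diff adj_minus adj_scaleR adj_mult adj_adj adj_scaleC

lemma norm_adj [simp]: "norm (adj x) = norm x" for x :: "'a::unital_cstar_algebra"
proof -
  have "norm y \<le> norm (adj y)" for y :: 'a
  proof (cases "norm y = 0")
    case False
    have "norm y * norm y \<le> norm (adj y) * norm y"
      using norm_mult_ineq[of "adj y" y] by (simp add: cstar_identity power2_eq_square)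
    then show ?thesis using False by simp
  qed simp
  from this[of x] this[of "adj x"] show ?thesis by (simp add: adj_adj)
qed

text \<open>Only an inequality, because the zero algebra belongs to the class and its unit has norm
  0.\<close>

lemma norm_one_le: "norm (1::'a::unital_cstar_algebra) \<le> 1"
proof -
  have "norm (1::'a) = (norm (1::'a))\<^sup>2" using cstar_identity[of "1::'a"] by simp
  then show ?thesis by (auto simp: power2_eq_square)
qed

lemma norm_scaleR_one_le: "norm (t *\<^sub>R (1::'a::unital_cstar_algebra)) \<le> \<bar>t\<bar>"
  using norm_one_le[where 'a='a] by (simp add: mult_left_le)

lemma tendsto_adj: "(f \<longlongrightarrow> l) F \<Longrightarrow> ((\<lambda>n. adj (f n)) \<longlongrightarrow> adj l) F"
  for l :: "'a::unital_cstar_algebra"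
  unfolding tendsto_iff dist_norm by (simp add: adj_diff[symmetric])

lemma norm_square_selfadjoint:
  "adj k = k \<Longrightarrow> norm (k * k) = (norm k)\<^sup>2" for k :: "'a::unital_cstar_algebra"
  using cstar_identity[of k] by simp

lemma scaleC_ii_ii [simp]: "\<i> *\<^sub>C \<i> *\<^sub>C x = - (x::'a::unital_cstar_algebra)"
  using scaleR_scaleC[of "-1" x] by (simp add: scaleC_scaleC)

lemma scaleC_one [simp]: "1 *\<^sub>C x = (x::'a::unital_cstar_algebra)"
  using scaleR_scaleC[of 1 x] by simp

lemma scaleC_zero_right [simp]: "c *\<^sub>C 0 = (0::'a::unital_cstar_algebra)"
  using scaleC_add_right[of c 0 "0::'a"] by simp

lemma scaleC_minus_right: "c *\<^sub>C (- x) = - (c *\<^sub>C x)" for x :: "'a::unital_cstar_algebra"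
  using scaleC_add_right[of c x "- x"] by (simp add: eq_neg_iff_add_eq_0 add.commute)

lemma scaleC_minus_left: "(- c) *\<^sub>C x = - (c *\<^sub>C x)" for x :: "'a::unital_cstar_algebra"
proof -
  have "(- c) *\<^sub>C x = c *\<^sub>C (- 1) *\<^sub>R x" by (simp add: scaleR_scaleC scaleC_scaleC)
  then show ?thesis by (simp add: scaleC_minus_right)
qed

lemma scaleC_diff_right: "c *\<^sub>C (x - y) = c *\<^sub>C x - c *\<^sub>C y" for x :: "'a::unital_cstar_algebra"
  using scaleC_add_right[of c x "- y"] by (simp add: scaleC_minus_right)

text \<open>
  The limit \<open>y\<close> of the iteration \<open>y \<mapsto> (h + y\<^sup>2) / 2\<close> satisfies \<open>(1 - y)\<^sup>2 = 1 - h\<close>. The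
  iteration is dominated by the scalar one with \<open>h = 1\<close>, which increases to a limit at most 1.
\<close>

lemma sqrt_one_minus:
  fixes h :: "'a::unital_cstar_algebra"
  assumes sa: "adj h = h" and h: "norm h \<le> 1"
  obtains s where "adj s = s" "s * s = 1 - h" "norm (1 - s) \<le> 1"
    "\<forall>x. x * h = h * x \<longrightarrow> x * s = s * x"
proof -
  define y :: "nat \<Rightarrow> 'a" where "y = rec_nat 0 (\<lambda>_ z. (1/2) *\<^sub>R (h + z * z))"
  define t :: "nat \<Rightarrow> real" where "t = rec_nat 0 (\<lambda>_ z. (1 + z * z) / 2)"
  have y0: "y 0 = 0" and yS: "y (Suc n) = (1/2) *\<^sub>R (h + y n * y n)" for n
    by (simp_all add: y_def)
  have t0: "t 0 = 0" and tS: "t (Suc n) = (1 + t n * t n) / 2" for n by (simp_all add: t_def)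
  have t_nonneg: "0 \<le> t n" for n by (cases n) (simp_all add: t0 tS)
  have t_le: "t n \<le> 1" for n
  proof (induction n)
    case (Suc n)
    then show ?case using mult_mono[of "t n" 1 "t n" 1] t_nonneg[of n] by (simp add: tS)
  qed (simp add: t0)
  have comm: "x * y n = y n * x" if x: "x * h = h * x" for x n
  proof (induction n)
    case (Suc n)
    have "x * (y n * y n) = y n * y n * x" by (metis Suc mult.assoc)
    then show ?case by (simp add: yS x distrib_left distrib_right)
  qed (simp add: y0)
  have yh: "y n * h = h * y n" for n using comm[of h n] by simp
  have yy: "y m * y n = y n * y m" for m n using comm[OF yh] .
  have y_le: "norm (y n) \<le> t n" for n
  proof (induction n)
    case (Suc n)
    have "norm (h + y n * y n) \<le> 1 + t n * t n"
      using h norm_mult_ineq[of "y n" "y n"] mult_mono[OF Suc Suc] t_nonneg[of n]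
      by (intro norm_triangle_le) auto
    then show ?case by (simp add: yS tS)
  qed (simp add: y0 t0)
  \<comment> \<open>The iterates commute with each other, so a difference of their squares factors;
    its bound is the same factorisation for the scalars \<open>t\<close>. The telescoping series of
    \<open>y\<close> is thereby dominated by that of \<open>t\<close>.\<close>
  have step: "norm (y (Suc n) - y n) \<le> t (Suc n) - t n" for n
  proof (induction n)
    case 0
    show ?case using h by (simp add: yS y0 tS t0)
  next
    case (Suc n)
    have "y (Suc (Suc n)) - y (Suc n) = (1/2) *\<^sub>R (y (Suc n) * y (Suc n) - y n * y n)"
      by (simp add: yS algebra_simps)
    also have "\<dots> = (1/2) *\<^sub>R ((y (Suc n) - y n) * (y (Suc n) + y n))"
      using yy[of n "Suc n"] by (simp add: algebra_simps)
    finally have "norm (y (Suc (Suc n)) - y (Suc n))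
        \<le> norm (y (Suc n) - y n) * norm (y (Suc n) + y n) / 2"
      using norm_mult_ineq[of "y (Suc n) - y n" "y (Suc n) + y n"] by simp
    also have "\<dots> \<le> (t (Suc n) - t n) * (t (Suc n) + t n) / 2"
      using Suc y_le[of n] y_le[of "Suc n"] norm_triangle_ineq[of "y (Suc n)" "y n"] order_trans[OF norm_ge_zero Suc]
      by (intro divide_right_mono mult_mono) auto
    also have "\<dots> = t (Suc (Suc n)) - t (Suc n)"
      unfolding tS[of "Suc n"] tS[of n] by (simp add: field_simps)
    finally show ?case .
  qed
  have t_inc: "t n \<le> t (Suc n)" for n using step[of n] norm_ge_zero[of "y (Suc n) - y n"] by linarith
  obtain l where "t \<longlonglongrightarrow> l"
    using incseq_convergent[of t 1] incseq_SucI[of t] t_inc t_le by blast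
  then have "summable (\<lambda>n. t (Suc n) - t n)" by (rule telescope_summable)
  then have "summable (\<lambda>n. y (Suc n) - y n)"
    by (rule summable_comparison_test') (use step in auto)
  then have "(\<lambda>n. \<Sum>i<n. y (Suc i) - y i) \<longlonglongrightarrow> (\<Sum>n. y (Suc n) - y n)"
    by (rule summable_LIMSEQ)
  then obtain z where z: "y \<longlonglongrightarrow> z" by (auto simp: sum_lessThan_telescope y0)
  have lim2: "(\<lambda>n. y (Suc n)) \<longlonglongrightarrow> (1/2) *\<^sub>R (h + z * z)"
    unfolding yS by (intro tendsto_intros z)
  have fix_z: "z = (1/2) *\<^sub>R (h + z * z)"
    using LIMSEQ_unique[OF LIMSEQ_Suc[OF z] lim2] .
  have "adj (y n) = y n" for n
    by (induction n) (simp_all add: y0 yS adj_simps sa)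
  then have z_adj: "adj z = z" using LIMSEQ_unique[OF tendsto_adj[OF z]] z by simp
  have z_sq: "(1 - z) * (1 - z) = 1 - h"
  proof -
    have "2 *\<^sub>R z = h + z * z" using arg_cong[OF fix_z, of "scaleR 2"] by simp
    then have "z + z = h + z * z" by (simp add: scaleR_2)
    then show ?thesis by (simp add: algebra_simps)
  qed
  have z_le: "norm z \<le> 1"
    using Lim_norm_ubound[OF trivial_limit_sequentially z, of 1] y_le t_le
    by (meson always_eventually order_trans)
  have z_comm: "\<forall>x. x * h = h * x \<longrightarrow> x * (1 - z) = (1 - z) * x"
  proof (intro allI impI)
    fix x assume "x * h = h * x"
    then have "x * z = z * x"
      using LIMSEQ_unique[OF tendsto_mult_left[OF z, of x]] tendsto_mult_right[OF z, of x] comm[of x]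
      by simp
    then show "x * (1 - z) = (1 - z) * x" by (simp add: left_diff_distrib right_diff_distrib)
  qed
  \<comment> \<open>The root is \<open>1 - z\<close>. The bound on \<open>1 - (1 - z) = z\<close>
    says that this root is positive in the sense of \<open>pos\<close>, with 1 as the
    witness.\<close>
  show thesis
    by (rule that[of "1 - z", OF _ z_sq _ z_comm]) (simp_all add: z_adj z_le adj_diff)
qed

text \<open>\<open>s + \<i> k\<close> is a multiple of a unitary, and \<open>k\<close> is its imaginary part.\<close>

lemma norm_square_le_of_sum:
  fixes s k :: "'a::unital_cstar_algebra"
  assumes "adj s = s" "adj k = k" "s * k = k * s" "s * s + k * k = t *\<^sub>R 1" "0 \<le> t"
  shows "(norm k)\<^sup>2 \<le> t"
proof -
  define u where "u = s + \<i> *\<^sub>C k"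
  have adj_u: "adj u = s - \<i> *\<^sub>C k"
    using assms by (simp add: u_def adj_simps scaleC_minus_left)
  have "adj u * u = t *\<^sub>R 1"
    unfolding adj_u unfolding u_def using assms(3) assms(4)[symmetric]
    by (simp add: distrib_left distrib_right left_diff_distrib right_diff_distrib
      mult_scaleC_left mult_scaleC_right scaleC_diff_right)
  then have "(norm u)\<^sup>2 \<le> t"
    using cstar_identity[of u] norm_scaleR_one_le[of t, where 'a='a] assms(5) by simp
  moreover have "norm k \<le> norm u"
  proof -
    have "u - adj u = 2 *\<^sub>R (\<i> *\<^sub>C k)" unfolding adj_u unfolding u_def by (simp add: scaleR_2)
    then have "norm (u - adj u) = 2 * norm k" by (simp add: norm_scaleC)
    then show ?thesis using norm_triangle_ineq4[of u "adj u"] by simp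
  qed
  ultimately show ?thesis by (meson norm_ge_zero order_trans power_mono)
qed

section \<open>The cone of positive elements\<close>

definition pos :: "'a::unital_cstar_algebra \<Rightarrow> bool" where
  "pos h \<longleftrightarrow> adj h = h \<and> (\<exists>t. norm (t *\<^sub>R 1 - h) \<le> t)"

lemma pos_adj: "pos h \<Longrightarrow> adj h = h"
  by (simp add: pos_def)

lemma pos_add:
  assumes "pos h" "pos k"
  shows "pos (h + k)"
proof -
  obtain s t where st: "norm (s *\<^sub>R 1 - h) \<le> s" "norm (t *\<^sub>R 1 - k) \<le> t"
    using assms by (auto simp: pos_def)
  have "(s + t) *\<^sub>R 1 - (h + k) = (s *\<^sub>R 1 - h) + (t *\<^sub>R 1 - k)" by (simp add: algebra_simps)
  then have "norm ((s + t) *\<^sub>R 1 - (h + k)) \<le> s + t"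
    using st by (metis add_mono norm_triangle_le)
  then show ?thesis using assms unfolding pos_def by (auto simp: adj_simps)
qed

lemma pos_scaleR:
  assumes "pos h" "0 \<le> r"
  shows "pos (r *\<^sub>R h)"
proof -
  obtain t where t: "norm (t *\<^sub>R 1 - h) \<le> t" using assms by (auto simp: pos_def)
  have "(r * t) *\<^sub>R 1 - r *\<^sub>R h = r *\<^sub>R (t *\<^sub>R 1 - h)" by (simp add: scaleR_diff_right)
  then have "norm ((r * t) *\<^sub>R 1 - r *\<^sub>R h) \<le> r * t"
    using t assms(2) by (simp add: mult_left_mono)
  then show ?thesis using assms unfolding pos_def by (auto simp: adj_simps)
qed

lemma pos_one [simp]: "pos 1"
  by (auto simp: pos_def intro!: exI[of _ 1])

lemma pos_zero [simp]: "pos 0"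
  using pos_scaleR[OF pos_one, of 0] by simp

lemma pos_scaleR_one: "0 \<le> t \<Longrightarrow> pos (t *\<^sub>R 1)"
  by (simp add: pos_scaleR)

text \<open>Division by the witness \<open>t\<close> puts \<open>h\<close> at distance at most 1
  from the unit, where \<open>sqrt_one_minus\<close> applies. The commutation clause does the work
  of the functional calculus: the root commutes with all that commutes with
  \<open>h\<close>.\<close>

lemma pos_sqrt:
  fixes h :: "'a::unital_cstar_algebra"
  assumes "pos h"
  obtains s where "pos s" "s * s = h" "\<forall>x. x * h = h * x \<longrightarrow> x * s = s * x"
proof -
  obtain t where t: "norm (t *\<^sub>R 1 - h) \<le> t" using assms by (auto simp: pos_def)
  show thesis
  proof (cases "t \<le> 0")
    case True
    then have "t = 0" using t norm_ge_zero order_trans by (metis order_antisym)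
    then have "h = 0" using t by simp
    then show thesis by (intro that[of 0]) auto
  next
    case False
    define k where "k = 1 - (1/t) *\<^sub>R h"
    have "k = (1/t) *\<^sub>R (t *\<^sub>R 1 - h)" using False by (simp add: k_def algebra_simps)
    then have nk: "norm k \<le> 1" using t False by (simp add: divide_le_eq)
    have ak: "adj k = k" using assms by (simp add: k_def adj_simps pos_adj)
    obtain s where s: "adj s = s" "s * s = 1 - k" "norm (1 - s) \<le> 1"
      "\<forall>x. x * k = k * x \<longrightarrow> x * s = s * x"
      by (rule sqrt_one_minus[OF ak nk]) (rule that)
    have "pos s" unfolding pos_def using s(1,3) by (intro conjI exI[of _ 1]) auto
    then have "pos (sqrt t *\<^sub>R s)" using False by (intro pos_scaleR) auto
    moreover have "(sqrt t *\<^sub>R s) * (sqrt t *\<^sub>R s) = h"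
      using False s(2) by (simp add: k_def)
    moreover have "\<forall>x. x * h = h * x \<longrightarrow> x * (sqrt t *\<^sub>R s) = sqrt t *\<^sub>R s * x"
    proof (intro allI impI)
      fix x assume "x * h = h * x"
      then show "x * (sqrt t *\<^sub>R s) = sqrt t *\<^sub>R s * x"
        using s(4)[rule_format, of x] by (simp add: k_def algebra_simps)
    qed
    ultimately show thesis by (rule that)
  qed
qed

text \<open>The root \<open>r\<close> of \<open>t - k * k\<close> commutes with \<open>k\<close>,
  and the two squares add up to \<open>t\<close>. So \<open>norm_square_le_of_sum\<close>, with
  \<open>r\<close> as the element to be bounded, gives \<open>norm r ^ 2 \<le> t\<close>.\<close>

lemma norm_diff_square_le:
  fixes k :: "'a::unital_cstar_algebra"
  assumes sa: "adj k = k" and t: "(norm k)\<^sup>2 \<le> t"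
  shows "norm (t *\<^sub>R 1 - k * k) \<le> t"
proof (cases "t = 0")
  case True
  then show ?thesis using t by simp
next
  case False
  then have tp: "t > 0" using t zero_le_power2[of "norm k"] by linarith
  define h where "h = (1/t) *\<^sub>R (k * k)"
  have nh: "norm h \<le> 1" using t tp by (simp add: h_def norm_square_selfadjoint[OF sa] divide_le_eq)
  have ah: "adj h = h" using sa by (simp add: h_def adj_simps)
  obtain s where s: "adj s = s" "s * s = 1 - h" "norm (1 - s) \<le> 1"
      "\<forall>x. x * h = h * x \<longrightarrow> x * s = s * x"
    by (rule sqrt_one_minus[OF ah nh]) (rule that)
  define r where "r = sqrt t *\<^sub>R s"
  have ra: "adj r = r" using s(1) by (simp add: r_def adj_simps)
  have rr: "r * r = t *\<^sub>R 1 - k * k"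
    using s(2) tp by (simp add: r_def h_def scaleR_diff_right)
  have "k * r = r * k" using s(4)[rule_format, of k] by (simp add: r_def h_def mult.assoc)
  then have "(norm r)\<^sup>2 \<le> t"
    using tp rr by (intro norm_square_le_of_sum[OF sa ra]) auto
  then show ?thesis using norm_square_selfadjoint[OF ra] rr by simp
qed

lemma pos_square: "adj k = k \<Longrightarrow> pos (k * k)" for k :: "'a::unital_cstar_algebra"
  using norm_diff_square_le[of k "(norm k)\<^sup>2"] by (auto simp: pos_def adj_simps)

text \<open>The definition of \<open>pos\<close> supplies some witness \<open>t\<close>; writing
  \<open>h\<close> as a square shows that every bound of the norm is one. A convergent sequence
  therefore has a common witness, which makes the cone closed.\<close>

lemma pos_norm_diff:
  fixes h :: "'a::unital_cstar_algebra"
  assumes "pos h" "norm h \<le> t"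
  shows "norm (t *\<^sub>R 1 - h) \<le> t"
proof -
  obtain s where s: "pos s" "s * s = h" using assms pos_sqrt by metis
  then show ?thesis
    using norm_diff_square_le[of s t] norm_square_selfadjoint[of s] assms(2) pos_adj by metis
qed

lemma pos_norm_minus:
  fixes h :: "'a::unital_cstar_algebra"
  assumes sa: "adj h = h" and t: "norm h \<le> t"
  shows "pos (t *\<^sub>R 1 - h)"
proof -
  have "norm (t *\<^sub>R 1 - (t *\<^sub>R 1 - h)) \<le> t" using t by simp
  then show ?thesis unfolding pos_def using sa by (intro conjI exI[of _ t]) (auto simp: adj_simps)
qed

lemma pos_limit:
  fixes h :: "'a::unital_cstar_algebra"
  assumes X: "\<And>n. pos (X n)" and lim: "X \<longlonglongrightarrow> h"
  shows "pos h"
proof -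
  have "Bseq X" using lim convergentI convergent_imp_Bseq by blast
  then obtain t where t: "\<And>n. norm (X n) \<le> t" unfolding Bseq_def by blast
  have n: "norm (t *\<^sub>R 1 - X n) \<le> t" for n using pos_norm_diff[OF X t] .
  moreover have "(\<lambda>n. t *\<^sub>R 1 - X n) \<longlonglongrightarrow> t *\<^sub>R 1 - h" by (intro tendsto_intros lim)
  ultimately have "norm (t *\<^sub>R 1 - h) \<le> t"
    using Lim_norm_ubound[OF trivial_limit_sequentially] n by (auto intro!: always_eventually)
  moreover have "adj h = h"
    using LIMSEQ_unique[OF tendsto_adj[OF lim]] lim pos_adj[OF X] by simp
  ultimately show ?thesis by (auto simp: pos_def)
qed

lemma pos_of_perturb:
  fixes h :: "'a::unital_cstar_algebra"
  assumes "\<And>e. e > 0 \<Longrightarrow> pos (h + e *\<^sub>R 1)"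
  shows "pos h"
proof (rule pos_limit)
  show "pos (h + inverse (real (Suc n)) *\<^sub>R 1)" for n by (rule assms) simp
  have "(\<lambda>n. h + inverse (real (Suc n)) *\<^sub>R 1) \<longlonglongrightarrow> h + 0 *\<^sub>R 1"
    by (intro tendsto_intros LIMSEQ_inverse_real_of_nat)
  then show "(\<lambda>n. h + inverse (real (Suc n)) *\<^sub>R 1) \<longlonglongrightarrow> h" by simp
qed

text \<open>The roots of commuting factors commute, so the product is the square of a selfadjoint
  element.\<close>

lemma pos_mult:
  fixes h k :: "'a::unital_cstar_algebra"
  assumes "pos h" "pos k" "h * k = k * h"
  shows "pos (h * k)"
proof -
  obtain s where s: "pos s" "s * s = h" "\<forall>x. x * h = h * x \<longrightarrow> x * s = s * x"
    by (rule pos_sqrt[OF assms(1)]) (rule that)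
  obtain r where r: "pos r" "r * r = k" "\<forall>x. x * k = k * x \<longrightarrow> x * r = r * x"
    by (rule pos_sqrt[OF assms(2)]) (rule that)
  have "k * s = s * k" using s(3)[rule_format, of k] assms(3) by simp
  then have sr: "s * r = r * s" using r(3)[rule_format, of s] by simp
  then have "adj (s * r) = s * r" using s(1) r(1) by (simp add: adj_simps pos_adj)
  moreover have "h * k = (s * r) * (s * r)" by (metis mult.assoc r(2) s(2) sr)
  ultimately show ?thesis using pos_square by metis
qed

text \<open>The roots of \<open>h\<close> and of \<open>r - h\<close> commute and their squares add
  up to \<open>r\<close>. The number \<open>t\<close> may be negative, whence the maximum;
  \<open>norm_plus_square_ge\<close> applies it to a \<open>t\<close> of unknown sign.\<close>

lemma pos_norm_le_max:
  fixes h :: "'a::unital_cstar_algebra"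
  assumes "pos h" "pos (t *\<^sub>R 1 - h)"
  shows "norm h \<le> max 0 t"
proof -
  define r where "r = max 0 t"
  have "r *\<^sub>R 1 - h = (t *\<^sub>R 1 - h) + (r - t) *\<^sub>R 1" by (simp add: algebra_simps)
  moreover have "pos ((t *\<^sub>R 1 - h) + (r - t) *\<^sub>R 1)"
    by (intro pos_add assms pos_scaleR_one) (simp add: r_def)
  ultimately have "pos (r *\<^sub>R 1 - h)" by metis
  then obtain s where s: "pos s" "s * s = r *\<^sub>R 1 - h"
     "\<forall>x. x * (r *\<^sub>R 1 - h) = (r *\<^sub>R 1 - h) * x \<longrightarrow> x * s = s * x"
    by (rule pos_sqrt) (rule that)
  obtain k where k: "pos k" "k * k = h" "\<forall>x. x * h = h * x \<longrightarrow> x * k = k * x"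
    by (rule pos_sqrt[OF assms(1)]) (rule that)
  have "h * s = s * h" using s(3)[rule_format, of h] by (simp add: algebra_simps)
  then have "s * k = k * s" using k(3)[rule_format, of s] by simp
  then have "(norm k)\<^sup>2 \<le> r"
    using s(1,2) k(1,2) by (intro norm_square_le_of_sum[of s k r]) (auto simp: pos_adj r_def)
  then show ?thesis using norm_square_selfadjoint[OF pos_adj[OF k(1)]] k(2) r_def by simp
qed

lemma pos_norm_le: "pos h \<Longrightarrow> pos (t *\<^sub>R 1 - h) \<Longrightarrow> 0 \<le> t \<Longrightarrow> norm h \<le> t"
  using pos_norm_le_max[of h t] by simp

section \<open>Inverses, absolute values and positivity of \<open>adj x * x\<close>\<close>

lemma neumann_inverse:
  fixes x :: "'a::unital_cstar_algebra"
  assumes "norm (1 - x) < 1"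
  obtains r where "x * r = 1" "r * x = 1"
proof -
  define k where "k = 1 - x"
  have pw: "norm (k ^ n) \<le> norm k ^ n" for n
  proof (induction n)
    case 0
    show ?case using norm_one_le by simp
  next
    case (Suc n)
    then show ?case using norm_mult_ineq[of k "k ^ n"] mult_left_mono[OF Suc norm_ge_zero[of k]] by simp
  qed
  have "summable (\<lambda>n. norm k ^ n)" using assms by (intro summable_geometric) (simp add: k_def)
  then have sm: "summable (\<lambda>n. k ^ n)"
    by (rule summable_comparison_test') (use pw in auto)
  define r where "r = (\<Sum>n. k ^ n)"
  have S: "(\<lambda>n. \<Sum>i<n. k ^ i) \<longlonglongrightarrow> r" using summable_LIMSEQ[OF sm] by (simp add: r_def)
  have z: "(\<lambda>n. 1 - k ^ n) \<longlonglongrightarrow> 1 - 0"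
    by (intro tendsto_intros summable_LIMSEQ_zero sm)
  have tel: "x * (\<Sum>i<n. k ^ i) = 1 - k ^ n" "(\<Sum>i<n. k ^ i) * x = 1 - k ^ n" for n
  proof (induction n)
    case (Suc n)
    have "x = 1 - k" by (simp add: k_def)
    then have "x * k ^ n = k ^ n - k ^ Suc n" "k ^ n * x = k ^ n - k ^ Suc n"
      by (simp_all add: left_diff_distrib right_diff_distrib power_commutes)
    then show "x * (\<Sum>i<Suc n. k ^ i) = 1 - k ^ Suc n" "(\<Sum>i<Suc n. k ^ i) * x = 1 - k ^ Suc n"
      using Suc by (simp_all add: distrib_left distrib_right)
  qed auto
  have "x * r = 1"
    using LIMSEQ_unique[OF tendsto_mult_left[OF S, of x]] z by (simp add: tel)
  moreover have "r * x = 1"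
    using LIMSEQ_unique[OF tendsto_mult_right[OF S, of x]] z by (simp add: tel)
  ultimately show thesis by (rule that)
qed

text \<open>With \<open>t = norm m\<close>, the element \<open>(m + d) / (t + d)\<close> has
  distance at most \<open>t / (t + d) < 1\<close> from the unit and is inverted by the Neumann
  series. Positivity of \<open>r\<close> comes from \<open>r = r * r * (m + d)\<close>, that of
  \<open>1 - d * r\<close> from its being \<open>m * r\<close>.\<close>

lemma pos_shift_inverse:
  fixes m :: "'a::unital_cstar_algebra"
  assumes m: "pos m" and d: "d > 0"
  obtains r where "(m + d *\<^sub>R 1) * r = 1" "r * (m + d *\<^sub>R 1) = 1" "pos r" "pos (1 - d *\<^sub>R r)"
    "\<forall>x. x * m = m * x \<longrightarrow> x * r = r * x"
proof -
  define t where "t = norm m"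
  define q where "q = m + d *\<^sub>R 1"
  have td: "t + d > 0" using d norm_ge_zero[of m] unfolding t_def by linarith
  have "1 - (1 / (t + d)) *\<^sub>R q = (1 / (t + d)) *\<^sub>R ((t + d) *\<^sub>R 1 - q)"
    using td by (simp add: scaleR_diff_right)
  also have "(t + d) *\<^sub>R 1 - q = t *\<^sub>R 1 - m" by (simp add: q_def algebra_simps)
  finally have "norm (1 - (1 / (t + d)) *\<^sub>R q) \<le> t / (t + d)"
    using pos_norm_diff[OF m, of t] td by (simp add: t_def divide_right_mono)
  also have "\<dots> < 1" using td d by (simp add: divide_less_eq)
  finally obtain r0 where r0: "(1 / (t + d)) *\<^sub>R q * r0 = 1" "r0 * (1 / (t + d)) *\<^sub>R q = 1"
    using neumann_inverse by blast
  define r where "r = (1 / (t + d)) *\<^sub>R r0"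
  have qr: "q * r = 1" and rq: "r * q = 1" using r0 by (simp_all add: r_def)
  have comm: "x * r = r * x" if "x * m = m * x" for x
  proof -
    have xq: "x * q = q * x" using that by (simp add: q_def algebra_simps)
    have "x * r = r * q * (x * r)" by (simp add: rq)
    also have "\<dots> = r * x * (q * r)" by (metis mult.assoc xq)
    finally show ?thesis by (simp add: qr)
  qed
  have pq: "pos q" unfolding q_def using m d by (intro pos_add pos_scaleR_one) auto
  have ra: "adj r = r"
  proof -
    have "adj r * q = 1" using arg_cong[OF qr, of adj] pq by (simp add: adj_simps pos_adj)
    then have "adj r = adj r * (q * r)" by (simp add: qr)
    also have "\<dots> = r" using \<open>adj r * q = 1\<close> by (simp add: mult.assoc[symmetric])
    finally show ?thesis .
  qed
  have mr: "m * r = r * m" using comm by simp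
  have "r * r * q = q * (r * r)"
    by (simp add: mult.assoc rq) (simp add: mult.assoc[symmetric] qr)
  then have "pos (r * r * q)" using ra pq by (intro pos_mult pos_square)
  then have pr: "pos r" by (simp add: mult.assoc rq)
  have "1 - d *\<^sub>R r = m * r" using qr by (simp add: q_def algebra_simps)
  then have "pos (1 - d *\<^sub>R r)" using pos_mult[OF m pr mr] by simp
  with qr rq pr show thesis by (intro that[of r] allI impI comm) (simp_all add: q_def)
qed

text \<open>The element \<open>a\<close> is the absolute value of \<open>h\<close>. For
  \<open>u = a + k\<close> with \<open>k\<close> equal to \<open>h\<close> or \<open>- h\<close>,
  one has \<open>u * u = 2 * (u * a)\<close>; so \<open>u\<close> would be the positive quotient of
  \<open>u * u\<close> by \<open>2 * a\<close> if \<open>a\<close> were invertible. The proof of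
  \<open>key\<close> shifts \<open>a\<close> by \<open>e\<close> to make it so.\<close>

lemma pos_abs:
  fixes h :: "'a::unital_cstar_algebra"
  assumes sa: "adj h = h"
  obtains a where "pos a" "a * a = h * h" "pos (a + h)" "pos (a - h)"
    "\<forall>x. x * h = h * x \<longrightarrow> x * a = a * x"
proof -
  obtain a where a: "pos a" "a * a = h * h" "\<forall>x. x * (h * h) = h * h * x \<longrightarrow> x * a = a * x"
    by (rule pos_sqrt[OF pos_square[OF sa]]) (rule that)
  have comm: "x * a = a * x" if "x * h = h * x" for x
    by (rule a(3)[rule_format]) (metis that mult.assoc)
  have key: "pos (a + k)" if ksa: "adj k = k" and kk: "a * a = k * k" and ka: "k * a = a * k" for k
  proof (rule pos_of_perturb)
    fix d :: real assume "d > 0"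
    define e where "e = 2 * d"
    define u where "u = a + k"
    have e: "e > 0" using \<open>d > 0\<close> by (simp add: e_def)
    obtain r where r: "(a + e *\<^sub>R 1) * r = 1" "r * (a + e *\<^sub>R 1) = 1" "pos r" "pos (1 - e *\<^sub>R r)"
      "\<forall>x. x * a = a * x \<longrightarrow> x * r = r * x"
      by (rule pos_shift_inverse[OF a(1) e]) (rule that)
    have ua: "u * a = a * u" using ka by (simp add: u_def algebra_simps)
    then have ur: "u * r = r * u" using r(5)[rule_format, of u] by simp
    have u2: "u * u = 2 *\<^sub>R (u * a)"
      using kk ka by (simp add: u_def algebra_simps scaleR_2)
    define q where "q = (u + e *\<^sub>R 1) * (u + e *\<^sub>R 1)"
    have "pos q" unfolding q_def
      using a(1) ksa by (intro pos_square) (simp add: u_def adj_simps pos_adj)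
    moreover have "q * r = r * q" unfolding q_def
      using ur by (simp add: algebra_simps) (metis mult.assoc)
    ultimately have "pos (q * r)" using r(3) pos_mult by blast
    \<comment> \<open>Half of \<open>q * r\<close> is \<open>u + (e * e / 2) * r\<close>. The second
      summand cancels the term in \<open>r\<close> and leaves the error \<open>e / 2\<close>, which
      is why \<open>e\<close> is \<open>2 * d\<close>.\<close>
    then have "pos ((1/2) *\<^sub>R (q * r) + (e/2) *\<^sub>R (1 - e *\<^sub>R r))"
      using r(4) e by (intro pos_add pos_scaleR) auto
    moreover have "(1/2) *\<^sub>R (q * r) + (e/2) *\<^sub>R (1 - e *\<^sub>R r) = u + d *\<^sub>R 1"
    proof -
      have "q = 2 *\<^sub>R (u * (a + e *\<^sub>R 1)) + (e * e) *\<^sub>R 1"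
        using u2 by (simp add: q_def algebra_simps scaleR_2)
          (simp add: scaleR_add_left[symmetric] mult.commute)
      then have "q * r = 2 *\<^sub>R (u * ((a + e *\<^sub>R 1) * r)) + (e * e) *\<^sub>R r"
        by (simp add: distrib_right mult.assoc)
      then have "q * r = 2 *\<^sub>R u + (e * e) *\<^sub>R r" by (simp only: r(1) mult_1_right)
      then show ?thesis by (simp add: e_def scaleR_add_right scaleR_diff_right)
    qed
    ultimately show "pos (a + k + d *\<^sub>R 1)" by (simp add: u_def)
  qed
  have ha: "h * a = a * h" using comm by simp
  have "pos (a - h)" using key[of "- h"] a(2) ha sa by (simp add: adj_simps)
  with a(1,2) key[OF sa a(2) ha] show thesis by (intro that[of a] allI impI comm)
qed

text \<open>Completing the square, \<open>c + c * c + 1/4\<close> is the square of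
  \<open>c + 1/2\<close>, and for positive \<open>c\<close> the shift by 1/2 adds 1/2 to the norm.
  The assumption \<open>c \<noteq> 0\<close> excludes the value 0 of the maximum in
  \<open>pos_norm_le_max\<close>.\<close>

lemma norm_plus_square_ge:
  fixes c :: "'a::unital_cstar_algebra"
  assumes c: "pos c" and "c \<noteq> 0"
  shows "norm c + (norm c)\<^sup>2 \<le> norm (c + c * c)"
proof -
  define \<tau> where "\<tau> = norm (c + c * c)"
  define k where "k = c + (1/2) *\<^sub>R 1"
  have ka: "adj k = k" using c by (simp add: k_def adj_simps pos_adj)
  have "k * k = (c + c * c) + (1/4) *\<^sub>R 1"
    by (simp add: k_def algebra_simps scaleR_2[symmetric] flip: scaleR_add_left)
  then have "norm (k * k) \<le> \<tau> + 1/4"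
    using norm_triangle_ineq[of "c + c * c" "(1/4) *\<^sub>R 1"] norm_scaleR_one_le[of "1/4", where 'a='a]
    by (simp add: \<tau>_def)
  then have 1: "(norm k)\<^sup>2 \<le> \<tau> + 1/4" using norm_square_selfadjoint[OF ka] by simp
  have "(norm k - 1/2) *\<^sub>R 1 - c = norm k *\<^sub>R 1 - k" by (simp add: k_def algebra_simps)
  then have "pos ((norm k - 1/2) *\<^sub>R 1 - c)" using pos_norm_minus[OF ka order_refl] by simp
  then have "norm c \<le> max 0 (norm k - 1/2)" using pos_norm_le_max[OF c] by blast
  then have "norm c + 1/2 \<le> norm k" using assms(2) norm_eq_zero[of c] norm_ge_zero[of c] by linarith
  then have "(norm c + 1/2)\<^sup>2 \<le> (norm k)\<^sup>2" by (intro power_mono) auto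
  then show ?thesis using 1 by (simp add: \<tau>_def power2_eq_square algebra_simps)
qed

text \<open>With \<open>a\<close> the absolute value of \<open>h = adj x * x\<close>, the element
  \<open>v = a - h\<close> is twice the negative part of \<open>h\<close>, and
  \<open>y = x * v\<close> makes \<open>- (adj y * y)\<close> positive. Then
  \<open>y * adj y\<close> is positive as well. If \<open>y\<close> were nonzero, its multiple
  \<open>z\<close> of norm 1 would satisfy \<open>norm (1 + adj z * z) \<le> 1\<close>, so
  \<open>b = z * adj z\<close> of norm 1 would give \<open>norm (b + b * b) \<le> 1\<close>,
  although this norm is at least 2. So \<open>y = 0\<close>, which forces \<open>v = 0\<close> and
  \<open>h = a\<close>.\<close>

theorem pos_adj_mult_self:
  fixes x :: "'a::unital_cstar_algebra"
  shows "pos (adj x * x)"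
proof -
  define h where "h = adj x * x"
  have sa: "adj h = h" by (simp add: h_def adj_simps)
  obtain a where a: "pos a" "a * a = h * h" "pos (a + h)" "pos (a - h)"
    "\<forall>y. y * h = h * y \<longrightarrow> y * a = a * y"
    by (rule pos_abs[OF sa]) (rule that)
  have ha: "h * a = a * h" using a(5)[rule_format, of h] by simp
  define v where "v = a - h"
  have va: "v * a = a * v" and vh: "v * h = h * v" using ha by (simp_all add: v_def algebra_simps)
  have "v * (a * z) = a * (v * z)" for z by (simp only: mult.assoc[symmetric] va)
  then have avv: "a * (v * v) = v * v * a" by (simp add: mult.assoc va)
  have vv: "h * v = - (a * v)" using a(2) ha by (simp add: v_def algebra_simps)
  have vsa: "adj v = v" using a(1) sa by (simp add: v_def pos_adj adj_diff)
  define y where "y = x * v"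
  define w where "w = - (adj y * y)"
  have "adj y * y = v * (h * v)" by (simp add: y_def h_def adj_simps vsa mult.assoc)
  also have "\<dots> = - (a * (v * v))" by (simp add: vv va mult.assoc[symmetric])
  finally have yy: "adj y * y = - (a * (v * v))" .
  have "pos (a * (v * v))"
    using avv vsa by (intro pos_mult a pos_square) simp_all
  then have w: "pos w" by (simp add: w_def yy)
  define c where "c = y * adj y"
  have c: "pos c"
  proof -
    \<comment> \<open>Up to sign these are the real and imaginary parts of \<open>y\<close>. The sum
      of their squares is half of \<open>y * adj y + adj y * y\<close>, so twice that sum plus
      \<open>w\<close> is \<open>y * adj y\<close>.\<close>
    define p q where "p = (1/2) *\<^sub>R (y + adj y)" and "q = (1/2) *\<^sub>R (\<i> *\<^sub>C (y - adj y))"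
    have pa: "adj p = p" and qa: "adj q = q"
      by (simp_all add: p_def q_def adj_simps scaleC_minus_left scaleC_minus_right scaleC_diff_right add.commute)
    have "p * p = (1/4) *\<^sub>R (y * y + y * adj y + adj y * y + adj y * adj y)"
      by (simp add: p_def algebra_simps)
    moreover have "q * q = (1/4) *\<^sub>R (- (y * y) + y * adj y + adj y * y - adj y * adj y)"
    proof -
      have "(\<i> *\<^sub>C d) * (\<i> *\<^sub>C d) = - (d * d)" for d :: 'a
        by (simp add: mult_scaleC_left mult_scaleC_right)
      then have "q * q = (1/4) *\<^sub>R - ((y - adj y) * (y - adj y))" by (simp add: q_def)
      then show ?thesis by (simp add: algebra_simps)
    qed
    ultimately have "p * p + q * q = (1/4) *\<^sub>R ((y * adj y + adj y * y) + (y * adj y + adj y * y))"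
      by (simp flip: scaleR_add_right)
    also have "\<dots> = (1/2) *\<^sub>R (y * adj y + adj y * y)"
      unfolding scaleR_2[symmetric] by simp
    finally have "2 *\<^sub>R (p * p + q * q) + w = c" by (simp add: w_def c_def)
    moreover have "pos (2 *\<^sub>R (p * p + q * q) + w)"
      using pa qa w by (intro pos_add pos_scaleR pos_square) auto
    ultimately show ?thesis by simp
  qed
  have "y = 0"
  proof (rule ccontr)
    assume y0: "y \<noteq> 0"
    define s where "s = 1 / norm y"
    define z where "z = s *\<^sub>R y"
    define b where "b = z * adj z"
    have nz: "norm z = 1" using y0 by (simp add: z_def s_def)
    have b_eq: "b = (s * s) *\<^sub>R c" by (simp add: b_def z_def c_def adj_simps)
    have b: "pos b" unfolding b_eq using c by (intro pos_scaleR) auto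
    have nb: "norm b = 1" using cstar_identity[of "adj z"] nz by (simp add: b_def adj_adj)
    have wz: "adj z * z = - ((s * s) *\<^sub>R w)" by (simp add: z_def w_def adj_simps)
    have "pos ((s * s) *\<^sub>R w)" using w by (intro pos_scaleR) auto
    moreover have "norm ((s * s) *\<^sub>R w) \<le> 1"
      using cstar_identity[of z] nz by (simp add: wz)
    ultimately have le: "norm (1 + adj z * z) \<le> 1"
      using pos_norm_diff[of "(s * s) *\<^sub>R w" 1] by (simp add: wz)
    have "b + b * b = z * (1 + adj z * z) * adj z"
      by (simp add: b_def distrib_left distrib_right mult.assoc)
    then have "norm (b + b * b) \<le> norm (z * (1 + adj z * z)) * norm (adj z)"
      by (simp only: norm_mult_ineq)
    also have "\<dots> \<le> norm z * norm (1 + adj z * z) * norm (adj z)"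
      by (intro mult_right_mono norm_mult_ineq norm_ge_zero)
    finally have "norm (b + b * b) \<le> 1" using le nz by simp
    moreover have "b \<noteq> 0" using nb by auto
    ultimately show False using norm_plus_square_ge[OF b] nb by simp
  qed
  then have "a * (v * v) = 0" using yy by simp
  \<comment> \<open>Both \<open>v * v * a\<close> and \<open>v * v * h = - (v * v * a)\<close>
    vanish, so the fourth power of the selfadjoint \<open>v\<close> is 0; the C*-identity, used
    twice, gives \<open>v = 0\<close>.\<close>
  have "(v * v) * (v * v) = v * (v * (a - h)) * v" by (simp add: v_def mult.assoc)
  also have "\<dots> = 0"
  proof -
    have "v * (v * (a - h)) = v * v * a - v * v * h" by (simp add: right_diff_distrib mult.assoc)
    also have "v * v * h = - (v * v * a)" by (simp only: mult.assoc vh vv va mult_minus_right)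
    also have "v * v * a = 0" using \<open>a * (v * v) = 0\<close> by (simp only: avv)
    finally show ?thesis by simp
  qed
  finally have "norm ((v * v) * (v * v)) = 0" by simp
  then have "v = 0"
    using norm_square_selfadjoint[of "v * v"] norm_square_selfadjoint[of v] vsa
    by (simp add: adj_simps)
  then show ?thesis using a(1) by (simp add: v_def h_def)
qed

lemma pos_conjugate:
  fixes h :: "'a::unital_cstar_algebra"
  assumes "pos h"
  shows "pos (adj x * h * x)"
proof -
  obtain s where s: "pos s" "s * s = h" using pos_sqrt[OF assms] by metis
  have "adj x * h * x = adj (s * x) * (s * x)" using s by (simp add: adj_simps pos_adj mult.assoc[symmetric]) (metis mult.assoc)
  then show ?thesis using pos_adj_mult_self by metis
qed

lemma pos_trans: "pos (b - a) \<Longrightarrow> pos (c - b) \<Longrightarrow> pos (c - a)"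
  using pos_add[of "b - a" "c - b"] by simp

lemma pos_norm_sq_diff:
  fixes x :: "'a::unital_cstar_algebra"
  shows "pos ((norm x)\<^sup>2 *\<^sub>R 1 - adj x * x)"
  by (rule pos_norm_minus) (simp_all add: adj_simps cstar_identity)

lemma pos_adj_mult_le:
  fixes x :: "'a::unital_cstar_algebra"
  shows "pos ((norm b)\<^sup>2 *\<^sub>R (adj x * x) - adj (b * x) * (b * x))"
  using pos_conjugate[OF pos_norm_sq_diff[of b], of x]
  by (simp add: adj_simps algebra_simps)

section \<open>Extreme states\<close>

text \<open>Homogeneity is only an inequality; used for \<open>c\<close> and for
  \<open>1 / c\<close> it becomes the equality of \<open>sublinear_scale\<close>. This weak form is
  easier to check for infima.\<close>

definition sublinear :: "('v::real_vector \<Rightarrow> real) \<Rightarrow> bool" where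
  "sublinear p \<longleftrightarrow> (\<forall>x y. p (x + y) \<le> p x + p y) \<and> (\<forall>c>0. \<forall>x. p (c *\<^sub>R x) \<le> c * p x)
     \<and> p 0 = 0"

lemma sublinear_scale: "sublinear p \<Longrightarrow> 0 \<le> c \<Longrightarrow> p (c *\<^sub>R x) = c * p x"
proof (cases "c = 0")
  case False
  assume p: "sublinear p" and "0 \<le> c"
  with False have c: "c > 0" by simp
  have "p ((1/c) *\<^sub>R c *\<^sub>R x) \<le> (1/c) * p (c *\<^sub>R x)"
    using p c unfolding sublinear_def by (metis zero_less_divide_1_iff)
  then have "c * p x \<le> p (c *\<^sub>R x)" using c by (simp add: field_simps)
  then show ?thesis using p c unfolding sublinear_def by (simp add: order_antisym)
qed (simp add: sublinear_def)

lemma sublinear_add: "sublinear p \<Longrightarrow> p (x + y) \<le> p x + p y"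
  and sublinear_zero: "sublinear p \<Longrightarrow> p 0 = 0"
  by (simp_all add: sublinear_def)

lemma sublinear_neg: "sublinear p \<Longrightarrow> - p (- x) \<le> p x"
  using sublinear_add[of p x "- x"] sublinear_zero[of p] by simp

text \<open>The extra inequality makes \<open>f\<close> odd, and subadditivity at \<open>- x\<close>
  and \<open>- y\<close> turns into superadditivity.\<close>

lemma linear_of_sublinear:
  assumes p: "sublinear f" and neg: "\<And>x. f x + f (- x) \<le> 0"
  shows "linear f"
proof -
  have m: "f (- x) = - f x" for x using sublinear_neg[OF p, of x] neg[of x] by linarith
  show ?thesis
  proof
    fix x y
    have "f (x + y) \<le> f x + f y" "f (- x + - y) \<le> f (- x) + f (- y)"
      by (rule sublinear_add[OF p])+
    moreover have "f (- x + - y) = - f (x + y)" using m[of "x + y"] by (simp add: algebra_simps)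
    ultimately show "f (x + y) = f x + f y" by (simp add: m)
  next
    fix c x
    show "f (c *\<^sub>R x) = c *\<^sub>R f x"
    proof (cases "c \<ge> 0")
      case False
      have "f (c *\<^sub>R x) = f (- ((- c) *\<^sub>R x))" by simp
      also have "\<dots> = - ((- c) * f x)" using False by (simp only: m sublinear_scale[OF p])
      finally show ?thesis by simp
    qed (simp add: sublinear_scale[OF p])
  qed
qed

text \<open>The one-step move of the Hahn-Banach argument: a linear functional lies below
  \<open>touch q h\<close> exactly if it lies below \<open>q\<close> and agrees with
  \<open>q\<close> at \<open>h\<close>. Its value at \<open>- h\<close> is at most
  \<open>- q h\<close>, which pins such functionals on the line through \<open>h\<close>.\<close>

definition touch :: "('v::real_vector \<Rightarrow> real) \<Rightarrow> 'v \<Rightarrow> 'v \<Rightarrow> real" where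
  "touch q h x = (INF t\<in>{0..}. q (x + t *\<^sub>R h) - t * q h)"

context
  fixes q :: "'v::real_vector \<Rightarrow> real" and h :: 'v
  assumes q: "sublinear q"
begin

lemma touch_bdd:
  assumes "0 \<le> t"
  shows "- q (- x) \<le> q (x + t *\<^sub>R h) - t * q h"
proof -
  have "q ((x + t *\<^sub>R h) + (- x)) \<le> q (x + t *\<^sub>R h) + q (- x)"
    by (rule sublinear_add[OF q])
  then show ?thesis using sublinear_scale[OF q assms, of h] by simp
qed

lemma touch_lower:
  assumes "0 \<le> t"
  shows "touch q h x \<le> q (x + t *\<^sub>R h) - t * q h"
  unfolding touch_def using assms touch_bdd[of _ x]
  by (intro cINF_lower bdd_belowI2[where m="- q (- x)"]) auto

lemma touch_greatest:
  assumes "\<And>t. 0 \<le> t \<Longrightarrow> b \<le> q (x + t *\<^sub>R h) - t * q h"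
  shows "b \<le> touch q h x"
  unfolding touch_def using assms by (intro cINF_greatest) auto

lemma touch_le: "touch q h x \<le> q x"
  using touch_lower[of 0 x] by simp

lemma touch_neg: "touch q h (- h) \<le> - q h"
  using touch_lower[of 1 "- h"] q by (simp add: sublinear_def)

lemma touch_sublinear: "sublinear (touch q h)"
  unfolding sublinear_def
proof (intro conjI allI impI)
  fix x y
  have "touch q h (x + y) - touch q h y \<le> q (x + t *\<^sub>R h) - t * q h" if t: "0 \<le> t" for t
  proof -
    have "touch q h (x + y) - (q (x + t *\<^sub>R h) - t * q h) \<le> q (y + s *\<^sub>R h) - s * q h"
      if s: "0 \<le> s" for s
    proof -
      have "touch q h (x + y) \<le> q ((x + t *\<^sub>R h) + (y + s *\<^sub>R h)) - (t + s) * q h"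
        using touch_lower[of "t + s" "x + y"] s t by (simp add: algebra_simps)
      also have "q ((x + t *\<^sub>R h) + (y + s *\<^sub>R h)) \<le> q (x + t *\<^sub>R h) + q (y + s *\<^sub>R h)"
        by (rule sublinear_add[OF q])
      finally show ?thesis by (simp add: algebra_simps)
    qed
    from touch_greatest[OF this] show ?thesis by simp
  qed
  from touch_greatest[OF this] show "touch q h (x + y) \<le> touch q h x + touch q h y" by simp
next
  fix c :: real and x assume c: "c > 0"
  have "touch q h (c *\<^sub>R x) / c \<le> q (x + t *\<^sub>R h) - t * q h" if t: "0 \<le> t" for t
  proof -
    have "touch q h (c *\<^sub>R x) \<le> q (c *\<^sub>R (x + t *\<^sub>R h)) - (c * t) * q h"
      using touch_lower[of "c * t" "c *\<^sub>R x"] c t by (simp add: scaleR_add_right)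
    also have "\<dots> = c * (q (x + t *\<^sub>R h) - t * q h)"
      by (simp only: sublinear_scale[OF q less_imp_le[OF c]] right_diff_distrib mult.assoc)
    finally show ?thesis using c by (simp add: divide_le_eq mult.commute)
  qed
  from touch_greatest[OF this] show "touch q h (c *\<^sub>R x) \<le> c * touch q h x"
    using c by (simp add: divide_le_eq mult.commute)
next
  have "q 0 = 0" using q by (simp add: sublinear_def)
  then show "touch q h 0 = 0"
    using touch_le[of 0] touch_greatest[of 0 0] touch_bdd[of _ 0] by fastforce
qed

lemma linear_le_touch:
  assumes g: "linear g" "\<And>x. g x \<le> q x" "g h = q h"
  shows "g x \<le> touch q h x"
proof (rule touch_greatest)
  fix t :: real
  have "g x = g (x + t *\<^sub>R h) - t * q h"
    using g(1,3) by (simp add: linear_add linear_scale)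
  then show "g x \<le> q (x + t *\<^sub>R h) - t * q h" using g(2)[of "x + t *\<^sub>R h"] by linarith
qed

end

text \<open>
  Making the functional touch \<open>p\<close> successively at \<open>d 0, d 1, \<dots>\<close> exposes a lexicographically
  maximal functional below \<open>p\<close>, which is extreme.
\<close>

lemma extreme_linear_minorant:
  fixes p :: "'v::real_normed_vector \<Rightarrow> real" and d :: "nat \<Rightarrow> 'v"
  assumes p: "sublinear p" and pn: "\<And>x. p x \<le> norm x" and dense: "closure (range d) = UNIV"
  obtains f where "linear f" "\<forall>x. f x \<le> p x" "f (d 0) = p (d 0)"
    "\<forall>g h c. linear g \<longrightarrow> linear h \<longrightarrow> (\<forall>x. g x \<le> p x) \<longrightarrow> (\<forall>x. h x \<le> p x) \<longrightarrow> 0 < c \<longrightarrow> c < 1 \<longrightarrow>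
       (\<forall>x. f x = c * g x + (1 - c) * h x) \<longrightarrow> g = f"
proof -
  define P where "P = rec_nat p (\<lambda>n q. touch q (d n))"
  have P0: "P 0 = p" and PS: "P (Suc n) = touch (P n) (d n)" for n by (simp_all add: P_def)
  have sl: "sublinear (P n)" for n
    by (induction n) (simp_all add: P0 PS p touch_sublinear)
  have dec: "P (Suc n) x \<le> P n x" for n x unfolding PS by (rule touch_le[OF sl])
  have Pn: "P n x \<le> norm x" for n x
    by (induction n) (simp_all add: P0 pn order_trans[OF dec])
  have lower: "- norm x \<le> P n x" for n x
    using sublinear_neg[OF sl, of n x] Pn[of n "- x"] by simp
  have decs: "decseq (\<lambda>n. P n x)" for x by (rule decseq_SucI) (rule dec)
  have "\<exists>l. (\<lambda>n. P n x) \<longlonglongrightarrow> l" for x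
    using decseq_convergent[OF decs[of x], of "- norm x"] lower by metis
  then obtain f where lim: "\<And>x. (\<lambda>n. P n x) \<longlonglongrightarrow> f x" by metis
  have fP: "f x \<le> P n x" for n x using decseq_ge[OF decs lim] .
  have fsub: "sublinear f"
    unfolding sublinear_def
  proof (intro conjI allI impI)
    fix x y show "f (x + y) \<le> f x + f y"
      by (rule LIMSEQ_le[OF lim tendsto_add[OF lim lim]]) (use sublinear_add[OF sl] in blast)
  next
    fix c :: real and x assume "c > 0"
    then show "f (c *\<^sub>R x) \<le> c * f x"
      by (intro LIMSEQ_le[OF lim tendsto_mult_left[OF lim]]) (simp add: sublinear_scale[OF sl])
  next
    have "P n 0 = 0" for n by (rule sublinear_zero[OF sl])
    then show "f 0 = 0" using LIMSEQ_unique[OF lim[of 0]] by simp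
  qed
  have touchd: "f (- d n) \<le> - P n (d n)" for n
    using fP[of "- d n" "Suc n"] touch_neg[OF sl, of n "d n"] by (simp add: PS)
  have fn: "f x \<le> norm x" for x using fP[of x 0] pn[of x] by (simp add: P0)
  \<comment> \<open>On the dense sequence this holds because \<open>P (Suc n)\<close> touches at
    \<open>d n\<close>; the bound of \<open>f\<close> by the norm extends it to all
    \<open>x\<close>.\<close>
  have "f x + f (- x) \<le> 0" for x
  proof (rule field_le_epsilon)
    fix e :: real assume "e > 0"
    then obtain n where n: "dist (d n) x < e/2"
      using dense closure_approachable[of x "range d"] by (metis UNIV_I half_gt_zero rangeE)
    have "f (d n + (x - d n)) \<le> f (d n) + f (x - d n)" "f (- d n + (d n - x)) \<le> f (- d n) + f (d n - x)"
      by (rule sublinear_add[OF fsub])+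
    moreover have "f (d n) + f (- d n) \<le> 0" using touchd[of n] fP[of "d n" n] by linarith
    moreover have "f (x - d n) \<le> e/2" "f (d n - x) \<le> e/2"
      using fn[of "x - d n"] fn[of "d n - x"] n by (auto simp: dist_norm norm_minus_commute)
    ultimately show "f x + f (- x) \<le> 0 + e" by simp
  qed
  then have lin: "linear f" by (rule linear_of_sublinear[OF fsub])
  have fd: "f (d n) = P n (d n)" for n
    using touchd[of n] fP[of "d n" n] lin by (simp add: linear_neg)
  have ext: "g = f"
    if g: "linear g" and h: "linear h" and gp: "\<forall>x. g x \<le> p x" and hp: "\<forall>x. h x \<le> p x"
      and c: "0 < c" "c < 1" and eq: "\<forall>x. f x = c * g x + (1 - c) * h x" for g h c
  proof -
    have ind: "(\<forall>x. g x \<le> P n x) \<and> (\<forall>x. h x \<le> P n x)" for n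
    proof (induction n)
      case (Suc n)
      \<comment> \<open>The value of \<open>f\<close> at \<open>d n\<close> is the largest one
        possible below \<open>P n\<close>. A proper convex combination attains it only if both
        functionals do, and both then stay below \<open>P (Suc n)\<close>.\<close>
      have "c * (P n (d n) - g (d n)) + (1 - c) * (P n (d n) - h (d n)) = 0"
        using fd[of n] eq by (simp add: algebra_simps)
      moreover have "c * (P n (d n) - g (d n)) \<ge> 0" "(1 - c) * (P n (d n) - h (d n)) \<ge> 0"
        using Suc c by (intro mult_nonneg_nonneg; simp)+
      ultimately have "c * (P n (d n) - g (d n)) = 0" "(1 - c) * (P n (d n) - h (d n)) = 0"
        by linarith+
      then have "g (d n) = P n (d n)" "h (d n) = P n (d n)" using c by auto
      then show ?case
        unfolding PS using Suc g h by (intro conjI allI linear_le_touch[OF sl]) auto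
    qed (simp add: P0 gp hp)
    have le: "g x \<le> f x" for x by (rule LIMSEQ_le_const[OF lim]) (use ind in blast)
    have "g x = f x" for x using le[of x] le[of "- x"] g lin by (simp add: linear_neg)
    then show ?thesis by blast
  qed
  show thesis
  proof (rule that[OF lin])
    show "\<forall>x. f x \<le> p x" using fP[of _ 0] by (simp add: P0)
    show "f (d 0) = p (d 0)" using fd[of 0] by (simp add: P0)
  qed (use ext in blast)
qed

section \<open>Closed ideals, positive functionals and purity\<close>

lemma closed_ideal_zero: "closed_ideal L \<Longrightarrow> 0 \<in> L"
  and closed_ideal_add: "closed_ideal L \<Longrightarrow> x \<in> L \<Longrightarrow> y \<in> L \<Longrightarrow> x + y \<in> L"
  and closed_ideal_mult_left: "closed_ideal L \<Longrightarrow> x \<in> L \<Longrightarrow> b * x \<in> L"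
  and closed_ideal_mult_right: "closed_ideal L \<Longrightarrow> x \<in> L \<Longrightarrow> x * b \<in> L"
  by (auto simp: closed_ideal_def complex_subspace_def)

lemma closed_ideal_scaleR: "closed_ideal L \<Longrightarrow> x \<in> L \<Longrightarrow> r *\<^sub>R x \<in> L"
  by (simp add: closed_ideal_def complex_subspace_def scaleR_scaleC)

lemma closed_ideal_diff: "closed_ideal L \<Longrightarrow> x \<in> L \<Longrightarrow> y \<in> L \<Longrightarrow> x - y \<in> L"
  using closed_ideal_add[of L x "- y"] closed_ideal_uminus by fastforce

locale positive_functional =
  fixes \<phi> :: "'a::unital_cstar_algebra \<Rightarrow> complex"
  assumes add: "\<phi> (x + y) = \<phi> x + \<phi> y"
    and scaleC: "\<phi> (c *\<^sub>C x) = c * \<phi> x"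
    and adj: "\<phi> (adj x) = cnj (\<phi> x)"
    and nonneg: "0 \<le> Re (\<phi> (adj x * x))"
begin

lemma scaleR: "\<phi> (r *\<^sub>R x) = complex_of_real r * \<phi> x"
  by (simp add: scaleR_scaleC scaleC)

lemma zero [simp]: "\<phi> 0 = 0"
  using scaleR[of 0 0] by simp

lemma minus: "\<phi> (- x) = - \<phi> x"
  using scaleR[of "-1" x] by simp

lemma diff: "\<phi> (x - y) = \<phi> x - \<phi> y"
  using add[of x "- y"] by (simp add: minus)

lemma pos_nonneg:
  assumes "pos h"
  shows "0 \<le> Re (\<phi> h)"
proof -
  obtain s where "pos s" "s * s = h" using pos_sqrt[OF assms] by metis
  then show ?thesis using nonneg[of s] by (simp add: pos_adj)
qed

lemma pos_mono: "pos (k - h) \<Longrightarrow> Re (\<phi> h) \<le> Re (\<phi> k)"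
  using pos_nonneg[of "k - h"] by (simp add: diff)

lemma self_real: "\<phi> (adj x * x) = complex_of_real (Re (\<phi> (adj x * x)))"
  using adj[of "adj x * x"] by (simp add: adj_simps complex_eq_iff)

lemma cauchy_schwarz:
  "(cmod (\<phi> (adj y * x)))\<^sup>2 \<le> Re (\<phi> (adj y * y)) * Re (\<phi> (adj x * x))"
proof -
  define p q s where "p = Re (\<phi> (adj x * x))" and "q = Re (\<phi> (adj y * y))" and "s = \<phi> (adj y * x)"
  have sc: "\<phi> (adj x * y) = cnj s" using adj[of "adj y * x"] by (simp add: adj_simps s_def)
  have key: "0 \<le> p - 2 * t * (cmod s)\<^sup>2 + t\<^sup>2 * (cmod s)\<^sup>2 * q" for t :: real
  proof -
    define c where "c = - (complex_of_real t * s)"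
    have "\<phi> (adj (x + c *\<^sub>C y) * (x + c *\<^sub>C y)) =
        complex_of_real p + c * cnj s + cnj c * s + cnj c * c * complex_of_real q"
      using self_real[of x] self_real[of y]
      by (simp add: adj_simps distrib_left distrib_right mult_scaleC_left mult_scaleC_right
        add scaleC sc p_def q_def s_def)
    also have "\<dots> = complex_of_real (p - 2 * t * (cmod s)\<^sup>2 + t\<^sup>2 * (cmod s)\<^sup>2 * q)"
    proof -
      have ss: "s * cnj s = complex_of_real ((cmod s)\<^sup>2)" by (rule complex_norm_square[symmetric])
      have "c * cnj s = - complex_of_real t * (s * cnj s)" "cnj c * s = - complex_of_real t * (s * cnj s)"
        "cnj c * c = complex_of_real (t\<^sup>2) * (s * cnj s)"
        by (simp_all add: c_def power2_eq_square)
      then show ?thesis unfolding ss by simp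
    qed
    finally show ?thesis using nonneg[of "x + c *\<^sub>C y"] by simp
  qed
  have "q \<ge> 0" using nonneg[of y] by (simp add: q_def)
  have "(cmod s)\<^sup>2 \<le> q * p"
  proof (cases "q = 0")
    case True
    have "(cmod s)\<^sup>2 = 0"
    proof (rule ccontr)
      assume n: "(cmod s)\<^sup>2 \<noteq> 0"
      \<comment> \<open>For \<open>q = 0\<close> the bound \<open>key\<close> is affine in
        \<open>t\<close>; this \<open>t\<close> makes its right-hand side
        \<open>p - 2 * (p + 1)\<close>, which is negative.\<close>
      have "0 \<le> p - 2 * ((p + 1) / (cmod s)\<^sup>2) * (cmod s)\<^sup>2"
        using key[of "(p + 1) / (cmod s)\<^sup>2"] True by simp
      then have "0 \<le> p - 2 * (p + 1)" using n by simp
      moreover have "p \<ge> 0" using nonneg[of x] by (simp add: p_def)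
      ultimately show False by simp
    qed
    then show ?thesis using True by simp
  next
    case False
    with \<open>q \<ge> 0\<close> have q: "q > 0" by simp
    have "0 \<le> p - (cmod s)\<^sup>2 / q"
      using key[of "1/q"] q by (simp add: field_simps power2_eq_square)
    then show ?thesis using q by (simp add: field_simps)
  qed
  then show ?thesis by (simp add: p_def q_def s_def)
qed

lemma cmod_square_le: "(cmod (\<phi> x))\<^sup>2 \<le> Re (\<phi> 1) * Re (\<phi> (adj x * x))"
  using cauchy_schwarz[of 1 x] by simp

lemma one_nonneg: "0 \<le> Re (\<phi> 1)"
  using nonneg[of 1] by simp

lemma zero_of_one: "Re (\<phi> 1) = 0 \<Longrightarrow> \<phi> x = 0"
  using cmod_square_le[of x] by simp

lemma Re_linear: "linear (\<lambda>x. Re (\<phi> x))"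
  by standard (simp_all add: add scaleR)

lemma eq_of_Re: "\<phi> x = Complex (Re (\<phi> x)) (- Re (\<phi> (\<i> *\<^sub>C x)))"
  by (simp add: scaleC complex_eq_iff)

end

text \<open>Extremality in its order form: a positive functional dominated by \<open>\<phi>\<close>
  is a multiple of it. This applies directly to the functional that an invariant subspace cuts out
  of the cyclic vector.\<close>

definition pure_functional :: "('a::unital_cstar_algebra \<Rightarrow> complex) \<Rightarrow> bool" where
  "pure_functional \<phi> \<longleftrightarrow> positive_functional \<phi> \<and> \<phi> 1 = 1 \<and>
     (\<forall>\<psi>. positive_functional \<psi> \<longrightarrow> (\<forall>x. Re (\<psi> (adj x * x)) \<le> Re (\<phi> (adj x * x))) \<longrightarrow>
        (\<exists>\<mu>. \<forall>x. \<psi> x = \<mu> * \<phi> x))"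

text \<open>
  The order seminorm of the quotient by \<open>L\<close>; the real parts of the states that vanish on \<open>L\<close>
  are the linear functionals below it.
\<close>

definition quotient_bound :: "'a::unital_cstar_algebra set \<Rightarrow> 'a \<Rightarrow> real" where
  "quotient_bound L x =
     Inf {t. \<exists>l\<in>L. adj l = l \<and> pos (t *\<^sub>R 1 - (1/2) *\<^sub>R (x + adj x) - l)}"

context
  fixes L :: "'a::unital_cstar_algebra set"
  assumes L: "closed_ideal L" and proper: "1 \<notin> L"
begin

text \<open>A smaller \<open>t\<close> would make \<open>\<tau> - l\<close> positive for some
  negative \<open>\<tau>\<close>. Shifted by \<open>- \<tau>\<close> it is invertible; but this
  shift is \<open>- l\<close>, an element of a proper ideal.\<close>

lemma quotient_bound_set_lower:
  assumes "l \<in> L" "pos (t *\<^sub>R 1 - (1/2) *\<^sub>R (x + adj x) - l)"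
  shows "- norm x \<le> t"
proof (rule ccontr)
  define y where "y = (1/2) *\<^sub>R (x + adj x)"
  define \<tau> where "\<tau> = t + norm x"
  assume "\<not> - norm x \<le> t"
  then have neg: "- \<tau> > 0" by (simp add: \<tau>_def)
  have "norm (- y) \<le> norm x"
    using norm_triangle_ineq[of x "adj x"] by (simp add: y_def)
  moreover have "adj (- y) = - y" by (simp add: y_def adj_simps add.commute)
  ultimately have "pos (norm x *\<^sub>R 1 - - y)" by (intro pos_norm_minus)
  from pos_add[OF assms(2) this] have "pos (\<tau> *\<^sub>R 1 - l)"
    by (simp add: y_def \<tau>_def algebra_simps)
  from pos_shift_inverse[OF this neg] obtain r where "(\<tau> *\<^sub>R 1 - l + (- \<tau>) *\<^sub>R 1) * r = 1" by metis
  then have "- l * r = 1" by simp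
  then show False using proper closed_ideal_mult_right[OF L closed_ideal_uminus[OF L assms(1)]] by metis
qed

lemma quotient_bound_lower:
  assumes "l \<in> L" "adj l = l" "pos (t *\<^sub>R 1 - (1/2) *\<^sub>R (x + adj x) - l)"
  shows "quotient_bound L x \<le> t"
  unfolding quotient_bound_def
  using assms quotient_bound_set_lower by (intro cInf_lower bdd_belowI[where m="- norm x"]) auto

lemma quotient_bound_set_nonempty:
  "pos (norm x *\<^sub>R 1 - (1/2) *\<^sub>R (x + adj x) - 0)"
proof -
  have "pos (norm x *\<^sub>R 1 - (1/2) *\<^sub>R (x + adj x))"
    using norm_triangle_ineq[of x "adj x"] by (intro pos_norm_minus) (simp_all add: adj_simps add.commute)
  then show ?thesis by simp
qed

lemma quotient_bound_greatest:
  assumes "\<And>t l. l \<in> L \<Longrightarrow> adj l = l \<Longrightarrow> pos (t *\<^sub>R 1 - (1/2) *\<^sub>R (x + adj x) - l) \<Longrightarrow> b \<le> t"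
  shows "b \<le> quotient_bound L x"
  unfolding quotient_bound_def
  using assms quotient_bound_set_nonempty[of x] closed_ideal_zero[OF L]
  by (intro cInf_greatest) (auto intro!: exI[of _ "norm x"] bexI[of _ 0])

lemma quotient_bound_le_norm: "quotient_bound L x \<le> norm x"
  using quotient_bound_lower[OF closed_ideal_zero[OF L] adj_zero quotient_bound_set_nonempty] .

lemma quotient_bound_sublinear: "sublinear (quotient_bound L)"
  unfolding sublinear_def
proof (intro conjI allI impI)
  fix x y
  have "quotient_bound L (x + y) - quotient_bound L y \<le> t"
    if l: "l \<in> L" "adj l = l" "pos (t *\<^sub>R 1 - (1/2) *\<^sub>R (x + adj x) - l)" for t l
  proof -
    have "quotient_bound L (x + y) - t \<le> s"
      if k: "k \<in> L" "adj k = k" "pos (s *\<^sub>R 1 - (1/2) *\<^sub>R (y + adj y) - k)" for s k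
    proof -
      have "(t + s) *\<^sub>R 1 - (1/2) *\<^sub>R ((x + y) + adj (x + y)) - (l + k) =
          (t *\<^sub>R 1 - (1/2) *\<^sub>R (x + adj x) - l) + (s *\<^sub>R 1 - (1/2) *\<^sub>R (y + adj y) - k)"
        by (simp add: adj_add algebra_simps)
      then have "pos ((t + s) *\<^sub>R 1 - (1/2) *\<^sub>R ((x + y) + adj (x + y)) - (l + k))"
        using pos_add[OF l(3) k(3)] by (simp only:)
      then have "quotient_bound L (x + y) \<le> t + s"
        using closed_ideal_add[OF L l(1) k(1)] l(2) k(2)
        by (intro quotient_bound_lower[of "l + k"]) (simp_all add: adj_add)
      then show ?thesis by simp
    qed
    then have "quotient_bound L (x + y) - t \<le> quotient_bound L y" by (rule quotient_bound_greatest)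
    then show ?thesis by simp
  qed
  then have "quotient_bound L (x + y) - quotient_bound L y \<le> quotient_bound L x"
    by (rule quotient_bound_greatest)
  then show "quotient_bound L (x + y) \<le> quotient_bound L x + quotient_bound L y" by simp
next
  fix c :: real and x assume c: "c > 0"
  have "quotient_bound L (c *\<^sub>R x) / c \<le> t"
    if l: "l \<in> L" "adj l = l" "pos (t *\<^sub>R 1 - (1/2) *\<^sub>R (x + adj x) - l)" for t l
  proof -
    have "(c * t) *\<^sub>R 1 - (1/2) *\<^sub>R (c *\<^sub>R x + adj (c *\<^sub>R x)) - c *\<^sub>R l
        = c *\<^sub>R (t *\<^sub>R 1 - (1/2) *\<^sub>R (x + adj x) - l)"
      by (simp add: adj_scaleR algebra_simps)
    then have "quotient_bound L (c *\<^sub>R x) \<le> c * t"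
      using pos_scaleR[OF l(3), of c] c l closed_ideal_scaleR[OF L]
      by (intro quotient_bound_lower[of "c *\<^sub>R l"]) (simp_all add: adj_scaleR)
    then show ?thesis using c by (simp add: divide_le_eq mult.commute)
  qed
  then have "quotient_bound L (c *\<^sub>R x) / c \<le> quotient_bound L x" by (rule quotient_bound_greatest)
  then show "quotient_bound L (c *\<^sub>R x) \<le> c * quotient_bound L x"
    using c by (simp add: divide_le_eq mult.commute)
next
  show "quotient_bound L 0 = 0"
    using quotient_bound_le_norm[of 0] quotient_bound_greatest[of 0 0] quotient_bound_set_lower[of _ _ 0]
    by fastforce
qed

text \<open>
  If \<open>b\<^sup>* b \<le> \<epsilon> + l\<close> with \<open>l \<in> L\<close>, then \<open>b\<^sup>* b \<le> 2 \<epsilon> + m\<close> with \<open>m = l\<^sup>2 / (4 \<epsilon>)\<close>, and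
  \<open>b\<close> is within \<open>(2 \<epsilon>)\<^sup>1\<^sup>/\<^sup>2\<close> of \<open>b m (m + 2 \<epsilon>)\<^sup>-\<^sup>1 \<in> L\<close>.
\<close>

lemma quotient_bound_pos:
  assumes b: "b \<notin> L"
  shows "0 < quotient_bound L (adj b * b)"
proof (rule ccontr)
  assume np: "\<not> 0 < quotient_bound L (adj b * b)"
  have "\<exists>z\<in>L. dist z b < e" if e: "e > 0" for e
  proof -
    \<comment> \<open>Chosen so that \<open>2 * \<epsilon>\<close> is the square of
      \<open>e / 2\<close>, the distance to be reached.\<close>
    define \<epsilon> where "\<epsilon> = e\<^sup>2 / 8"
    have \<epsilon>: "\<epsilon> > 0" using e by (simp add: \<epsilon>_def)
    obtain t l where l: "l \<in> L" "adj l = l" "pos (t *\<^sub>R 1 - (1/2) *\<^sub>R (adj b * b + adj (adj b * b)) - l)"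
      and t: "t < \<epsilon>"
      using quotient_bound_greatest[of "adj b * b" \<epsilon>] np \<epsilon> by (meson not_le order_trans)
    \<comment> \<open>Completing the square, \<open>(l + 2 * \<epsilon>)^2 / (4 * \<epsilon>) = m +
      l + \<epsilon>\<close> is positive. This trades \<open>- l\<close> for
      \<open>m + \<epsilon>\<close> with \<open>m\<close> a positive element of
      \<open>L\<close>.\<close>
    define m where "m = (1 / (4 * \<epsilon>)) *\<^sub>R (l * l)"
    have m: "pos m" unfolding m_def using l(2) \<epsilon> by (intro pos_scaleR pos_square) auto
    have mL: "m \<in> L" unfolding m_def using l(1) L by (intro closed_ideal_scaleR closed_ideal_mult_left)
    have "pos ((1 / (4 * \<epsilon>)) *\<^sub>R ((l + (2 * \<epsilon>) *\<^sub>R 1) * (l + (2 * \<epsilon>) *\<^sub>R 1)))"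
      using l(2) \<epsilon> by (intro pos_scaleR pos_square) (simp_all add: adj_simps)
    moreover have "(1 / (4 * \<epsilon>)) *\<^sub>R ((l + (2 * \<epsilon>) *\<^sub>R 1) * (l + (2 * \<epsilon>) *\<^sub>R 1)) = m + l + \<epsilon> *\<^sub>R 1"
    proof -
      have "(4 * \<epsilon>) *\<^sub>R l = (2 * \<epsilon>) *\<^sub>R l + (2 * \<epsilon>) *\<^sub>R l"
        by (simp flip: scaleR_add_left)
      then have "(l + (2 * \<epsilon>) *\<^sub>R 1) * (l + (2 * \<epsilon>) *\<^sub>R 1)
          = l * l + (4 * \<epsilon>) *\<^sub>R l + (2 * \<epsilon> * (2 * \<epsilon>)) *\<^sub>R 1"
        by (simp add: distrib_left distrib_right scaleR_add_right add.assoc)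
      then show ?thesis using \<epsilon> by (simp add: m_def scaleR_add_right)
    qed
    ultimately have "pos (m + l + \<epsilon> *\<^sub>R 1)" by simp
    moreover have "pos (\<epsilon> *\<^sub>R 1 - adj b * b - l)"
    proof -
      have "(1/2) *\<^sub>R (adj b * b + adj (adj b * b)) = adj b * b"
        by (simp add: adj_simps flip: scaleR_2)
      then have "pos ((t *\<^sub>R 1 - adj b * b - l) + (\<epsilon> - t) *\<^sub>R 1)"
        using l(3) t by (intro pos_add pos_scaleR_one) auto
      then show ?thesis by (simp add: algebra_simps)
    qed
    ultimately have "pos ((m + l + \<epsilon> *\<^sub>R 1) + (\<epsilon> *\<^sub>R 1 - adj b * b - l))" by (rule pos_add)
    moreover have "(m + l + \<epsilon> *\<^sub>R 1) + (\<epsilon> *\<^sub>R 1 - adj b * b - l) = m + (2 * \<epsilon>) *\<^sub>R 1 - adj b * b"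
      by (simp only: mult_2 scaleR_add_left) (simp add: algebra_simps)
    ultimately have le: "pos (m + (2 * \<epsilon>) *\<^sub>R 1 - adj b * b)" by simp
    define \<delta> where "\<delta> = 2 * \<epsilon>"
    have \<delta>: "\<delta> > 0" using \<epsilon> by (simp add: \<delta>_def)
    obtain r where r: "(m + \<delta> *\<^sub>R 1) * r = 1" "r * (m + \<delta> *\<^sub>R 1) = 1" "pos r" "pos (1 - \<delta> *\<^sub>R r)"
      using pos_shift_inverse[OF m \<delta>] by metis
    have ra: "adj r = r" using r(3) by (rule pos_adj)
    \<comment> \<open>What remains of \<open>b\<close> after removing \<open>b * m * r\<close>,
      which lies in \<open>L\<close>. Conjugating \<open>adj b * b \<le> m + \<delta>\<close> by
      \<open>r\<close> bounds \<open>adj y * y\<close> by \<open>\<delta>^2 * r\<close>, hence by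
      \<open>\<delta>\<close>.\<close>
    define y where "y = \<delta> *\<^sub>R (b * r)"
    have yy: "adj y * y = (\<delta> * \<delta>) *\<^sub>R (r * (adj b * b) * r)"
      by (simp add: y_def adj_simps ra mult.assoc)
    have "pos ((\<delta> * \<delta>) *\<^sub>R (r * (m + \<delta> *\<^sub>R 1 - adj b * b) * r))"
      using pos_conjugate[OF le, of r] \<delta> by (intro pos_scaleR) (simp_all add: ra \<delta>_def)
    also have "r * (m + \<delta> *\<^sub>R 1 - adj b * b) * r = r - r * (adj b * b) * r"
      using r(2) by (simp only: right_diff_distrib left_diff_distrib mult_1_left)
    finally have "pos ((\<delta> * \<delta>) *\<^sub>R r - adj y * y)" by (simp only: yy scaleR_diff_right)
    moreover have "pos (\<delta> *\<^sub>R 1 - (\<delta> * \<delta>) *\<^sub>R r)"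
      using pos_scaleR[OF r(4), of \<delta>] \<delta> by (simp add: scaleR_diff_right)
    ultimately have "pos (\<delta> *\<^sub>R 1 - adj y * y)" by (rule pos_trans)
    then have "(norm y)\<^sup>2 \<le> \<delta>"
      using pos_norm_le[OF pos_adj_mult_self, of \<delta> y] \<delta> by (simp add: cstar_identity)
    also have "\<delta> = (e/2)\<^sup>2" by (simp add: \<delta>_def \<epsilon>_def power2_eq_square)
    finally have "norm y \<le> e/2" using e power2_le_imp_le by force
    moreover have "b - y = b * (m * r)"
    proof -
      have "m * r = 1 - \<delta> *\<^sub>R r" using r(1) by (simp add: distrib_right eq_diff_eq)
      then show ?thesis by (simp add: y_def right_diff_distrib)
    qed
    then have "b - y \<in> L" using mL L by (simp add: closed_ideal_mult_left closed_ideal_mult_right)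
    ultimately show ?thesis using e by (intro bexI[of _ "b - y"]) (auto simp: dist_norm)
  qed
  then have "b \<in> closure L" by (simp add: closure_approachable)
  then show False using b L by (simp add: closed_ideal_def)
qed

text \<open>The functional is applied to the positive element
  \<open>t - (x + adj x) / 2 - l\<close>, where \<open>l\<close> contributes nothing. The factor
  \<open>Re (\<phi> 1)\<close> stands for a normalisation, since the two parts into which a state is
  split are not states themselves.\<close>

lemma positive_functional_le_quotient_bound:
  assumes \<phi>: "positive_functional \<phi>" and van: "\<And>l. l \<in> L \<Longrightarrow> \<phi> l = 0"
  shows "Re (\<phi> x) \<le> Re (\<phi> 1) * quotient_bound L x"
proof -
  interpret positive_functional \<phi> by (rule \<phi>)
  have *: "Re (\<phi> x) \<le> Re (\<phi> 1) * t"
    if l: "l \<in> L" "adj l = l" "pos (t *\<^sub>R 1 - (1/2) *\<^sub>R (x + adj x) - l)" for t l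
    using pos_nonneg[OF l(3)] van[OF l(1)] by (simp add: diff add scaleR adj mult.commute)
  show ?thesis
  proof (cases "Re (\<phi> 1) = 0")
    case True
    then show ?thesis using zero_of_one[of x] by simp
  next
    case False
    then have "Re (\<phi> 1) > 0" using one_nonneg by simp
    moreover from this have "Re (\<phi> x) / Re (\<phi> 1) \<le> quotient_bound L x"
      using * by (intro quotient_bound_greatest) (auto simp: divide_le_eq mult.commute)
    ultimately show ?thesis by (simp add: divide_le_eq mult.commute)
  qed
qed

end

theorem pure_functional_exists:
  fixes L :: "'a::unital_cstar_algebra set"
  assumes sep: "separable_space (euclidean :: 'a topology)"
    and L: "closed_ideal L" and b: "b \<notin> L"
  obtains \<phi> where "pure_functional \<phi>" "\<And>l. l \<in> L \<Longrightarrow> \<phi> l = 0" "\<phi> (adj b * b) \<noteq> 0"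
proof -
  have proper: "1 \<notin> L" using b closed_ideal_mult_left[OF L, of 1 b] by auto
  define p where "p = quotient_bound L"
  obtain U :: "'a set" where U: "countable U" "closure U = UNIV"
    using sep by (auto simp: separable_space_def)
  then have "U \<noteq> {}" by auto
  \<comment> \<open>Placing \<open>adj b * b\<close> in front of a dense sequence makes the
    functional equal to \<open>p\<close> there, and \<open>quotient_bound_pos\<close> makes that
    value positive.\<close>
  define d where "d n = (case n of 0 \<Rightarrow> adj b * b | Suc n \<Rightarrow> from_nat_into U n)" for n
  have "U \<subseteq> range d"
  proof
    fix x assume "x \<in> U"
    then obtain n where "from_nat_into U n = x" using U(1) from_nat_into_surj by metis
    then have "x = d (Suc n)" by (simp add: d_def)
    then show "x \<in> range d" by blast
  qed
  then have dense: "closure (range d) = UNIV" using U(2) closure_mono[of U "range d"] by auto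
  obtain f where f: "linear f" "\<forall>x. f x \<le> p x" "f (d 0) = p (d 0)"
    "\<forall>g h c. linear g \<longrightarrow> linear h \<longrightarrow> (\<forall>x. g x \<le> p x) \<longrightarrow> (\<forall>x. h x \<le> p x) \<longrightarrow> 0 < c \<longrightarrow> c < 1 \<longrightarrow>
       (\<forall>x. f x = c * g x + (1 - c) * h x) \<longrightarrow> g = f"
    by (rule extreme_linear_minorant[OF quotient_bound_sublinear[OF L proper, folded p_def]
          quotient_bound_le_norm[OF L proper, folded p_def] dense]) (rule that)
  note lower = quotient_bound_lower[OF L proper, folded p_def]
  \<comment> \<open>The case \<open>l = 0\<close> says that \<open>f\<close> ignores skew-adjoint
    elements and so is invariant under \<open>adj\<close>; the case \<open>x = l\<close> makes it
    vanish on the selfadjoint part of \<open>L\<close>.\<close>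
  have f0: "f x = 0" if x: "l \<in> L" "adj l = l" "x + adj x = 2 *\<^sub>R l" for x l
  proof -
    have "f x \<le> 0" using lower[of l 0 x] f(2) x order_trans closed_ideal_uminus[OF L]
      lower[of "- l" 0 x] by (fastforce simp: adj_simps)
    moreover have "- x + adj (- x) = - (2 *\<^sub>R l)" by (simp add: adj_simps x(3)[symmetric])
    then have "f (- x) \<le> 0" using lower[of l 0 "- x"] f(2)[rule_format, of "- x"] x by simp
    ultimately show ?thesis using f(1) by (simp add: linear_neg)
  qed
  have f_adj: "f (adj x) = f x" for x
    using f0[of 0 "x - adj x"] closed_ideal_zero[OF L] f(1) by (simp add: adj_simps linear_diff)
  have f_one: "f 1 = 1"
  proof -
    have "(1/2) *\<^sub>R (1 + adj (1::'a)) = 1" by (simp flip: scaleR_2)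
    then have "p 1 \<le> 1" using lower[of 0 1 1] closed_ideal_zero[OF L] by simp
    moreover have "(1/2) *\<^sub>R (- 1 + adj (- 1::'a)) = - 1" by (simp add: adj_minus flip: scaleR_2)
    then have "p (- 1) \<le> - 1" using lower[of 0 "- 1" "- 1"] closed_ideal_zero[OF L] by simp
    ultimately show ?thesis
      using f(2)[rule_format, of 1] f(2)[rule_format, of "- 1"] f(1) by (simp add: linear_neg)
  qed
  have f_pos: "0 \<le> f (adj x * x)" for x
  proof -
    have "(1/2) *\<^sub>R (- (adj x * x) + adj (- (adj x * x))) = - (adj x * x)"
      by (simp add: adj_simps flip: scaleR_2)
    then have "p (- (adj x * x)) \<le> 0"
      using lower[of 0 0 "- (adj x * x)"] closed_ideal_zero[OF L] pos_adj_mult_self[of x] by simp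
    then show ?thesis using f(2)[rule_format, of "- (adj x * x)"] f(1) by (simp add: linear_neg)
  qed
  define \<phi> where "\<phi> x = Complex (f x) (- f (\<i> *\<^sub>C x))" for x
  have Re_\<phi>: "Re (\<phi> x) = f x" for x by (simp add: \<phi>_def)
  have pf: "positive_functional \<phi>"
  proof
    show "\<phi> (x + y) = \<phi> x + \<phi> y" for x y
      using f(1) by (simp add: \<phi>_def complex_eq_iff linear_add scaleC_add_right)
    show "\<phi> (c *\<^sub>C x) = c * \<phi> x" for c x
    proof -
      have "c *\<^sub>C x = Re c *\<^sub>R x + Im c *\<^sub>R (\<i> *\<^sub>C x)"
        by (subst complex_eq[of c]) (simp add: scaleR_scaleC scaleC_scaleC scaleC_add_left mult.commute)
      moreover from this have "\<i> *\<^sub>C c *\<^sub>C x = Re c *\<^sub>R (\<i> *\<^sub>C x) - Im c *\<^sub>R x"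
        by (simp add: scaleC_add_right scaleR_scaleC scaleC_scaleC)
          (simp add: scaleC_minus_left mult.commute flip: scaleC_scaleC)
      ultimately show ?thesis
        using f(1) by (simp add: \<phi>_def complex_eq_iff linear_add linear_diff linear_scale)
    qed
    show "\<phi> (adj x) = cnj (\<phi> x)" for x
    proof -
      have "\<i> *\<^sub>C adj x = adj (- (\<i> *\<^sub>C x))" by (simp add: adj_simps scaleC_minus_left)
      then have "f (\<i> *\<^sub>C adj x) = - f (\<i> *\<^sub>C x)" using f(1) by (simp add: f_adj linear_neg)
      then show ?thesis by (simp add: \<phi>_def complex_eq_iff f_adj)
    qed
    show "0 \<le> Re (\<phi> (adj x * x))" for x by (simp add: Re_\<phi> f_pos)
  qed
  interpret positive_functional \<phi> by (rule pf)
  have \<phi>_one: "\<phi> 1 = 1"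
    using adj[of 1] f_one by (simp add: complex_eq_iff Re_\<phi>)
  have van: "\<phi> l = 0" if "l \<in> L" for l
  proof -
    have "f (adj l * l) = 0"
      using f0[of "adj l * l" "adj l * l"] closed_ideal_mult_left[OF L that]
      by (simp add: adj_simps scaleR_2)
    then show ?thesis using cmod_square_le[of l] by (simp add: Re_\<phi>)
  qed
  have "\<exists>\<mu>. \<forall>x. \<psi> x = \<mu> * \<phi> x"
    if \<psi>: "positive_functional \<psi>" and le: "\<forall>x. Re (\<psi> (adj x * x)) \<le> Re (\<phi> (adj x * x))" for \<psi>
  proof -
    interpret \<psi>: positive_functional \<psi> by (rule \<psi>)
    define \<mu> where "\<mu> = Re (\<psi> 1)"
    have \<mu>: "0 \<le> \<mu>" "\<mu> \<le> 1"
      using \<psi>.one_nonneg le[rule_format, of 1] by (simp_all add: \<mu>_def \<phi>_one)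
    have \<chi>: "positive_functional (\<lambda>x. \<phi> x - \<psi> x)"
      by standard (use le in \<open>simp_all add: add scaleC adj \<psi>.add \<psi>.scaleC \<psi>.adj algebra_simps\<close>)
    interpret \<chi>: positive_functional "\<lambda>x. \<phi> x - \<psi> x" by (rule \<chi>)
    have \<psi>_van: "\<psi> l = 0" if "l \<in> L" for l
    proof -
      have "Re (\<psi> (adj l * l)) \<le> 0"
        using le[rule_format, of l] van[OF closed_ideal_mult_left[OF L that]] by simp
      then have "Re (\<psi> (adj l * l)) = 0" using \<psi>.nonneg[of l] by simp
      then show ?thesis using \<psi>.cmod_square_le[of l] by simp
    qed
    consider "\<mu> = 0" | "\<mu> = 1" | "0 < \<mu>" "\<mu> < 1" using \<mu> by linarith
    then show ?thesis
    proof cases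
      case 1
      then show ?thesis using \<psi>.zero_of_one by (intro exI[of _ 0]) (simp add: \<mu>_def)
    next
      case 2
      then have "\<phi> x - \<psi> x = 0" for x by (intro \<chi>.zero_of_one) (simp add: \<phi>_one \<mu>_def)
      then show ?thesis by (intro exI[of _ 1]) simp
    next
      case 3
      \<comment> \<open>The two summands of \<open>\<phi> = \<psi> + (\<phi> - \<psi>)\<close>,
        scaled to take the value 1 at the unit, exhibit \<open>f\<close> as a convex combination of
        functionals below \<open>p\<close>.\<close>
      define g h where "g x = Re (\<psi> x) / \<mu>" and "h x = Re (\<phi> x - \<psi> x) / (1 - \<mu>)" for x
      have "linear g" "linear h"
        using \<psi>.Re_linear \<chi>.Re_linear unfolding linear_iff
        by (simp_all add: g_def h_def add_divide_distrib diff_divide_distrib right_diff_distrib)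
      moreover have "\<forall>x. g x \<le> p x"
        using positive_functional_le_quotient_bound[OF L proper \<psi> \<psi>_van] 3
        by (simp add: g_def p_def \<mu>_def divide_le_eq mult.commute)
      moreover have "\<forall>x. h x \<le> p x"
        using positive_functional_le_quotient_bound[OF L proper \<chi>] van \<psi>_van 3
        by (simp add: h_def p_def \<mu>_def divide_le_eq mult.commute \<phi>_one)
      moreover have "\<forall>x. f x = \<mu> * g x + (1 - \<mu>) * h x"
        using 3 by (simp add: g_def h_def Re_\<phi>)
      ultimately have gf: "g = f" using f(4) 3 by blast
      have "Re (\<psi> x) = \<mu> * Re (\<phi> x)" for x
        using fun_cong[OF gf, of x] 3 by (simp add: g_def Re_\<phi> field_simps)
      then have "\<psi> x = complex_of_real \<mu> * \<phi> x" for x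
        by (subst \<psi>.eq_of_Re, subst eq_of_Re) (simp add: complex_eq_iff)
      then show ?thesis by blast
    qed
  qed
  then have "pure_functional \<phi>" by (simp add: pure_functional_def pf \<phi>_one)
  moreover have "\<phi> (adj b * b) \<noteq> 0"
  proof -
    have "f (adj b * b) > 0"
      using f(3) quotient_bound_pos[OF L proper b] by (simp add: d_def p_def)
    then show ?thesis using Re_\<phi>[of "adj b * b"] by auto
  qed
  ultimately show thesis using van that by blast
qed

section \<open>The irreducible representation of an extreme state\<close>

context complex_hilbert_space
begin

abbreviation hsub :: "'h \<Rightarrow> 'h \<Rightarrow> 'h" where
  "hsub x y \<equiv> hadd H x (hscale H (-1) y)"

lemmas inner_expand = inner_add_left inner_add_right inner_scale_left inner_scale_right
  add_closed scale_closed

lemma hnorm_nonneg: "x \<in> hcarrier H \<Longrightarrow> 0 \<le> hnorm H x"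
  by (simp add: hnorm_def inner_nonneg)

lemma hnorm_square: "x \<in> hcarrier H \<Longrightarrow> (hnorm H x)\<^sup>2 = Re (hinner H x x)"
  by (simp add: hnorm_def inner_nonneg)

text \<open>Moving \<open>w\<close> along \<open>k\<close> gives a quadratic polynomial bounded
  below by \<open>d\<close>, evaluated at its minimum \<open>t = 1 / q\<close>. The defect
  \<open>e\<close> is kept so that the bound applies to each term of a minimising sequence.\<close>

lemma inner_near_minimum:
  assumes v: "v \<in> hcarrier H" and w: "w \<in> hcarrier H" and k: "k \<in> hcarrier H"
    and d: "\<And>c. d \<le> (hnorm H (hsub v (hadd H w (hscale H c k))))\<^sup>2"
    and e: "(hnorm H (hsub v w))\<^sup>2 \<le> d + e"
  shows "cmod (hinner H (hsub v w) k) \<le> sqrt e * hnorm H k"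
proof -
  define s Q q where "s = hinner H (hsub v w) k" and "Q = Re (hinner H (hsub v w) (hsub v w))"
    and "q = Re (hinner H k k)"
  have vw: "hsub v w \<in> hcarrier H" using v w by (intro add_closed scale_closed)
  have Q: "Q = (hnorm H (hsub v w))\<^sup>2" using hnorm_square[OF vw] by (simp add: Q_def)
  have sc: "hinner H k (hsub v w) = cnj s" using inner_commute[OF vw k] by (simp add: s_def)
  have e0: "e \<ge> 0"
    using d[of 0] e v w k
    by (simp add: scale_zero_left add_zero)
  have key: "d \<le> Q - 2 * t * (cmod s)\<^sup>2 + t\<^sup>2 * (cmod s)\<^sup>2 * q" for t :: real
  proof -
    define c where "c = complex_of_real t * s"
    have m: "hsub v (hadd H w (hscale H c k)) \<in> hcarrier H"
      using v w k by (intro add_closed scale_closed)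
    have "hinner H (hsub v (hadd H w (hscale H c k))) (hsub v (hadd H w (hscale H c k)))
      = hinner H (hsub v w) (hsub v w) - cnj c * s - c * cnj s + c * cnj c * hinner H k k"
      unfolding s_def using v w k inner_commute[OF v k] inner_commute[OF w k]
      by (simp add: inner_expand algebra_simps)
    moreover have "cnj c * s = complex_of_real (t * (cmod s)\<^sup>2)" "c * cnj s = complex_of_real (t * (cmod s)\<^sup>2)"
      "c * cnj c = complex_of_real (t\<^sup>2 * (cmod s)\<^sup>2)"
      using complex_norm_square[of s] by (simp_all add: c_def power2_eq_square mult_ac)
    ultimately have "Re (hinner H (hsub v (hadd H w (hscale H c k))) (hsub v (hadd H w (hscale H c k))))
      = Q - 2 * t * (cmod s)\<^sup>2 + t\<^sup>2 * (cmod s)\<^sup>2 * q"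
      by (simp add: Q_def q_def)
    then show ?thesis using d[of c] hnorm_square[OF m] by simp
  qed
  have "(cmod s)\<^sup>2 \<le> e * q"
  proof (cases "q = 0")
    case True
    then have "hinner H k k = 0" using inner_self[OF k] by (simp add: q_def)
    then have "k = hzero H" using inner_definite k by blast
    then have "s = 0" using inner_zero_left[OF vw] sc by simp
    then show ?thesis using True by simp
  next
    case False
    then have q: "q > 0" using inner_nonneg[OF k] by (simp add: q_def)
    have "(cmod s)\<^sup>2 / q \<le> Q - d" using key[of "1/q"] q by (simp add: power2_eq_square)
    then have "(cmod s)\<^sup>2 / q \<le> e" using e by (simp add: Q)
    then show ?thesis using q by (simp add: divide_le_eq)
  qed
  also have "e * q = (sqrt e * hnorm H k)\<^sup>2"
    using e0 hnorm_square[OF k] by (simp add: q_def power_mult_distrib)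
  finally show ?thesis
    unfolding s_def by (rule power2_le_imp_le) (simp add: e0 hnorm_nonneg[OF k])
qed

text \<open>A minimising sequence is almost orthogonal to \<open>K\<close> in the sense of
  \<open>inner_near_minimum\<close>. Testing this with the difference \<open>z\<close> of two of its
  terms, itself in \<open>K\<close>, shows that the sequence is Cauchy; testing it with
  \<open>k\<close> gives orthogonality in the limit.\<close>

lemma orthogonal_projection:
  assumes K: "closed_hsubspace H K" and v: "v \<in> hcarrier H"
  obtains w where "w \<in> K" "\<And>k. k \<in> K \<Longrightarrow> hinner H (hsub v w) k = 0"
proof -
  have KH: "x \<in> hcarrier H" if "x \<in> K" for x using K that by (auto simp: closed_hsubspace_def)
  have K0: "hzero H \<in> K" and Ka: "\<And>x y. x \<in> K \<Longrightarrow> y \<in> K \<Longrightarrow> hadd H x y \<in> K"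
    and Ks: "\<And>c x. x \<in> K \<Longrightarrow> hscale H c x \<in> K"
    using K by (auto simp: closed_hsubspace_def)
  define F where "F x = (hnorm H (hsub v x))\<^sup>2" for x
  define d where "d = (INF x\<in>K. F x)"
  have bdd: "bdd_below (F ` K)" by (intro bdd_belowI2[where m=0]) (simp add: F_def)
  have dF: "d \<le> F x" if "x \<in> K" for x unfolding d_def using that by (intro cINF_lower bdd)
  define \<epsilon> where "\<epsilon> n = inverse (real (Suc n))" for n
  have \<epsilon>: "\<epsilon> n > 0" for n by (simp add: \<epsilon>_def)
  have "\<exists>x\<in>K. F x < d + \<epsilon> n" for n
    using cINF_less_iff[OF _ bdd, of "d + \<epsilon> n"] K0 \<epsilon>[of n] unfolding d_def by auto
  then obtain X where XK: "\<And>n. X n \<in> K" and XF: "\<And>n. F (X n) < d + \<epsilon> n" by metis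
  have near: "cmod (hinner H (hsub v (X n)) k) \<le> sqrt (\<epsilon> n) * hnorm H k" if k: "k \<in> K" for n k
    using XF[of n] dF Ka[OF XK Ks[OF k]]
    by (intro inner_near_minimum[OF v KH[OF XK] KH[OF k], of d]) (auto simp: F_def)
  have lim_\<epsilon>: "(\<lambda>n. sqrt (\<epsilon> n)) \<longlonglongrightarrow> 0"
    using tendsto_real_sqrt[OF LIMSEQ_inverse_real_of_nat] by (simp add: \<epsilon>_def)
  have dist_X: "hdist H (X m) (X n) \<le> sqrt (\<epsilon> m) + sqrt (\<epsilon> n)" for m n
  proof -
    define z where "z = hsub (X m) (X n)"
    have z: "z \<in> K" using XK Ka Ks by (simp add: z_def)
    note Hs = v KH[OF XK[of m]] KH[OF XK[of n]] KH[OF z]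
    have "hinner H z z = hinner H (hsub v (X n)) z - hinner H (hsub v (X m)) z"
      by (subst z_def) (use Hs in \<open>simp add: inner_expand\<close>)
    then have "cmod (hinner H z z) \<le> cmod (hinner H (hsub v (X n)) z) + cmod (hinner H (hsub v (X m)) z)"
      by (simp only: norm_triangle_ineq4)
    then have "(hnorm H z)\<^sup>2 \<le> (sqrt (\<epsilon> m) + sqrt (\<epsilon> n)) * hnorm H z"
      using near[OF z, of m] near[OF z, of n] complex_Re_le_cmod[of "hinner H z z"]
      by (simp add: hnorm_square[OF KH[OF z]] distrib_right)
    then have "hnorm H z \<le> sqrt (\<epsilon> m) + sqrt (\<epsilon> n)"
      using hnorm_nonneg[OF KH[OF z]] \<epsilon>[of m] \<epsilon>[of n]
      by (cases "hnorm H z = 0") (auto simp: power2_eq_square less_imp_le)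
    then show ?thesis by (simp add: hdist_def z_def)
  qed
  have "\<exists>N. \<forall>m\<ge>N. \<forall>n\<ge>N. hdist H (X m) (X n) < e" if e: "e > 0" for e
  proof -
    obtain N where N: "\<forall>n\<ge>N. sqrt (\<epsilon> n) < e/2"
      using order_tendstoD(2)[OF lim_\<epsilon>, of "e/2"] e by (auto simp: eventually_sequentially)
    have "hdist H (X m) (X n) < e" if "m \<ge> N" "n \<ge> N" for m n
      using dist_X[of m n] N that by (smt (verit) field_sum_of_halves)
    then show ?thesis by blast
  qed
  then obtain w where w: "w \<in> hcarrier H" and lim: "(\<lambda>n. hdist H (X n) w) \<longlonglongrightarrow> 0"
    using complete[of X] KH[OF XK] by blast
  have "w \<in> K" using closed_hsubspace_limit[OF K w _ lim] XK by blast
  moreover have "hinner H (hsub v w) k = 0" if k: "k \<in> K" for k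
  proof -
    have le: "cmod (hinner H (hsub v w) k) \<le> sqrt (\<epsilon> n) * hnorm H k + hdist H (X n) w * hnorm H k" for n
    proof -
      note Hs = v w KH[OF XK[of n]] KH[OF k]
      have "hinner H (hsub v w) k = hinner H (hsub v (X n)) k + hinner H (hsub (X n) w) k"
        using Hs by (simp add: inner_expand)
      then have "cmod (hinner H (hsub v w) k) \<le> cmod (hinner H (hsub v (X n)) k) + cmod (hinner H (hsub (X n) w) k)"
        by (simp only: norm_triangle_ineq)
      moreover have "cmod (hinner H (hsub (X n) w) k) \<le> hdist H (X n) w * hnorm H k"
        unfolding hdist_def using Hs by (intro cauchy_schwarz add_closed scale_closed)
      ultimately show ?thesis using near[OF k, of n] by linarith
    qed
    have "(\<lambda>n. sqrt (\<epsilon> n) * hnorm H k + hdist H (X n) w * hnorm H k) \<longlonglongrightarrow> 0 * hnorm H k + 0 * hnorm H k"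
      by (intro tendsto_intros lim_\<epsilon> lim)
    then have "cmod (hinner H (hsub v w) k) \<le> 0"
      using LIMSEQ_le_const[of _ "0 * hnorm H k + 0 * hnorm H k"] le by fastforce
    then show ?thesis by simp
  qed
  ultimately show thesis by (rule that)
qed

end

text \<open>Left multiplication by \<open>a\<close>, moved to the other argument of the inner
  product that \<open>u b\<close> encodes. No representing sequence is mentioned, so nothing has to
  be well defined.\<close>

definition gns_act :: "'a::unital_cstar_algebra \<Rightarrow> ('a \<Rightarrow> complex) \<Rightarrow> 'a \<Rightarrow> complex" where
  "gns_act a u b = u (adj a * b)"

section \<open>The completion of the algebra in the seminorm of a positive functional\<close>

context positive_functional
begin

definition seminorm :: "'a \<Rightarrow> real" where
  "seminorm x = sqrt (Re (\<phi> (adj x * x)))"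

lemma seminorm_nonneg: "0 \<le> seminorm x"
  by (simp add: seminorm_def nonneg)

lemma seminorm_square: "(seminorm x)\<^sup>2 = Re (\<phi> (adj x * x))"
  by (simp add: seminorm_def nonneg)

lemma cmod_le_seminorm: "cmod (\<phi> (adj y * x)) \<le> seminorm y * seminorm x"
  by (rule power2_le_imp_le)
    (simp_all add: power_mult_distrib seminorm_square seminorm_nonneg cauchy_schwarz)

lemma cmod_self: "cmod (\<phi> (adj x * x)) = (seminorm x)\<^sup>2"
  using self_real[of x] nonneg[of x] by (metis norm_of_real abs_of_nonneg seminorm_square)

lemma seminorm_triangle: "seminorm (x + y) \<le> seminorm x + seminorm y"
proof (rule power2_le_imp_le)
  have "Re (\<phi> (adj x * y)) = Re (\<phi> (adj y * x))"
    using adj[of "adj y * x"] by (simp add: adj_simps)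
  then have "(seminorm (x + y))\<^sup>2 = (seminorm x)\<^sup>2 + 2 * Re (\<phi> (adj y * x)) + (seminorm y)\<^sup>2"
    by (simp add: seminorm_square adj_add distrib_left distrib_right add)
  then show "(seminorm (x + y))\<^sup>2 \<le> (seminorm x + seminorm y)\<^sup>2"
    using cmod_le_seminorm[of y x] complex_Re_le_cmod[of "\<phi> (adj y * x)"]
    by (simp add: power2_eq_square algebra_simps)
qed (simp add: seminorm_nonneg)

lemma seminorm_scaleC: "seminorm (c *\<^sub>C x) = cmod c * seminorm x"
proof -
  have "c * cnj c = complex_of_real ((cmod c)\<^sup>2)" by (metis complex_norm_square)
  then have "\<phi> (adj (c *\<^sub>C x) * (c *\<^sub>C x)) = complex_of_real ((cmod c)\<^sup>2) * \<phi> (adj x * x)"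
    by (simp add: adj_scaleC mult_scaleC_left mult_scaleC_right scaleC scaleC_scaleC)
  then show ?thesis by (simp add: seminorm_def real_sqrt_mult)
qed

lemma seminorm_minus: "seminorm (- x) = seminorm x"
  by (simp add: seminorm_def adj_minus)

lemma seminorm_commute: "seminorm (x - y) = seminorm (y - x)"
  using seminorm_minus[of "x - y"] by simp

lemma seminorm_triangle3: "seminorm (x - z) \<le> seminorm (x - y) + seminorm (y - z)"
  using seminorm_triangle[of "x - y" "y - z"] by simp

lemma seminorm_mult: "seminorm (a * x) \<le> norm a * seminorm x"
proof (rule power2_le_imp_le)
  show "(seminorm (a * x))\<^sup>2 \<le> (norm a * seminorm x)\<^sup>2"
    using pos_mono[OF pos_adj_mult_le[of a x]] by (simp add: seminorm_square power_mult_distrib scaleR)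
qed (simp add: seminorm_nonneg)

definition seminorm_cauchy :: "(nat \<Rightarrow> 'a) \<Rightarrow> bool" where
  "seminorm_cauchy X \<longleftrightarrow> (\<forall>e>0. \<exists>N. \<forall>m\<ge>N. \<forall>n\<ge>N. seminorm (X m - X n) < e)"

lemma seminorm_cauchy_const: "seminorm_cauchy (\<lambda>_. x)"
  by (simp add: seminorm_cauchy_def seminorm_def)

lemma seminorm_cauchy_add:
  assumes "seminorm_cauchy X" "seminorm_cauchy Y"
  shows "seminorm_cauchy (\<lambda>n. X n + Y n)"
  unfolding seminorm_cauchy_def
proof (intro allI impI)
  fix e :: real assume "e > 0"
  then obtain M N where "\<forall>m\<ge>M. \<forall>n\<ge>M. seminorm (X m - X n) < e/2" "\<forall>m\<ge>N. \<forall>n\<ge>N. seminorm (Y m - Y n) < e/2"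
    using assms unfolding seminorm_cauchy_def by (meson half_gt_zero)
  moreover have "seminorm ((X m + Y m) - (X n + Y n)) \<le> seminorm (X m - X n) + seminorm (Y m - Y n)" for m n
    using seminorm_triangle[of "X m - X n" "Y m - Y n"] by (simp add: algebra_simps)
  ultimately show "\<exists>N. \<forall>m\<ge>N. \<forall>n\<ge>N. seminorm ((X m + Y m) - (X n + Y n)) < e"
    by (intro exI[of _ "max M N"]) (smt (verit) field_sum_of_halves max.bounded_iff)
qed

lemma seminorm_cauchy_bounded_map:
  assumes X: "seminorm_cauchy X" and T: "\<And>m n. seminorm (T m - T n) \<le> C * seminorm (X m - X n)"
  shows "seminorm_cauchy T"
  unfolding seminorm_cauchy_def
proof (intro allI impI)
  fix e :: real assume e: "e > 0"
  define D where "D = max C 1"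
  have D: "D > 0" by (simp add: D_def)
  obtain N where N: "\<forall>m\<ge>N. \<forall>n\<ge>N. seminorm (X m - X n) < e / D"
    using X e D unfolding seminorm_cauchy_def by (meson divide_pos_pos)
  have "seminorm (T m - T n) < e" if "m \<ge> N" "n \<ge> N" for m n
  proof -
    have "seminorm (T m - T n) \<le> D * seminorm (X m - X n)"
      using T[of m n] mult_right_mono[of C D "seminorm (X m - X n)"] seminorm_nonneg by (simp add: D_def)
    also have "\<dots> < D * (e / D)" using N that D by (intro mult_strict_left_mono) auto
    finally show ?thesis using D by simp
  qed
  then show "\<exists>N. \<forall>m\<ge>N. \<forall>n\<ge>N. seminorm (T m - T n) < e" by blast
qed

lemma seminorm_cauchy_scaleC: "seminorm_cauchy X \<Longrightarrow> seminorm_cauchy (\<lambda>n. c *\<^sub>C X n)"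
  by (rule seminorm_cauchy_bounded_map[of X _ "cmod c"]) (simp_all add: seminorm_scaleC flip: scaleC_diff_right)

lemma seminorm_cauchy_mult: "seminorm_cauchy X \<Longrightarrow> seminorm_cauchy (\<lambda>n. a * X n)"
  by (rule seminorm_cauchy_bounded_map[of X _ "norm a"]) (simp_all add: seminorm_mult flip: right_diff_distrib)

lemma seminorm_cauchy_bounded:
  assumes "seminorm_cauchy X"
  obtains M where "M > 0" "\<And>n. seminorm (X n) \<le> M"
proof -
  obtain N where N: "\<forall>m\<ge>N. \<forall>n\<ge>N. seminorm (X m - X n) < 1"
    using assms unfolding seminorm_cauchy_def by (meson zero_less_one)
  define M where "M = Max ((\<lambda>n. seminorm (X n)) ` {..N}) + 1"
  have fin: "seminorm (X n) \<le> M - 1" if "n \<le> N" for n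
    using that by (simp add: M_def)
  have "seminorm (X n) \<le> M" for n
  proof (cases "n \<le> N")
    case False
    then have "seminorm (X n - X N) < 1" using N by simp
    then show ?thesis using seminorm_triangle[of "X n - X N" "X N"] fin[of N] by simp
  qed (use fin[of n] in simp)
  moreover have "M > 0" using fin[of 0] seminorm_nonneg[of "X 0"] by simp
  ultimately show thesis using that by blast
qed

lemma seminorm_cauchy_pair_convergent:
  assumes X: "seminorm_cauchy X" and Y: "seminorm_cauchy Y"
  shows "convergent (\<lambda>n. \<phi> (adj (Y n) * X n))"
proof -
  obtain A where A: "A > 0" "\<And>n. seminorm (X n) \<le> A" using seminorm_cauchy_bounded[OF X] by blast
  obtain B where B: "B > 0" "\<And>n. seminorm (Y n) \<le> B" using seminorm_cauchy_bounded[OF Y] by blast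
  have "Cauchy (\<lambda>n. \<phi> (adj (Y n) * X n))"
  proof (rule metric_CauchyI)
    fix e :: real assume e: "e > 0"
    obtain M N where M: "\<forall>m\<ge>M. \<forall>n\<ge>M. seminorm (X m - X n) < e / (2 * B)"
      and N: "\<forall>m\<ge>N. \<forall>n\<ge>N. seminorm (Y m - Y n) < e / (2 * A)"
      using X Y e A(1) B(1) unfolding seminorm_cauchy_def by (meson divide_pos_pos mult_pos_pos zero_less_numeral)
    have "dist (\<phi> (adj (Y m) * X m)) (\<phi> (adj (Y n) * X n)) < e" if mn: "m \<ge> max M N" "n \<ge> max M N" for m n
    proof -
      have "\<phi> (adj (Y m) * X m) - \<phi> (adj (Y n) * X n)
          = \<phi> (adj (Y m) * (X m - X n)) + \<phi> (adj (Y m - Y n) * X n)"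
        by (simp add: adj_diff left_diff_distrib right_diff_distrib diff)
      then have "dist (\<phi> (adj (Y m) * X m)) (\<phi> (adj (Y n) * X n))
          \<le> cmod (\<phi> (adj (Y m) * (X m - X n))) + cmod (\<phi> (adj (Y m - Y n) * X n))"
        by (simp only: dist_norm norm_triangle_ineq)
      also have "\<dots> \<le> seminorm (Y m) * seminorm (X m - X n) + seminorm (Y m - Y n) * seminorm (X n)"
        by (intro add_mono cmod_le_seminorm)
      also have "\<dots> \<le> B * seminorm (X m - X n) + seminorm (Y m - Y n) * A"
        using A B seminorm_nonneg by (intro add_mono mult_right_mono mult_left_mono)
      also have "\<dots> < B * (e / (2 * B)) + e / (2 * A) * A"
        using M N mn A(1) B(1) by (intro add_strict_mono mult_strict_left_mono mult_strict_right_mono) auto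
      also have "\<dots> = e" using A(1) B(1) by (simp add: field_simps)
      finally show ?thesis .
    qed
    then show "\<exists>M. \<forall>m\<ge>M. \<forall>n\<ge>M. dist (\<phi> (adj (Y m) * X m)) (\<phi> (adj (Y n) * X n)) < e" by blast
  qed
  then show ?thesis by (rule Cauchy_convergent)
qed

text \<open>Weak convergence to 0 of a Cauchy sequence is convergence in seminorm: the square of
  \<open>seminorm (Z n)\<close> is split by means of a later \<open>Z m\<close>, and
  \<open>m\<close> tends to infinity with \<open>Z n\<close> as the test element. Hence a function
  determines the class of its representing sequence.\<close>

lemma seminorm_cauchy_null:
  assumes Z: "seminorm_cauchy Z" and lim: "\<And>b. (\<lambda>n. \<phi> (adj b * Z n)) \<longlonglongrightarrow> 0"
  shows "(\<lambda>n. seminorm (Z n)) \<longlonglongrightarrow> 0"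
proof -
  obtain B where B: "B > 0" "\<And>n. seminorm (Z n) \<le> B" using seminorm_cauchy_bounded[OF Z] by blast
  show ?thesis
  proof (rule LIMSEQ_I)
    fix e :: real assume e: "e > 0"
    have "e\<^sup>2 / (2 * B) > 0" using e B by simp
    then obtain N where N: "\<forall>m\<ge>N. \<forall>n\<ge>N. seminorm (Z m - Z n) < e\<^sup>2 / (2 * B)"
      using Z unfolding seminorm_cauchy_def by blast
    have "norm (seminorm (Z n) - 0) < e" if n: "n \<ge> N" for n
    proof -
      have "(seminorm (Z n))\<^sup>2 \<le> e\<^sup>2 / 2 + cmod (\<phi> (adj (Z n) * Z m))" if m: "m \<ge> N" for m
      proof -
        have "\<phi> (adj (Z n) * Z n) = \<phi> (adj (Z n) * (Z n - Z m)) + \<phi> (adj (Z n) * Z m)"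
          by (simp add: right_diff_distrib diff)
        then have "(seminorm (Z n))\<^sup>2 \<le> cmod (\<phi> (adj (Z n) * (Z n - Z m))) + cmod (\<phi> (adj (Z n) * Z m))"
          unfolding cmod_self[symmetric] by (simp only: norm_triangle_ineq)
        moreover have "cmod (\<phi> (adj (Z n) * (Z n - Z m))) \<le> B * (e\<^sup>2 / (2 * B))"
          using cmod_le_seminorm[of "Z n" "Z n - Z m"] N n m B seminorm_nonneg
          by (meson less_imp_le mult_mono order_trans)
        ultimately show ?thesis using B by simp
      qed
      moreover have "(\<lambda>m. e\<^sup>2 / 2 + cmod (\<phi> (adj (Z n) * Z m))) \<longlonglongrightarrow> e\<^sup>2 / 2 + 0"
        by (intro tendsto_intros tendsto_norm_zero lim)
      ultimately have "(seminorm (Z n))\<^sup>2 \<le> e\<^sup>2 / 2 + 0"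
        using LIMSEQ_le_const[of _ "e\<^sup>2 / 2 + 0" "(seminorm (Z n))\<^sup>2"] by blast
      also have "\<dots> < e\<^sup>2" using e by simp
      finally have "seminorm (Z n) < e" using e power_less_imp_less_base[of "seminorm (Z n)" 2 e] by simp
      then show ?thesis using seminorm_nonneg[of "Z n"] by simp
    qed
    then show "\<exists>N. \<forall>n\<ge>N. norm (seminorm (Z n) - 0) < e" by blast
  qed
qed

text \<open>
  The class of a Cauchy sequence \<open>X\<close> in the completion is encoded by the function
  \<open>b \<mapsto> lim \<langle>X n, b\<rangle>\<close>.
\<close>

definition represents :: "(nat \<Rightarrow> 'a) \<Rightarrow> ('a \<Rightarrow> complex) \<Rightarrow> bool" where
  "represents X u \<longleftrightarrow> seminorm_cauchy X \<and> (\<forall>b. (\<lambda>n. \<phi> (adj b * X n)) \<longlonglongrightarrow> u b)"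

lemma seminorm_cauchy_represents:
  assumes "seminorm_cauchy X"
  obtains u where "represents X u"
proof -
  have "\<exists>l. (\<lambda>n. \<phi> (adj b * X n)) \<longlonglongrightarrow> l" for b
    using seminorm_cauchy_pair_convergent[OF assms seminorm_cauchy_const[of b]] by (simp add: convergent_def)
  then obtain u where "\<forall>b. (\<lambda>n. \<phi> (adj b * X n)) \<longlonglongrightarrow> u b" by metis
  then show thesis using assms that by (auto simp: represents_def)
qed

lemma represents_add:
  assumes "represents X u" "represents Y w"
  shows "represents (\<lambda>n. X n + Y n) (\<lambda>b. u b + w b)"
  using assms unfolding represents_def by (simp add: seminorm_cauchy_add distrib_left add tendsto_add)

lemma represents_scale:
  assumes "represents X u"
  shows "represents (\<lambda>n. c *\<^sub>C X n) (\<lambda>b. c * u b)"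
  using assms unfolding represents_def
  by (simp add: seminorm_cauchy_scaleC mult_scaleC_right scaleC tendsto_mult_left)

lemma represents_mult:
  assumes "represents X u"
  shows "represents (\<lambda>n. a * X n) (\<lambda>b. u (adj a * b))"
proof -
  have "(\<lambda>n. \<phi> (adj b * (a * X n))) \<longlonglongrightarrow> u (adj a * b)" for b
    using assms unfolding represents_def by (simp add: adj_simps mult.assoc[symmetric]) (metis adj_adj adj_mult)
  then show ?thesis using assms seminorm_cauchy_mult unfolding represents_def by blast
qed

definition hat :: "'a \<Rightarrow> 'a \<Rightarrow> complex" where
  "hat x b = \<phi> (adj b * x)"

lemma represents_hat: "represents (\<lambda>_. x) (hat x)"
  by (simp add: represents_def seminorm_cauchy_const hat_def)

definition rep_seq :: "('a \<Rightarrow> complex) \<Rightarrow> nat \<Rightarrow> 'a" where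
  "rep_seq u = (SOME X. represents X u)"

lemma represents_rep_seq: "represents X u \<Longrightarrow> represents (rep_seq u) u"
  unfolding rep_seq_def by (rule someI[of "\<lambda>X. represents X u"])

definition gns_space :: "('a \<Rightarrow> complex) hilbert" where
  "gns_space = \<lparr>hcarrier = {u. \<exists>X. represents X u}, hzero = (\<lambda>_. 0), hadd = (\<lambda>u w b. u b + w b),
    hscale = (\<lambda>c u b. c * u b), hinner = (\<lambda>u w. lim (\<lambda>n. \<phi> (adj (rep_seq w n) * rep_seq u n)))\<rparr>"

lemma gns_space_sel: "hcarrier gns_space = {u. \<exists>X. represents X u}" "hzero gns_space = (\<lambda>_. 0)"
  "hadd gns_space = (\<lambda>u w b. u b + w b)" "hscale gns_space = (\<lambda>c u b. c * u b)"
  by (simp_all add: gns_space_def)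

lemma represents_diff_null:
  assumes X: "represents X u" and Y: "represents Y u"
  shows "(\<lambda>n. seminorm (X n - Y n)) \<longlonglongrightarrow> 0"
proof (rule seminorm_cauchy_null)
  have "represents (\<lambda>n. X n + (-1) *\<^sub>C Y n) (\<lambda>b. u b + (-1) * u b)"
    by (intro represents_add represents_scale X Y)
  then have "represents (\<lambda>n. X n - Y n) (\<lambda>b. 0)" by (simp add: scaleC_minus_left)
  then show "seminorm_cauchy (\<lambda>n. X n - Y n)" "(\<lambda>n. \<phi> (adj b * (X n - Y n))) \<longlonglongrightarrow> 0" for b
    by (auto simp: represents_def)
qed

text \<open>The inner product is defined through a chosen sequence for each function. Its
  independence of that choice reduces the Hilbert space axioms to limits of facts about
  \<open>\<phi>\<close>.\<close>

lemma inner_limit: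
  assumes X: "represents X u" and Y: "represents Y w"
  shows "(\<lambda>n. \<phi> (adj (Y n) * X n)) \<longlonglongrightarrow> hinner gns_space u w"
proof -
  define X' Y' where "X' = rep_seq u" and "Y' = rep_seq w"
  have X': "represents X' u" and Y': "represents Y' w"
    unfolding X'_def Y'_def using X Y represents_rep_seq by blast+
  have seminorm_cauchy: "seminorm_cauchy X" "seminorm_cauchy X'" "seminorm_cauchy Y" "seminorm_cauchy Y'" using X Y X' Y' by (auto simp: represents_def)
  obtain A where A: "\<And>n. seminorm (X n) \<le> A" using seminorm_cauchy_bounded[OF seminorm_cauchy(1)] by blast
  obtain B where B: "\<And>n. seminorm (Y' n) \<le> B" using seminorm_cauchy_bounded[OF seminorm_cauchy(4)] by blast
  have "convergent (\<lambda>n. \<phi> (adj (Y' n) * X' n))" by (rule seminorm_cauchy_pair_convergent[OF seminorm_cauchy(2) seminorm_cauchy(4)])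
  then have l: "(\<lambda>n. \<phi> (adj (Y' n) * X' n)) \<longlonglongrightarrow> hinner gns_space u w"
    by (simp add: convergent_LIMSEQ_iff gns_space_def X'_def Y'_def)
  have "(\<lambda>n. \<phi> (adj (Y n) * X n) - \<phi> (adj (Y' n) * X' n)) \<longlonglongrightarrow> 0"
  proof (rule Lim_null_comparison)
    have "(\<lambda>n. seminorm (Y n - Y' n) * A + B * seminorm (X n - X' n)) \<longlonglongrightarrow> 0 * A + B * 0"
      by (intro tendsto_intros represents_diff_null[OF Y Y'] represents_diff_null[OF X X'])
    then show "(\<lambda>n. seminorm (Y n - Y' n) * A + B * seminorm (X n - X' n)) \<longlonglongrightarrow> 0" by simp
    show "\<forall>\<^sub>F n in sequentially. cmod (\<phi> (adj (Y n) * X n) - \<phi> (adj (Y' n) * X' n))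
        \<le> seminorm (Y n - Y' n) * A + B * seminorm (X n - X' n)"
    proof (rule always_eventually, rule allI)
      fix n
      have "\<phi> (adj (Y n) * X n) - \<phi> (adj (Y' n) * X' n)
          = \<phi> (adj (Y n - Y' n) * X n) + \<phi> (adj (Y' n) * (X n - X' n))"
        by (simp add: adj_diff left_diff_distrib right_diff_distrib diff)
      then have "cmod (\<phi> (adj (Y n) * X n) - \<phi> (adj (Y' n) * X' n))
          \<le> cmod (\<phi> (adj (Y n - Y' n) * X n)) + cmod (\<phi> (adj (Y' n) * (X n - X' n)))"
        by (simp only: norm_triangle_ineq)
      also have "\<dots> \<le> seminorm (Y n - Y' n) * seminorm (X n) + seminorm (Y' n) * seminorm (X n - X' n)"
        by (intro add_mono cmod_le_seminorm)
      also have "\<dots> \<le> seminorm (Y n - Y' n) * A + B * seminorm (X n - X' n)"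
        using A B seminorm_nonneg by (intro add_mono mult_left_mono mult_right_mono)
      finally show "cmod (\<phi> (adj (Y n) * X n) - \<phi> (adj (Y' n) * X' n))
        \<le> seminorm (Y n - Y' n) * A + B * seminorm (X n - X' n)" .
    qed
  qed
  from tendsto_add[OF this l] show ?thesis by simp
qed

text \<open>The reproducing property: evaluation at \<open>b\<close> is the inner product with the
  vector of \<open>b\<close>.\<close>

lemma inner_hat:
  assumes "represents X u"
  shows "hinner gns_space u (hat b) = u b"
  using LIMSEQ_unique[OF inner_limit[OF assms represents_hat[of b]]] assms
  by (simp add: represents_def)

lemma hnorm_limit:
  assumes "represents X u"
  shows "(\<lambda>n. seminorm (X n)) \<longlonglongrightarrow> hnorm gns_space u"
  unfolding seminorm_def hnorm_def by (intro tendsto_real_sqrt tendsto_Re inner_limit assms)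

lemma represents_hsub:
  assumes "represents X u" "represents Y w"
  shows "represents (\<lambda>n. X n - Y n) (hadd gns_space u (hscale gns_space (-1) w))"
  using represents_add[OF assms(1) represents_scale[OF assms(2), of "-1"]]
  by (simp add: gns_space_sel scaleC_minus_left)

lemma hdist_limit:
  assumes "represents X u" "represents Y w"
  shows "(\<lambda>n. seminorm (X n - Y n)) \<longlonglongrightarrow> hdist gns_space u w"
  unfolding hdist_def by (rule hnorm_limit[OF represents_hsub[OF assms]])

lemma hdist_triangle:
  assumes u: "represents X u" and v: "represents Y v" and w: "represents Z w"
  shows "hdist gns_space u w \<le> hdist gns_space u v + hdist gns_space v w"
  by (rule LIMSEQ_le[OF hdist_limit[OF u w] tendsto_add[OF hdist_limit[OF u v] hdist_limit[OF v w]]])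
    (use seminorm_triangle3 in blast)

lemma hdist_hat: "hdist gns_space (hat x) (hat y) = seminorm (x - y)"
  using LIMSEQ_unique[OF hdist_limit[OF represents_hat represents_hat]] by simp

lemma hdist_hat_limit:
  assumes X: "represents X u"
  shows "(\<lambda>n. hdist gns_space (hat (X n)) u) \<longlonglongrightarrow> 0"
proof (rule LIMSEQ_I)
  fix e :: real assume e: "e > 0"
  obtain N where N: "\<forall>m\<ge>N. \<forall>n\<ge>N. seminorm (X m - X n) < e/2"
    using X e unfolding represents_def seminorm_cauchy_def by (meson half_gt_zero)
  have "norm (hdist gns_space (hat (X n)) u - 0) < e" if n: "n \<ge> N" for n
  proof -
    note l = hdist_limit[OF represents_hat[of "X n"] X]
    have "hdist gns_space (hat (X n)) u \<le> e/2"
      by (rule LIMSEQ_le_const2[OF l]) (use N n in \<open>auto intro!: exI[of _ N] less_imp_le\<close>)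
    moreover have "0 \<le> hdist gns_space (hat (X n)) u"
      by (rule LIMSEQ_le_const[OF l]) (simp add: seminorm_nonneg)
    ultimately show ?thesis using e by simp
  qed
  then show "\<exists>N. \<forall>n\<ge>N. norm (hdist gns_space (hat (X n)) u - 0) < e" by blast
qed

lemma gns_space_hilbert: "complex_hilbert_space gns_space"
proof
  fix x y assume "x \<in> hcarrier gns_space" "y \<in> hcarrier gns_space"
  then show "hadd gns_space x y \<in> hcarrier gns_space" using represents_add unfolding gns_space_sel by blast
next
  show "hzero gns_space \<in> hcarrier gns_space"
    using represents_hat[of 0] by (auto simp: gns_space_sel hat_def[abs_def])
next
  fix x c assume "x \<in> hcarrier gns_space"
  then show "hscale gns_space c x \<in> hcarrier gns_space" using represents_scale unfolding gns_space_sel by blast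
next
  fix x y z assume "x \<in> hcarrier gns_space" "y \<in> hcarrier gns_space" "z \<in> hcarrier gns_space"
  then obtain X Y Z where X: "represents X x" and Y: "represents Y y" and Z: "represents Z z"
    by (auto simp: gns_space_sel)
  have "(\<lambda>n. \<phi> (adj (Z n) * (X n + Y n))) \<longlonglongrightarrow> hinner gns_space (hadd gns_space x y) z"
    unfolding gns_space_sel by (rule inner_limit[OF represents_add[OF X Y] Z])
  moreover have "(\<lambda>n. \<phi> (adj (Z n) * X n) + \<phi> (adj (Z n) * Y n)) \<longlonglongrightarrow> hinner gns_space x z + hinner gns_space y z"
    by (intro tendsto_add inner_limit X Y Z)
  ultimately show "hinner gns_space (hadd gns_space x y) z = hinner gns_space x z + hinner gns_space y z"
    by (simp add: distrib_left add LIMSEQ_unique)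
next
  fix x y c assume "x \<in> hcarrier gns_space" "y \<in> hcarrier gns_space"
  then obtain X Y where X: "represents X x" and Y: "represents Y y" by (auto simp: gns_space_sel)
  have "(\<lambda>n. \<phi> (adj (Y n) * (c *\<^sub>C X n))) \<longlonglongrightarrow> hinner gns_space (hscale gns_space c x) y"
    unfolding gns_space_sel by (rule inner_limit[OF represents_scale[OF X] Y])
  moreover have "(\<lambda>n. c * \<phi> (adj (Y n) * X n)) \<longlonglongrightarrow> c * hinner gns_space x y"
    by (intro tendsto_mult_left inner_limit X Y)
  ultimately show "hinner gns_space (hscale gns_space c x) y = c * hinner gns_space x y"
    by (simp add: mult_scaleC_right scaleC LIMSEQ_unique)
next
  fix x y assume "x \<in> hcarrier gns_space" "y \<in> hcarrier gns_space"
  then obtain X Y where X: "represents X x" and Y: "represents Y y" by (auto simp: gns_space_sel)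
  have "\<phi> (adj (X n) * Y n) = cnj (\<phi> (adj (Y n) * X n))" for n
    using adj[of "adj (Y n) * X n"] by (simp add: adj_simps)
  then show "hinner gns_space y x = cnj (hinner gns_space x y)"
    using LIMSEQ_unique[OF inner_limit[OF Y X]] tendsto_cnj[OF inner_limit[OF X Y]] by simp
next
  fix x assume "x \<in> hcarrier gns_space"
  then obtain X where X: "represents X x" by (auto simp: gns_space_sel)
  show "0 \<le> Re (hinner gns_space x x)"
    by (rule LIMSEQ_le_const[OF tendsto_Re[OF inner_limit[OF X X]]]) (simp add: nonneg)
  assume "hinner gns_space x x = 0"
  then have l: "(\<lambda>n. seminorm (X n)) \<longlonglongrightarrow> 0" using hnorm_limit[OF X] by (simp add: hnorm_def)
  have "x b = 0" for b
  proof -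
    have "(\<lambda>n. \<phi> (adj b * X n)) \<longlonglongrightarrow> 0"
    proof (rule Lim_null_comparison)
      show "\<forall>\<^sub>F n in sequentially. cmod (\<phi> (adj b * X n)) \<le> seminorm b * seminorm (X n)"
        by (simp add: cmod_le_seminorm)
      show "(\<lambda>n. seminorm b * seminorm (X n)) \<longlonglongrightarrow> 0" using tendsto_mult_left[OF l, of "seminorm b"] by simp
    qed
    moreover have "(\<lambda>n. \<phi> (adj b * X n)) \<longlonglongrightarrow> x b" using X by (simp add: represents_def)
    ultimately show ?thesis using LIMSEQ_unique by metis
  qed
  then show "x = hzero gns_space" by (simp add: gns_space_sel fun_eq_iff)
next
  fix U :: "nat \<Rightarrow> 'a \<Rightarrow> complex"
  assume UH: "\<And>n. U n \<in> hcarrier gns_space"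
    and cauU: "\<And>e. e > 0 \<Longrightarrow> \<exists>N. \<forall>m\<ge>N. \<forall>n\<ge>N. hdist gns_space (U m) (U n) < e"
  define \<epsilon> where "\<epsilon> n = inverse (real (Suc n))" for n
  have lim_\<epsilon>: "\<epsilon> \<longlonglongrightarrow> 0" unfolding \<epsilon>_def by (rule LIMSEQ_inverse_real_of_nat)
  obtain V where V: "\<And>n. represents (V n) (U n)" using UH by (simp add: gns_space_sel) metis
  \<comment> \<open>Completeness by approximation: algebra elements within
    \<open>\<epsilon> k\<close> of \<open>U k\<close> form a Cauchy sequence, which represents the
    limit.\<close>
  have "\<exists>x. hdist gns_space (hat x) (U k) < \<epsilon> k" for k
    using order_tendstoD(2)[OF hdist_hat_limit[OF V[of k]], of "\<epsilon> k"]
    by (auto simp: eventually_sequentially \<epsilon>_def)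
  then obtain x where x: "\<And>k. hdist gns_space (hat (x k)) (U k) < \<epsilon> k" by metis
  have sym: "hdist gns_space u w = hdist gns_space w u" if "represents X u" "represents Y w" for X Y u w
    using LIMSEQ_unique[OF hdist_limit[OF that]] hdist_limit[OF that(2) that(1)] by (simp add: seminorm_commute)
  have "seminorm_cauchy x"
    unfolding seminorm_cauchy_def
  proof (intro allI impI)
    fix e :: real assume e: "e > 0"
    obtain M where M: "\<forall>m\<ge>M. \<forall>n\<ge>M. hdist gns_space (U m) (U n) < e/3" using cauU[of "e/3"] e by auto
    obtain N where N: "\<forall>n\<ge>N. \<epsilon> n < e/3"
      using order_tendstoD(2)[OF lim_\<epsilon>, of "e/3"] e by (auto simp: eventually_sequentially)
    have "seminorm (x m - x n) < e" if mn: "m \<ge> max M N" "n \<ge> max M N" for m n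
    proof -
      have "seminorm (x m - x n) \<le> hdist gns_space (hat (x m)) (U m) + hdist gns_space (U m) (hat (x n))"
        unfolding hdist_hat[symmetric] by (rule hdist_triangle[OF represents_hat V represents_hat])
      also have "hdist gns_space (U m) (hat (x n)) \<le> hdist gns_space (U m) (U n) + hdist gns_space (U n) (hat (x n))"
        by (rule hdist_triangle[OF V V represents_hat])
      also have "hdist gns_space (U n) (hat (x n)) = hdist gns_space (hat (x n)) (U n)"
        by (rule sym[OF V represents_hat])
      finally have "seminorm (x m - x n) \<le> hdist gns_space (hat (x m)) (U m)
          + (hdist gns_space (U m) (U n) + hdist gns_space (hat (x n)) (U n))" by simp
      moreover have "hdist gns_space (U m) (U n) < e/3" "\<epsilon> m < e/3" "\<epsilon> n < e/3" using M N mn by simp_all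
      ultimately show ?thesis using x[of m] x[of n] by linarith
    qed
    then show "\<exists>N. \<forall>m\<ge>N. \<forall>n\<ge>N. seminorm (x m - x n) < e" by blast
  qed
  then obtain u where u: "represents x u" by (rule seminorm_cauchy_represents)
  have "(\<lambda>n. hdist gns_space (U n) u) \<longlonglongrightarrow> 0"
  proof (rule Lim_null_comparison)
    show "(\<lambda>n. \<epsilon> n + hdist gns_space (hat (x n)) u) \<longlonglongrightarrow> 0"
      using tendsto_add[OF lim_\<epsilon> hdist_hat_limit[OF u]] by simp
    have "norm (hdist gns_space (U n) u) \<le> \<epsilon> n + hdist gns_space (hat (x n)) u" for n
    proof -
      have "0 \<le> hdist gns_space (U n) u"
        by (rule LIMSEQ_le_const[OF hdist_limit[OF V u]]) (simp add: seminorm_nonneg)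
      moreover have "hdist gns_space (U n) u \<le> hdist gns_space (U n) (hat (x n)) + hdist gns_space (hat (x n)) u"
        by (rule hdist_triangle[OF V represents_hat u])
      moreover have "hdist gns_space (U n) (hat (x n)) = hdist gns_space (hat (x n)) (U n)"
        by (rule sym[OF V represents_hat])
      ultimately show ?thesis using x[of n] by simp
    qed
    then show "\<forall>\<^sub>F n in sequentially. norm (hdist gns_space (U n) u) \<le> \<epsilon> n + hdist gns_space (hat (x n)) u" by simp
  qed
  then show "\<exists>u\<in>hcarrier gns_space. (\<lambda>n. hdist gns_space (U n) u) \<longlonglongrightarrow> 0"
    using u by (auto simp: gns_space_sel)
qed (simp_all add: gns_space_sel fun_eq_iff algebra_simps)

lemma represents_gns_act: "represents X u \<Longrightarrow> represents (\<lambda>n. a * X n) (gns_act a u)"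
  using represents_mult[of X u a] by (simp add: gns_act_def[abs_def])

text \<open>The argument enters through its adjoint; together with the \<open>adj a\<close> in
  \<open>gns_act\<close> this makes the action linear in \<open>a\<close>.\<close>

lemma represents_antilinear:
  assumes X: "represents X u"
  shows "u (x + y) = u x + u y" "u (c *\<^sub>C x) = cnj c * u x"
proof -
  have l: "(\<lambda>n. \<phi> (adj b * X n)) \<longlonglongrightarrow> u b" for b using X by (simp add: represents_def)
  show "u (x + y) = u x + u y"
    using LIMSEQ_unique[OF l[of "x + y"]] tendsto_add[OF l[of x] l[of y]]
    by (simp add: adj_add distrib_right add)
  show "u (c *\<^sub>C x) = cnj c * u x"
    using LIMSEQ_unique[OF l[of "c *\<^sub>C x"]] tendsto_mult_left[OF l[of x], of "cnj c"]
    by (simp add: adj_scaleC mult_scaleC_left scaleC)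
qed

lemma gns_act_representation: "star_representation gns_space gns_act"
  unfolding star_representation_def
proof (intro conjI allI ballI)
  fix a
  have "hnorm gns_space (gns_act a u) \<le> norm a * hnorm gns_space u" if "represents X u" for X u
    by (rule LIMSEQ_le[OF hnorm_limit[OF represents_gns_act[OF that]] tendsto_mult_left[OF hnorm_limit[OF that]]])
      (use seminorm_mult in blast)
  then have "\<forall>u\<in>hcarrier gns_space. hnorm gns_space (gns_act a u) \<le> norm a * hnorm gns_space u" by (auto simp: gns_space_sel)
  moreover have "gns_act a u \<in> hcarrier gns_space" if "u \<in> hcarrier gns_space" for u
    using that represents_gns_act unfolding gns_space_sel by blast
  ultimately show "bounded_operator gns_space (gns_act a)"
    unfolding bounded_operator_def by (auto simp: gns_space_sel gns_act_def[abs_def])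
next
  fix u assume "u \<in> hcarrier gns_space"
  then obtain X where X: "represents X u" by (auto simp: gns_space_sel)
  show "gns_act 1 u = u" by (simp add: gns_act_def[abs_def])
  show "gns_act (a + b) u = hadd gns_space (gns_act a u) (gns_act b u)" for a b
    by (simp add: gns_act_def[abs_def] gns_space_sel adj_add distrib_right represents_antilinear[OF X])
  show "gns_act (c *\<^sub>C a) u = hscale gns_space c (gns_act a u)" for c a
    by (simp add: gns_act_def[abs_def] gns_space_sel adj_scaleC mult_scaleC_left represents_antilinear[OF X])
  show "gns_act (a * b) u = gns_act a (gns_act b u)" for a b
    by (simp add: gns_act_def[abs_def] adj_mult mult.assoc)
  fix a w assume "w \<in> hcarrier gns_space"
  then obtain Y where Y: "represents Y w" by (auto simp: gns_space_sel)
  have "adj (Y n) * (a * X n) = adj (adj a * Y n) * X n" for n by (simp add: adj_simps mult.assoc)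
  then show "hinner gns_space (gns_act a u) w = hinner gns_space u (gns_act (adj a) w)"
    using LIMSEQ_unique[OF inner_limit[OF represents_gns_act[OF X, of a] Y]]
      inner_limit[OF X represents_gns_act[OF Y, of "adj a"]] by simp
qed

lemma gns_act_hat_one: "gns_act b (hat 1) = hat b"
  by (simp add: gns_act_def[abs_def] hat_def[abs_def] adj_simps)

end

text \<open>Let \<open>w\<close> be the projection of the cyclic vector \<open>v\<close> to an
  invariant subspace \<open>K\<close>. The functional of \<open>w\<close> is dominated by
  \<open>\<phi>\<close>, so purity gives \<open>w = \<mu> v\<close>. For \<open>\<mu> = 0\<close>
  the vector \<open>v\<close> is orthogonal to \<open>K\<close>, which is then zero; otherwise
  \<open>v\<close> lies in \<open>K\<close>, which is then everything.\<close>

lemma pure_functional_irreducible: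
  fixes \<phi> :: "'a::unital_cstar_algebra \<Rightarrow> complex"
  assumes pure: "pure_functional \<phi>"
  shows "irreducible_representation (positive_functional.gns_space \<phi>) gns_act"
proof -
  interpret positive_functional \<phi> using pure by (simp add: pure_functional_def)
  interpret gns_space: complex_hilbert_space gns_space by (rule gns_space_hilbert)
  have one: "\<phi> 1 = 1" using pure by (simp add: pure_functional_def)
  note rep = gns_act_representation
  have pc: "gns_act a u \<in> hcarrier gns_space" if "u \<in> hcarrier gns_space" for a u
    using represents_gns_act that by (auto simp: gns_space_sel)
  have radj: "hinner gns_space (gns_act a u) w = hinner gns_space u (gns_act (adj a) w)"
    if "u \<in> hcarrier gns_space" "w \<in> hcarrier gns_space" for a u w
    using rep that by (simp add: star_representation_def)
  have rmult: "gns_act (a * b) u = gns_act a (gns_act b u)" for a b u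
    by (simp add: gns_act_def[abs_def] adj_mult mult.assoc)
  have hat_in: "hat x \<in> hcarrier gns_space" for x using represents_hat by (auto simp: gns_space_sel)
  define v where "v = hat 1"
  have v: "v \<in> hcarrier gns_space" by (simp add: v_def hat_in)
  have rv: "gns_act b v = hat b" for b by (simp add: v_def gns_act_hat_one)
  have eval: "hinner gns_space u (gns_act b v) = u b" if "u \<in> hcarrier gns_space" for u b
    using that inner_hat by (auto simp: gns_space_sel rv)
  have "K = {hzero gns_space} \<or> K = hcarrier gns_space"
    if K: "closed_hsubspace gns_space K" and inv: "\<forall>a. \<forall>x\<in>K. gns_act a x \<in> K" for K
  proof -
    have KH: "x \<in> hcarrier gns_space" if "x \<in> K" for x using K that by (auto simp: closed_hsubspace_def)
    obtain w where w: "w \<in> K" and orth: "\<And>k. k \<in> K \<Longrightarrow> hinner gns_space (gns_space.hsub v w) k = 0"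
      using gns_space.orthogonal_projection[OF K v] by blast
    define u where "u = gns_space.hsub v w"
    have wH: "w \<in> hcarrier gns_space" using KH w by blast
    have u: "u \<in> hcarrier gns_space" unfolding u_def using v wH by (intro gns_space.add_closed gns_space.scale_closed)
    have orth': "hinner gns_space k u = 0" if "k \<in> K" for k
      using gns_space.inner_commute[OF u KH[OF that]] orth[OF that] by (simp add: u_def)
    \<comment> \<open>This coefficient equals both the inner product of \<open>gns_act x w\<close>
      with \<open>v\<close> and that with \<open>w\<close>, because \<open>v - w\<close> is
      orthogonal to \<open>K\<close>. The second form gives positivity; the definition itself later
      turns \<open>\<psi> = \<mu> \<phi>\<close> into an equation for \<open>w\<close>.\<close>
    define \<psi> where "\<psi> x = w (adj x)" for x
    have \<psi>v: "\<psi> x = hinner gns_space (gns_act x w) v" for x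
      using eval[OF wH, of "adj x"] radj[OF wH v, of x] by (simp add: \<psi>_def)
    have \<psi>w: "\<psi> x = hinner gns_space (gns_act x w) w" for x
    proof -
      have k: "gns_act x w \<in> K" using inv w by blast
      have "hinner gns_space (gns_act x w) u = hinner gns_space (gns_act x w) v - hinner gns_space (gns_act x w) w"
        unfolding u_def using KH[OF k] v wH by (simp add: gns_space.inner_expand)
      then show ?thesis using orth'[OF k] by (simp add: \<psi>v)
    qed
    have \<psi>_square: "\<psi> (adj x * x) = hinner gns_space (gns_act x w) (gns_act x w)" for x
      using radj[OF pc[OF wH, of x] wH, of "adj x"] by (simp add: \<psi>w rmult adj_adj)
    obtain W where W: "represents W w" using wH by (auto simp: gns_space_sel)
    have \<psi>: "positive_functional \<psi>"
    proof
      show "\<psi> (x + y) = \<psi> x + \<psi> y" "\<psi> (c *\<^sub>C x) = c * \<psi> x" for x y c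
        by (simp_all add: \<psi>_def adj_add adj_scaleC represents_antilinear[OF W])
      show "\<psi> (adj x) = cnj (\<psi> x)" for x
        unfolding \<psi>w using radj[OF wH wH, of "adj x"] gns_space.inner_commute[OF pc[OF wH, of x] wH]
        by (simp add: adj_adj)
      show "0 \<le> Re (\<psi> (adj x * x))" for x
        unfolding \<psi>_square by (intro gns_space.inner_nonneg pc wH)
    qed
    have le: "Re (\<psi> (adj x * x)) \<le> Re (\<phi> (adj x * x))" for x
    proof -
      let ?a = "gns_act x w" and ?b = "gns_act x u"
      have ab: "?a \<in> hcarrier gns_space" "?b \<in> hcarrier gns_space" using pc wH u by blast+
      have "gns_act x v = hadd gns_space ?a ?b"
      proof -
        obtain V where "represents V v" using v by (auto simp: gns_space_sel)
        then show ?thesis by (simp add: u_def gns_act_def[abs_def] gns_space_sel)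
      qed
      moreover have "hinner gns_space ?a ?b = 0"
      proof -
        have "hinner gns_space ?a ?b = hinner gns_space (gns_act (adj x) ?a) u"
          using radj[OF ab(1) u, of "adj x"] by (simp add: adj_adj)
        moreover have "gns_act (adj x) ?a \<in> K" using inv w by blast
        ultimately show ?thesis using orth' by metis
      qed
      moreover from this have "hinner gns_space ?b ?a = 0" using gns_space.inner_commute[OF ab] by simp
      ultimately have "hinner gns_space (gns_act x v) (gns_act x v) = hinner gns_space ?a ?a + hinner gns_space ?b ?b"
        using ab by (simp add: gns_space.inner_expand)
      moreover have "hinner gns_space (gns_act x v) (gns_act x v) = \<phi> (adj x * x)"
        using eval[OF pc[OF v, of x], of x] by (simp only: rv) (simp add: hat_def)
      ultimately show ?thesis using \<psi>_square[of x] gns_space.inner_nonneg[OF ab(2)] by simp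
    qed
    obtain \<mu> where \<mu>: "\<And>x. \<psi> x = \<mu> * \<phi> x" using pure \<psi> le unfolding pure_functional_def by blast
    have w_eq: "w = hscale gns_space \<mu> v"
    proof
      fix b show "w b = hscale gns_space \<mu> v b"
        using \<mu>[of "adj b"] by (simp add: \<psi>_def adj_adj gns_space_sel v_def hat_def)
    qed
    show ?thesis
    proof (cases "\<mu> = 0")
      case True
      then have "u = v" unfolding u_def by (simp add: w_eq gns_space_sel)
      have "k = hzero gns_space" if k: "k \<in> K" for k
      proof
        fix b
        have "k b = hinner gns_space (gns_act (adj b) k) v"
          using eval[OF KH[OF k], of b] radj[OF KH[OF k] v, of "adj b"] by (simp add: adj_adj)
        also have "gns_act (adj b) k \<in> K" using inv k by blast
        then have "hinner gns_space (gns_act (adj b) k) v = 0" using orth' \<open>u = v\<close> by metis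
        finally show "k b = hzero gns_space b" by (simp add: gns_space_sel)
      qed
      then show ?thesis using K by (auto simp: closed_hsubspace_def)
    next
      case False
      have "v = hscale gns_space (1 / \<mu>) w" using False by (simp add: w_eq gns_space_sel)
      then have "v \<in> K" using K w by (auto simp: closed_hsubspace_def)
      then have hatK: "hat b \<in> K" for b using inv rv by metis
      have "x \<in> K" if x: "x \<in> hcarrier gns_space" for x
      proof -
        obtain X where X: "represents X x" using x by (auto simp: gns_space_sel)
        show ?thesis
          by (rule closed_hsubspace_limit[OF K x _ hdist_hat_limit[OF X]]) (simp add: hatK)
      qed
      then show ?thesis using KH by blast
    qed
  qed
  moreover have "hcarrier gns_space \<noteq> {hzero gns_space}"
  proof
    assume "hcarrier gns_space = {hzero gns_space}"
    then have "v = hzero gns_space" using v by simp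
    then have "v 1 = 0" by (simp add: gns_space_sel)
    then show False using one by (simp add: v_def hat_def)
  qed
  ultimately show ?thesis using rep by (simp add: irreducible_representation_def)
qed

text \<open>The kernel of the representation of a pure state works: the state vanishes on
  \<open>L\<close>, which is two-sided, so \<open>L\<close> acts as zero, while \<open>b\<close>
  moves the cyclic vector to one with value \<open>\<phi> (adj b * b)\<close> at
  \<open>b\<close>.\<close>

theorem primitive_ideal_separates:
  fixes L :: "'a::unital_cstar_algebra set"
  assumes sep: "separable_space (euclidean :: 'a topology)"
    and L: "closed_ideal L" and b: "b \<notin> L"
  obtains P where "primitive_ideal P" "L \<subseteq> P" "b \<notin> P"
proof -
  obtain \<phi> where pure: "pure_functional \<phi>" and van: "\<And>l. l \<in> L \<Longrightarrow> \<phi> l = 0"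
    and nz: "\<phi> (adj b * b) \<noteq> 0"
    using pure_functional_exists[OF sep L b] by blast
  interpret positive_functional \<phi> using pure by (simp add: pure_functional_def)
  have "primitive_ideal (rep_kernel gns_space gns_act)"
    by (rule primitive_ideal_rep_kernel[OF gns_space_hilbert pure_functional_irreducible[OF pure]])
  moreover have "L \<subseteq> rep_kernel gns_space gns_act"
  proof
    fix l assume l: "l \<in> L"
    have "gns_act l u = hzero gns_space" if "represents X u" for X u
    proof
      fix c
      have "\<phi> (adj c * (l * X n)) = 0" for n
        using van closed_ideal_mult_left[OF L closed_ideal_mult_right[OF L l]] by blast
      moreover have "(\<lambda>n. \<phi> (adj c * (l * X n))) \<longlonglongrightarrow> gns_act l u c"
        using represents_gns_act[OF that, of l] by (simp add: represents_def)
      ultimately have "gns_act l u c = 0" using LIMSEQ_unique[OF tendsto_const] by fastforce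
      then show "gns_act l u c = hzero gns_space c" by (simp add: gns_space_sel)
    qed
    then show "l \<in> rep_kernel gns_space gns_act" by (auto simp: rep_kernel_def gns_space_sel)
  qed
  moreover have "b \<notin> rep_kernel gns_space gns_act"
  proof
    assume "b \<in> rep_kernel gns_space gns_act"
    then have "hat b = hzero gns_space"
      using represents_hat[of 1] gns_act_hat_one[of b] by (auto simp: rep_kernel_def gns_space_sel)
    then have "hat b b = 0" by (simp add: gns_space_sel)
    then show False using nz by (simp add: hat_def)
  qed
  ultimately show thesis by (rule that)
qed

lemma primitive_ideal_props:
  fixes P :: "'a::unital_cstar_algebra set"
  assumes "primitive_ideal P"
  shows "1 \<notin> P" and "\<And>a b. a \<in> P \<Longrightarrow> b \<in> P \<Longrightarrow> a + b \<in> P"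
    and "\<And>a b. a \<in> P \<Longrightarrow> a * b \<in> P"
proof -
  obtain H :: "('a \<Rightarrow> complex) hilbert" and \<pi> where hs: "complex_hilbert_space H"
    and irr: "irreducible_representation H \<pi>" and P: "P = rep_kernel H \<pi>"
    using assms by (auto simp: primitive_ideal_def)
  interpret complex_hilbert_space H by (rule hs)
  have rep: "star_representation H \<pi>" and ne: "hcarrier H \<noteq> {hzero H}"
    using irr by (auto simp: irreducible_representation_def)
  have pc: "\<pi> a x \<in> hcarrier H" if "x \<in> hcarrier H" for a x
    using rep that by (auto simp: star_representation_def bounded_operator_def)
  show "1 \<notin> P"
  proof
    assume "1 \<in> P"
    then have "x = hzero H" if "x \<in> hcarrier H" for x
      using rep that by (simp add: P rep_kernel_def star_representation_def)
    then show False using ne zero_closed by blast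
  qed
  show "a + b \<in> P" if "a \<in> P" "b \<in> P" for a b
    using that rep by (simp add: P rep_kernel_def star_representation_def add_zero zero_closed)
  show "a * b \<in> P" if "a \<in> P" for a b
    using that rep pc by (simp add: P rep_kernel_def star_representation_def)
qed

section \<open>Ideals generated by central elements\<close>

lemma centerD: "z \<in> center \<Longrightarrow> z * b = b * z"
  by (simp add: center_def)

lemma centerI: "(\<And>b. z * b = b * z) \<Longrightarrow> z \<in> center"
  by (simp add: center_def)

lemma center_one: "1 \<in> center" and center_zero: "0 \<in> center"
  by (simp_all add: center_def)

lemma center_add: "z \<in> center \<Longrightarrow> w \<in> center \<Longrightarrow> z + w \<in> center"
  by (intro centerI) (simp only: distrib_left distrib_right centerD)

lemma center_diff: "z \<in> center \<Longrightarrow> w \<in> center \<Longrightarrow> z - w \<in> center"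
  by (intro centerI) (simp only: left_diff_distrib right_diff_distrib centerD)

lemma center_mult:
  assumes "z \<in> center" "w \<in> center"
  shows "z * w \<in> center"
proof (rule centerI)
  fix b
  have "z * w * b = z * (b * w)" by (simp only: mult.assoc centerD[OF assms(2), of b])
  also have "\<dots> = b * (z * w)"
    by (simp only: mult.assoc[symmetric] centerD[OF assms(1), of b])
  finally show "z * w * b = b * (z * w)" .
qed

lemma center_scaleR: "z \<in> center \<Longrightarrow> r *\<^sub>R z \<in> center"
  using centerD[of z] by (intro centerI) simp

lemma center_adj:
  assumes "z \<in> center"
  shows "adj z \<in> center"
proof (rule centerI)
  fix b
  have "adj (adj b * z) = adj (z * adj b)" by (simp only: centerD[OF assms, of "adj b"])
  then show "adj z * b = b * adj z" by (simp only: adj_simps)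
qed

lemma center_sandwich:
  assumes "z \<in> center" "adj z = z"
  shows "adj (y * z) * (y * z) = adj y * y * (z * z)"
proof -
  have "adj (y * z) * (y * z) = z * (adj y * (y * z))" using assms by (simp add: adj_simps mult.assoc)
  then show ?thesis using centerD[OF assms(1), of "adj y * (y * z)"] by (simp add: mult.assoc)
qed

text \<open>For a \<open>central_cone\<close> the closure of this set is the closed ideal generated
  by \<open>W\<close>. Stating the bound for \<open>adj x * x\<close> makes membership a matter of
  the order alone.\<close>

definition dominated :: "'a::unital_cstar_algebra set \<Rightarrow> 'a set" where
  "dominated W = {x. \<exists>w\<in>W. \<exists>M\<ge>0. pos (M *\<^sub>R w - adj x * x)}"

definition central_cone :: "'a::unital_cstar_algebra set \<Rightarrow> bool" where
  "central_cone W \<longleftrightarrow> 0 \<in> W \<and> (\<forall>w\<in>W. w \<in> center \<and> pos w) \<and> (\<forall>v\<in>W. \<forall>w\<in>W. v + w \<in> W)"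

lemma dominatedI: "w \<in> W \<Longrightarrow> 0 \<le> M \<Longrightarrow> pos (M *\<^sub>R w - adj x * x) \<Longrightarrow> x \<in> dominated W"
  by (auto simp: dominated_def)

lemma dominated_self: "adj x * x \<in> W \<Longrightarrow> x \<in> dominated W"
  by (rule dominatedI[of "adj x * x" _ 1]) simp_all

lemma dominated_mult_left:
  assumes "x \<in> dominated W"
  shows "b * x \<in> dominated W"
proof -
  obtain w M where w: "w \<in> W" "0 \<le> M" "pos (M *\<^sub>R w - adj x * x)"
    using assms by (auto simp: dominated_def)
  have "pos (((norm b)\<^sup>2 * M) *\<^sub>R w - (norm b)\<^sup>2 *\<^sub>R (adj x * x))"
    using pos_scaleR[OF w(3), of "(norm b)\<^sup>2"] by (simp add: scaleR_diff_right)
  then have "pos (((norm b)\<^sup>2 * M) *\<^sub>R w - adj (b * x) * (b * x))"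
    using pos_adj_mult_le[of b x] pos_trans by blast
  then show ?thesis using w by (intro dominatedI[of w]) auto
qed

context
  fixes W :: "'a::unital_cstar_algebra set"
  assumes W: "central_cone W"
begin

text \<open>Conjugation by \<open>b\<close> turns the bound \<open>M * w\<close> into
  \<open>M * (adj b * w * b)\<close>. Centrality moves \<open>w\<close> out, and
  \<open>adj b * b\<close> is at most \<open>norm b ^ 2\<close>.\<close>

lemma dominated_mult_right:
  assumes "x \<in> dominated W"
  shows "x * b \<in> dominated W"
proof -
  obtain w M where w: "w \<in> W" "0 \<le> M" "pos (M *\<^sub>R w - adj x * x)"
    using assms by (auto simp: dominated_def)
  have wc: "w \<in> center" "pos w" using W w(1) by (auto simp: central_cone_def)
  have "pos (adj b * (M *\<^sub>R w - adj x * x) * b)" by (rule pos_conjugate[OF w(3)])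
  also have "adj b * (M *\<^sub>R w - adj x * x) * b = M *\<^sub>R (w * (adj b * b)) - adj (x * b) * (x * b)"
    using centerD[OF wc(1), of "adj b"]
    by (simp add: adj_simps left_diff_distrib right_diff_distrib mult.assoc[symmetric])
  finally have "pos (M *\<^sub>R (w * (adj b * b)) - adj (x * b) * (x * b))" .
  moreover have "pos (M *\<^sub>R (w * ((norm b)\<^sup>2 *\<^sub>R 1 - adj b * b)))"
    by (intro pos_scaleR pos_mult wc pos_norm_sq_diff centerD w)
  then have "pos ((M * (norm b)\<^sup>2) *\<^sub>R w - M *\<^sub>R (w * (adj b * b)))"
    by (simp add: right_diff_distrib scaleR_diff_right)
  ultimately have "pos ((M * (norm b)\<^sup>2) *\<^sub>R w - adj (x * b) * (x * b))" by (rule pos_trans)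
  then show ?thesis using w by (intro dominatedI[of w]) auto
qed

lemma dominated_add:
  assumes "x \<in> dominated W" "y \<in> dominated W"
  shows "x + y \<in> dominated W"
proof -
  obtain v M where v: "v \<in> W" "0 \<le> M" "pos (M *\<^sub>R v - adj x * x)"
    using assms by (auto simp: dominated_def)
  obtain w N where w: "w \<in> W" "0 \<le> N" "pos (N *\<^sub>R w - adj y * y)"
    using assms by (auto simp: dominated_def)
  have vw: "pos v" "pos w" "v + w \<in> W" using W v w by (auto simp: central_cone_def)
  \<comment> \<open>The parallelogram identity: the square of \<open>x + y\<close> is twice the sum
    of the two squares minus the square of \<open>x - y\<close>.\<close>
  have "pos (2 *\<^sub>R ((M *\<^sub>R v - adj x * x) + (N *\<^sub>R w - adj y * y) + M *\<^sub>R w + N *\<^sub>R v)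
      + adj (x - y) * (x - y))"
    using v w vw by (intro pos_add pos_scaleR pos_adj_mult_self) auto
  also have "2 *\<^sub>R ((M *\<^sub>R v - adj x * x) + (N *\<^sub>R w - adj y * y) + M *\<^sub>R w + N *\<^sub>R v)
      + adj (x - y) * (x - y) = (2 * (M + N)) *\<^sub>R (v + w) - adj (x + y) * (x + y)"
    by (simp add: adj_simps algebra_simps scaleR_2)
  finally show ?thesis using v w vw by (intro dominatedI[of "v + w"]) auto
qed

lemma closed_ideal_dominated: "closed_ideal (closure (dominated W))"
proof -
  have 0: "0 \<in> dominated W"
    using W by (intro dominatedI[of 0 _ 0]) (auto simp: central_cone_def)
  have add: "x + y \<in> closure (dominated W)" if x: "x \<in> closure (dominated W)" and y: "y \<in> closure (dominated W)" for x y
  proof -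
    obtain X where "\<forall>n. X n \<in> dominated W" "X \<longlonglongrightarrow> x"
      using x unfolding closure_sequential by blast
    moreover obtain Y where "\<forall>n. Y n \<in> dominated W" "Y \<longlonglongrightarrow> y"
      using y unfolding closure_sequential by blast
    ultimately show ?thesis
      unfolding closure_sequential
      by (intro exI[of _ "\<lambda>n. X n + Y n"]) (simp add: dominated_add tendsto_add)
  qed
  have mult: "b * x \<in> closure (dominated W)" "x * b \<in> closure (dominated W)"
    if x: "x \<in> closure (dominated W)" for b x
  proof -
    obtain X where X: "\<forall>n. X n \<in> dominated W" "X \<longlonglongrightarrow> x"
      using x unfolding closure_sequential by blast
    then show "b * x \<in> closure (dominated W)"
      unfolding closure_sequential
      by (intro exI[of _ "\<lambda>n. b * X n"]) (simp add: dominated_mult_left tendsto_mult_left)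
    from X show "x * b \<in> closure (dominated W)"
      unfolding closure_sequential
      by (intro exI[of _ "\<lambda>n. X n * b"]) (simp add: dominated_mult_right tendsto_mult_right)
  qed
  have scale: "c *\<^sub>C x \<in> closure (dominated W)" if "x \<in> closure (dominated W)" for c x
    using mult(1)[OF that, of "c *\<^sub>C 1"] by (simp add: mult_scaleC_left)
  have "0 \<in> closure (dominated W)" using 0 closure_subset[of "dominated W"] by blast
  then show ?thesis
    unfolding closed_ideal_def complex_subspace_def using add mult scale by simp
qed

text \<open>One weight \<open>w\<close> dominates approximations of all elements of
  \<open>F\<close>, and \<open>g\<close> is \<open>\<delta>\<close> times the inverse of
  \<open>w + \<delta>\<close>: close to 1 where \<open>w\<close> is small against
  \<open>\<delta>\<close> and close to 0 where it is large. The factorisation of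
  \<open>1 - g\<close> through \<open>w\<close> puts it into any ideal that contains
  \<open>w\<close>.\<close>

lemma central_approximate_unit:
  assumes F: "finite F" "F \<subseteq> closure (dominated W)" and e: "e > 0"
  obtains g w c where "g \<in> center" "pos g" "norm g \<le> 1" "w \<in> W" "1 - g = w * c"
    "\<forall>x\<in>F. norm (x * g) < e"
proof -
  have "\<exists>w\<in>W. \<exists>M\<ge>0. \<forall>x\<in>F. \<exists>y. dist y x < e/2 \<and> pos (M *\<^sub>R w - adj y * y)"
    using F
  proof (induction F rule: finite_induct)
    case empty
    then show ?case using W by (auto simp: central_cone_def)
  next
    case (insert x F)
    then obtain v M where v: "v \<in> W" "0 \<le> M"
      and F: "\<forall>x\<in>F. \<exists>y. dist y x < e/2 \<and> pos (M *\<^sub>R v - adj y * y)" by auto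
    obtain y where y: "y \<in> dominated W" "dist y x < e/2"
      using insert.prems e closure_approachable[of x "dominated W"] by (metis half_gt_zero insert_subset)
    obtain w N where w: "w \<in> W" "0 \<le> N" "pos (N *\<^sub>R w - adj y * y)"
      using y(1) by (auto simp: dominated_def)
    have vw: "pos v" "pos w" "v + w \<in> W" using W v w by (auto simp: central_cone_def)
    have 1: "pos ((M + N) *\<^sub>R (v + w) - adj z * z)" if "pos (M *\<^sub>R v - adj z * z)" for z
    proof -
      have "pos ((M *\<^sub>R v - adj z * z) + M *\<^sub>R w + N *\<^sub>R v + N *\<^sub>R w)"
        using that v w vw by (intro pos_add pos_scaleR) auto
      then show ?thesis by (simp add: algebra_simps)
    qed
    have 2: "pos ((M + N) *\<^sub>R (v + w) - adj y * y)"
    proof -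
      have "pos ((N *\<^sub>R w - adj y * y) + M *\<^sub>R w + N *\<^sub>R v + M *\<^sub>R v)"
        using v w vw by (intro pos_add pos_scaleR) auto
      then show ?thesis by (simp add: algebra_simps)
    qed
    have "\<forall>z\<in>insert x F. \<exists>y. dist y z < e/2 \<and> pos ((M + N) *\<^sub>R (v + w) - adj y * y)"
      using F 1 2 y(2) by blast
    then show ?case using vw(3) v(2) w(2) by (intro bexI[of _ "v + w"] exI[of _ "M + N"]) auto
  qed
  then obtain w M where w: "w \<in> W" and M: "M \<ge> 0"
    and app: "\<forall>x\<in>F. \<exists>y. dist y x < e/2 \<and> pos (M *\<^sub>R w - adj y * y)" by blast
  have wc: "w \<in> center" "pos w" using W w by (auto simp: central_cone_def)
  \<comment> \<open>The estimate below bounds \<open>norm (y * g) ^ 2\<close> by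
    \<open>M * \<delta>\<close>; dividing by \<open>M + 1\<close> covers
    \<open>M = 0\<close>.\<close>
  define \<delta> where "\<delta> = (e/2)\<^sup>2 / (M + 1)"
  have \<delta>: "\<delta> > 0" "M * \<delta> \<le> (e/2)\<^sup>2" using e M by (simp_all add: \<delta>_def field_simps)
  obtain r where r: "(w + \<delta> *\<^sub>R 1) * r = 1" "pos r" "pos (1 - \<delta> *\<^sub>R r)"
    and comm: "\<forall>x. x * w = w * x \<longrightarrow> x * r = r * x"
    using pos_shift_inverse[OF wc(2) \<delta>(1)] by metis
  define g where "g = \<delta> *\<^sub>R r"
  have gc: "g \<in> center"
  proof (rule centerI)
    fix b show "g * b = b * g" using comm[rule_format, of b] centerD[OF wc(1), of b] by (simp add: g_def)
  qed
  have g: "pos g" "pos (1 - g)" using r(2,3) \<delta>(1) by (auto simp: g_def intro: pos_scaleR)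
  have ga: "adj g = g" using g(1) by (rule pos_adj)
  have g1: "norm g \<le> 1" using pos_norm_le[OF g(1), of 1] g(2) by simp
  have wr: "1 - g = w * r" using r(1) by (simp add: g_def distrib_right diff_eq_eq)
  have small: "norm (y * g) \<le> e/2" if y: "pos (M *\<^sub>R w - adj y * y)" for y
  proof -
    have "pos (adj g * (M *\<^sub>R w - adj y * y) * g)" by (rule pos_conjugate[OF y])
    also have "adj g * (M *\<^sub>R w - adj y * y) * g = M *\<^sub>R (g * (w * g)) - adj (y * g) * (y * g)"
      by (simp add: adj_simps ga left_diff_distrib right_diff_distrib mult.assoc)
    \<comment> \<open>This identity replaces \<open>g * w * g\<close> by
      \<open>\<delta> * (g - g * g)\<close>, which is at most \<open>\<delta>\<close>.\<close>
    also have "w * g = \<delta> *\<^sub>R (1 - g)" by (simp only: wr) (simp add: g_def)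
    finally have 1: "pos ((M * \<delta>) *\<^sub>R (g - g * g) - adj (y * g) * (y * g))"
      by (simp add: right_diff_distrib)
    have "pos ((M * \<delta>) *\<^sub>R ((1 - g) + g * g))"
      using M \<delta> g ga by (intro pos_scaleR pos_add pos_square) auto
    then have 2: "pos ((M * \<delta>) *\<^sub>R 1 - (M * \<delta>) *\<^sub>R (g - g * g))"
      by (simp add: scaleR_diff_right scaleR_add_right algebra_simps)
    from 1 2 have "pos ((M * \<delta>) *\<^sub>R 1 - adj (y * g) * (y * g))" by (rule pos_trans)
    then have "(norm (y * g))\<^sup>2 \<le> M * \<delta>"
      using pos_norm_le[OF pos_adj_mult_self, of "M * \<delta>" "y * g"] M \<delta> by (simp add: cstar_identity)
    then have "(norm (y * g))\<^sup>2 \<le> (e/2)\<^sup>2" using \<delta>(2) by simp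
    then show ?thesis by (rule power2_le_imp_le) (use e in simp)
  qed
  have "norm (x * g) < e" if x: "x \<in> F" for x
  proof -
    obtain y where y: "dist y x < e/2" "pos (M *\<^sub>R w - adj y * y)" using app x by blast
    have "norm ((x - y) * g) \<le> norm (x - y) * norm g" by (rule norm_mult_ineq)
    also have "\<dots> \<le> norm (x - y) * 1" using g1 by (intro mult_left_mono) auto
    also have "\<dots> < e/2" using y(1) by (simp add: dist_norm norm_minus_commute)
    finally have "norm ((x - y) * g) < e/2" .
    moreover have "x * g = (x - y) * g + y * g" by (simp add: left_diff_distrib)
    ultimately show ?thesis
      using small[OF y(2)] norm_triangle_ineq[of "(x - y) * g" "y * g"] by simp
  qed
  then show thesis using that[OF gc g(1) g1 w wr] by blast
qed

end

abbreviation central_part :: "'a::unital_cstar_algebra set \<Rightarrow> 'a set" where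
  "central_part J \<equiv> {w \<in> center \<inter> J. pos w}"

lemma central_cone_central_part: "closed_ideal J \<Longrightarrow> central_cone (central_part J)"
  by (auto simp: central_cone_def closed_ideal_zero center_zero closed_ideal_add center_add pos_add)

lemma closed_ideal_le_central:
  fixes J :: "'a::unital_cstar_algebra set"
  assumes sep: "separable_space (euclidean :: 'a topology)" and J: "closed_ideal J"
    and prim: "\<And>P. primitive_ideal P \<Longrightarrow> J \<subseteq> P \<or> (\<exists>x\<in>center \<inter> J. 1 - x \<in> P)"
  shows "J \<subseteq> closure (dominated (central_part J))"
proof
  fix b assume b: "b \<in> J"
  show "b \<in> closure (dominated (central_part J))"
  proof (rule ccontr)
    assume nb: "b \<notin> closure (dominated (central_part J))"
    obtain P where P: "primitive_ideal P" "closure (dominated (central_part J)) \<subseteq> P" "b \<notin> P"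
      by (rule primitive_ideal_separates[OF sep closed_ideal_dominated[OF central_cone_central_part[OF J]] nb])
    then obtain x where x: "x \<in> center" "x \<in> J" "1 - x \<in> P" using prim[OF P(1)] b by blast
    \<comment> \<open>The comaximality element \<open>x\<close> need not be positive;
      \<open>adj x * x\<close> is a positive central element of \<open>J\<close> that dominates
      it.\<close>
    have "adj x * x \<in> central_part J"
      using x closed_ideal_mult_left[OF J] by (simp add: center_mult center_adj pos_adj_mult_self)
    then have "x \<in> dominated (central_part J)" by (rule dominated_self)
    then have "x \<in> P" using closure_subset[of "dominated (central_part J)"] P(2) by blast
    then have "(1 - x) + x \<in> P" using primitive_ideal_props(2)[OF P(1)] x(3) by blast
    then have "1 \<in> P" by simp
    then show False using primitive_ideal_props(1)[OF P(1)] by blast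
  qed
qed

section \<open>Passing to the quotients\<close>

lemma anorm_coset_nonneg:
  assumes "closed_ideal J"
  shows "0 \<le> anorm (quotient_alg J) (coset J x)"
proof -
  have "coset J x \<noteq> {}" using closed_ideal_zero[OF assms] by (auto simp: coset_def)
  then show ?thesis by (auto simp: quotient_alg_def intro: cINF_greatest)
qed

lemma anorm_coset_le:
  assumes "y - x \<in> J"
  shows "anorm (quotient_alg J) (coset J x) \<le> norm y"
proof -
  have "y = x + (y - x)" by simp
  then have "y \<in> coset J x" using assms unfolding coset_def by blast
  then show ?thesis
    by (auto simp: quotient_alg_def intro!: cINF_lower bdd_belowI2[where m=0])
qed

lemma anorm_coset_less:
  assumes "closed_ideal J" "anorm (quotient_alg J) (coset J x) < t"
  obtains j where "j \<in> J" "norm (x + j) < t"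
proof -
  have "coset J x \<noteq> {}" using closed_ideal_zero[OF assms(1)] by (auto simp: coset_def)
  moreover have "bdd_below (norm ` coset J x)" by (rule bdd_belowI2[where m=0]) simp
  ultimately have "\<exists>y\<in>coset J x. norm y < t"
    using assms(2) cINF_less_iff[of "coset J x" norm t] by (simp add: quotient_alg_def)
  then show thesis using that by (auto simp: coset_def)
qed

lemma coset_add:
  assumes "closed_ideal J" "j \<in> J"
  shows "coset J (x + j) = coset J x"
proof -
  have "\<exists>k. x + j + i = x + k \<and> k \<in> J" if "i \<in> J" for i
    using closed_ideal_add[OF assms that] by (intro exI[of _ "j + i"]) (simp add: add.assoc)
  moreover have "\<exists>k. x + i = x + j + k \<and> k \<in> J" if "i \<in> J" for i
    using closed_ideal_diff[OF assms(1) that assms(2)] by (intro exI[of _ "i - j"]) simp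
  ultimately show ?thesis unfolding coset_def by blast
qed

lemma asymp_commutes_whole:
  "asymp_commutes whole D le N S \<longleftrightarrow> net_limit D le (\<lambda>l. norm (S * N l - N l * S)) 0"
  by (simp add: asymp_commutes_def whole_def)

text \<open>A net in the quotient is lifted with a bound, and each lift \<open>b l\<close> is
  multiplied by a central \<open>g\<close> with \<open>1 - g \<in> J\<close>. The class modulo
  \<open>J\<close> stays the same, while the commutators with finitely many \<open>S\<close> shrink
  to nearly their quotient norms.\<close>

lemma appr_double_commutant_quotient:
  fixes J A :: "'a::unital_cstar_algebra set"
  assumes J: "closed_ideal J" and cJ: "J \<subseteq> closure (dominated (central_part J))"
    and T: "T \<in> appr_double_commutant whole A"
  shows "coset J T \<in> appr_double_commutant (quotient_alg J) (coset J ` A)"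
proof -
  define Q where "Q = quotient_alg J"
  have "asymp_commutes Q D le N (coset J T)"
    if bn: "bounded_net Q D le N" and ac: "\<forall>S\<in>coset J ` A. asymp_commutes Q D le N S"
    for D :: "('a set set \<times> 'a set) set" and le N
  proof -
    obtain M where M: "\<forall>l\<in>D. N l \<in> acarrier Q \<and> anorm Q (N l) \<le> M" and dir: "directed D le"
      using bn by (auto simp: bounded_net_def)
    have "\<exists>b. N l = coset J b \<and> norm b \<le> M + 1" if "l \<in> D" for l
    proof -
      obtain x where x: "N l = coset J x" using M \<open>l \<in> D\<close> by (auto simp: Q_def quotient_alg_def)
      then have "anorm Q (coset J x) < M + 1" using M \<open>l \<in> D\<close> by fastforce
      then obtain j where "j \<in> J" "norm (x + j) < M + 1" using anorm_coset_less[OF J] Q_def by metis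
      then show ?thesis using x coset_add[OF J] by (intro exI[of _ "x + j"]) auto
    qed
    then obtain b where b: "\<And>l. l \<in> D \<Longrightarrow> N l = coset J (b l)" "\<And>l. l \<in> D \<Longrightarrow> norm (b l) \<le> M + 1"
      by metis
    define \<kappa> where "\<kappa> S l = anorm Q (coset J (S * b l - b l * S))" for S l
    have acQ: "asymp_commutes Q D le N (coset J S) \<longleftrightarrow> net_limit D le (\<kappa> S) 0" for S
      unfolding asymp_commutes_def net_limit_def \<kappa>_def Q_def
      by (intro all_cong bex_cong ball_cong refl imp_cong)
        (simp_all add: b(1) coset_mult[OF J] coset_minus[OF J])
    \<comment> \<open>A factor \<open>g\<close> serves only finitely many \<open>S\<close> and only
      up to an error, so the index also carries a finite subset of \<open>A\<close> and a number
      \<open>n\<close> that fixes the error.\<close>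
    define D' where "D' = D \<times> {F. finite F \<and> F \<subseteq> A} \<times> (UNIV :: nat set)"
    define le' where "le' p q \<longleftrightarrow> le (fst p) (fst q) \<and> fst (snd p) \<subseteq> fst (snd q) \<and> snd (snd p) \<le> snd (snd q)"
      for p q :: "('a set set \<times> 'a set) \<times> 'a set \<times> nat"
    have "\<exists>c. norm c \<le> M + 1 \<and> c - b l \<in> J \<and>
        (\<forall>S\<in>F. norm (S * c - c * S) \<le> \<kappa> S l + 2 * inverse (real (Suc n)))"
      if l: "l \<in> D" and F: "finite F" for l F n
    proof -
      define e where "e = inverse (real (Suc n))"
      have e: "e > 0" by (simp add: e_def)
      \<comment> \<open>The correction \<open>j S\<close> brings the commutator close to its
        quotient norm. The factor \<open>g\<close> makes \<open>j S * g\<close> small; each of these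
        two effects costs one \<open>e\<close>, which explains the bound
        \<open>\<kappa> S l + 2 * e\<close>.\<close>
      have "\<exists>j\<in>J. norm ((S * b l - b l * S) + j) < \<kappa> S l + e" for S
        using anorm_coset_less[OF J, of "S * b l - b l * S" "\<kappa> S l + e"] e
        unfolding \<kappa>_def Q_def by fastforce
      then obtain j where j: "\<And>S. j S \<in> J" "\<And>S. norm ((S * b l - b l * S) + j S) < \<kappa> S l + e"
        by metis
      have jF: "finite (j ` F)" "j ` F \<subseteq> closure (dominated (central_part J))" using F j(1) cJ by auto
      obtain g w c where g: "g \<in> center" "pos g" "norm g \<le> 1" "w \<in> central_part J" "1 - g = w * c"
        "\<forall>x\<in>j ` F. norm (x * g) < e"
        by (rule central_approximate_unit[OF central_cone_central_part[OF J] jF e]) (rule that)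
      have "norm (b l * g) \<le> norm (b l) * norm g" by (rule norm_mult_ineq)
      also have "\<dots> \<le> norm (b l) * 1" using g(3) by (intro mult_left_mono) auto
      finally have 1: "norm (b l * g) \<le> M + 1" using b(2)[OF l] by simp
      have "1 - g \<in> J" using g(4,5) closed_ideal_mult_right[OF J] by auto
      then have "b l * (1 - g) \<in> J" by (rule closed_ideal_mult_left[OF J])
      then have "- (b l * (1 - g)) \<in> J" by (rule closed_ideal_uminus[OF J])
      then have 2: "b l * g - b l \<in> J" by (simp add: right_diff_distrib)
      have 3: "norm (S * (b l * g) - b l * g * S) \<le> \<kappa> S l + 2 * e" if S: "S \<in> F" for S
      proof -
        define x where "x = (S * b l - b l * S) + j S"
        have "S * (b l * g) - b l * g * S = (S * b l - b l * S) * g"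
          using centerD[OF g(1), of S] by (simp add: left_diff_distrib mult.assoc)
        also have "\<dots> = x * g - j S * g" by (simp add: x_def distrib_right)
        finally have "norm (S * (b l * g) - b l * g * S) \<le> norm (x * g) + norm (j S * g)"
          by (simp only: norm_triangle_ineq4)
        moreover have "norm (x * g) \<le> norm x * norm g" by (rule norm_mult_ineq)
        moreover have "norm x * norm g \<le> norm x * 1" using g(3) by (intro mult_left_mono) auto
        moreover have "norm (j S * g) < e" using g(6) S by blast
        ultimately show ?thesis using j(2)[of S] by (simp add: x_def)
      qed
      show ?thesis using 1 2 3 by (intro exI[of _ "b l * g"]) (simp add: e_def)
    qed
    then have "\<forall>p\<in>D'. \<exists>c. norm c \<le> M + 1 \<and> c - b (fst p) \<in> J \<and>
        (\<forall>S\<in>fst (snd p). norm (S * c - c * S) \<le> \<kappa> S (fst p) + 2 * inverse (real (Suc (snd (snd p)))))"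
      by (auto simp: D'_def)
    then obtain c where c: "\<And>p. p \<in> D' \<Longrightarrow> norm (c p) \<le> M + 1"
      "\<And>p. p \<in> D' \<Longrightarrow> c p - b (fst p) \<in> J"
      "\<And>p S. p \<in> D' \<Longrightarrow> S \<in> fst (snd p) \<Longrightarrow> norm (S * c p - c p * S)
         \<le> \<kappa> S (fst p) + 2 * inverse (real (Suc (snd (snd p))))"
      by metis
    have "directed D' le'"
      unfolding directed_def
    proof (intro conjI ballI)
      show "D' \<noteq> {}" using dir by (auto simp: D'_def directed_def)
      show "reflp_on D' le'" using dir by (auto simp: D'_def directed_def reflp_on_def le'_def)
      show "transp_on D' le'"
      proof (rule transp_onI)
        fix p q r assume "p \<in> D'" "q \<in> D'" "r \<in> D'" "le' p q" "le' q r"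
        moreover have "transp_on D le" using dir by (simp add: directed_def)
        ultimately have "le (fst p) (fst r)"
          using transp_onD[of D le "fst p" "fst q" "fst r"] unfolding D'_def le'_def by auto
        moreover note \<open>le' p q\<close> \<open>le' q r\<close>
        ultimately show "le' p r" unfolding le'_def by auto
      qed
      fix p q assume p: "p \<in> D'" and q: "q \<in> D'"
      then have "fst p \<in> D" "fst q \<in> D" by (auto simp: D'_def)
      then obtain l where "l \<in> D" "le (fst p) l" "le (fst q) l"
        using dir unfolding directed_def by blast
      then show "\<exists>r\<in>D'. le' p r \<and> le' q r"
        using p q
        by (intro bexI[of _ "(l, fst (snd p) \<union> fst (snd q), max (snd (snd p)) (snd (snd q)))"])
          (auto simp: le'_def D'_def)
    qed
    then have bn': "bounded_net whole D' le' c"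
      using c(1) unfolding bounded_net_def whole_def by (intro conjI exI[of _ "M + 1"]) auto
    have "asymp_commutes whole D' le' c S" if S: "S \<in> A" for S
      unfolding asymp_commutes_whole net_limit_def
    proof (intro allI impI)
      fix e :: real assume e: "e > 0"
      have "net_limit D le (\<kappa> S) 0" using ac S acQ by blast
      then obtain l0 where l0: "l0 \<in> D" "\<forall>l\<in>D. le l0 l \<longrightarrow> \<bar>\<kappa> S l - 0\<bar> < e/2"
        using e unfolding net_limit_def by (meson half_gt_zero)
      obtain n0 where n0: "inverse (real (Suc n0)) < e/4" using reals_Archimedean[of "e/4"] e by auto
      have "\<bar>norm (S * c p - c p * S) - 0\<bar> < e" if p: "p \<in> D'" "le' (l0, {S}, n0) p" for p
      proof -
        have Sp: "S \<in> fst (snd p)" and np: "n0 \<le> snd (snd p)" and lp: "fst p \<in> D" "le l0 (fst p)"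
          using p by (auto simp: le'_def D'_def)
        have "inverse (real (Suc (snd (snd p)))) \<le> inverse (real (Suc n0))"
          using np by (intro le_imp_inverse_le) auto
        moreover have "\<kappa> S (fst p) < e/2" using l0(2) lp by fastforce
        ultimately have "norm (S * c p - c p * S) < e" using c(3)[OF p(1) Sp] n0 by linarith
        then show ?thesis by simp
      qed
      moreover have "(l0, {S}, n0) \<in> D'" using l0 S by (auto simp: D'_def)
      ultimately show "\<exists>p\<in>D'. \<forall>q\<in>D'. le' p q \<longrightarrow> \<bar>norm (S * c q - c q * S) - 0\<bar> < e" by blast
    qed
    then have "asymp_commutes whole D' le' c T"
      using appr_double_commutant_any_net[OF T bn'] by blast
    then have T': "net_limit D' le' (\<lambda>p. norm (T * c p - c p * T)) 0"
      by (simp only: asymp_commutes_whole)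
    have "net_limit D le (\<kappa> T) 0"
      unfolding net_limit_def
    proof (intro allI impI)
      fix e :: real assume "e > 0"
      then obtain p where p: "p \<in> D'" "\<forall>q\<in>D'. le' p q \<longrightarrow> \<bar>norm (T * c q - c q * T) - 0\<bar> < e"
        using T' unfolding net_limit_def by blast
      have "\<bar>\<kappa> T l - 0\<bar> < e" if l: "l \<in> D" "le (fst p) l" for l
      proof -
        \<comment> \<open>To return to \<open>D\<close>, the finite set and the number are frozen at
          those of \<open>p\<close> and only the first component moves. The lift differs from
          \<open>b l\<close> by an element of \<open>J\<close>, so its commutator with
          \<open>T\<close> bounds the quotient norm.\<close>
        define q where "q = (l, snd p)"
        have q: "q \<in> D'" "le' p q" "fst q = l" using p(1) l by (auto simp: q_def D'_def le'_def)
        have "T * (c q - b l) - (c q - b l) * T \<in> J"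
          using c(2)[OF q(1)] q(3) J
          by (simp add: closed_ideal_diff closed_ideal_mult_left closed_ideal_mult_right)
        then have "(T * c q - c q * T) - (T * b l - b l * T) \<in> J"
          by (simp add: algebra_simps)
        then have "\<kappa> T l \<le> norm (T * c q - c q * T)"
          unfolding \<kappa>_def Q_def by (rule anorm_coset_le)
        moreover have "0 \<le> \<kappa> T l" unfolding \<kappa>_def Q_def by (rule anorm_coset_nonneg[OF J])
        ultimately show ?thesis using p(2) q by fastforce
      qed
      moreover have "fst p \<in> D" using p(1) by (auto simp: D'_def)
      ultimately show "\<exists>l0\<in>D. \<forall>l\<in>D. le l0 l \<longrightarrow> \<bar>\<kappa> T l - 0\<bar> < e" by blast
    qed
    then show ?thesis by (simp only: acQ)
  qed
  then show ?thesis by (auto simp: appr_double_commutant_def Q_def quotient_alg_def)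
qed

section \<open>Gluing over the center\<close>

text \<open>
  A central \<open>w \<ge> 0\<close> is a weight if, for a combination \<open>d = \<Sum> a\<^sub>k w\<^sub>k\<close> with \<open>w = \<Sum> w\<^sub>k\<close>, the sum
  \<open>\<Sum> (T - a\<^sub>k)\<^sup>* (T - a\<^sub>k) w\<^sub>k\<close> is at most \<open>\<epsilon>\<^sup>2 w\<close>. Only \<open>d\<close> and \<open>q = \<Sum> a\<^sub>k\<^sup>* a\<^sub>k w\<^sub>k\<close> enter
  this bound; the condition on \<open>q\<close> says that \<open>\<Sum> (a\<^sub>k - X)\<^sup>* (a\<^sub>k - X) w\<^sub>k \<ge> 0\<close> for all \<open>X\<close>.
\<close>

definition weights :: "'a::unital_cstar_algebra set \<Rightarrow> 'a \<Rightarrow> real \<Rightarrow> 'a set" where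
  "weights A T \<epsilon> = {w \<in> center. pos w \<and> (\<exists>d\<in>A. \<exists>q.
     (\<forall>X. pos (q - adj d * X - adj X * d + adj X * X * w)) \<and>
     pos (\<epsilon>\<^sup>2 *\<^sub>R w - (adj T * T * w - adj T * d - adj d * T + q)))}"

text \<open>Both conditions are linear in \<open>w\<close>, \<open>d\<close> and \<open>q\<close>
  jointly, so witnesses for two weights add up to witnesses for their sum, with the same
  \<open>\<epsilon>\<close>.\<close>

lemma central_cone_weights:
  assumes A: "unital_subalgebra A"
  shows "central_cone (weights A T \<epsilon>)"
proof -
  have A0: "0 \<in> A" and Aa: "\<And>x y. x \<in> A \<Longrightarrow> y \<in> A \<Longrightarrow> x + y \<in> A"
    using A by (auto simp: unital_subalgebra_def complex_subspace_def)
  have "0 \<in> weights A T \<epsilon>"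
    unfolding weights_def using A0 by (auto simp: center_zero intro!: bexI[of _ 0] exI[of _ 0])
  moreover have "v + w \<in> weights A T \<epsilon>" if v: "v \<in> weights A T \<epsilon>" and w: "w \<in> weights A T \<epsilon>" for v w
  proof -
    obtain d q where d: "v \<in> center" "pos v" "d \<in> A"
      "\<forall>X. pos (q - adj d * X - adj X * d + adj X * X * v)"
      "pos (\<epsilon>\<^sup>2 *\<^sub>R v - (adj T * T * v - adj T * d - adj d * T + q))"
      using v by (auto simp: weights_def)
    obtain d' q' where d': "w \<in> center" "pos w" "d' \<in> A"
      "\<forall>X. pos (q' - adj d' * X - adj X * d' + adj X * X * w)"
      "pos (\<epsilon>\<^sup>2 *\<^sub>R w - (adj T * T * w - adj T * d' - adj d' * T + q'))"
      using w by (auto simp: weights_def)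
    have "pos ((q + q') - adj (d + d') * X - adj X * (d + d') + adj X * X * (v + w))" for X
      using pos_add[OF d(4)[rule_format, of X] d'(4)[rule_format, of X]]
      by (simp add: adj_simps algebra_simps)
    moreover have "pos (\<epsilon>\<^sup>2 *\<^sub>R (v + w) -
        (adj T * T * (v + w) - adj T * (d + d') - adj (d + d') * T + (q + q')))"
      using pos_add[OF d(5) d'(5)] by (simp add: adj_simps algebra_simps)
    ultimately show ?thesis
      using d(1-3) d'(1-3) unfolding weights_def
      by (auto simp: center_add pos_add Aa intro!: bexI[of _ "d + d'"] exI[of _ "q + q'"])
  qed
  ultimately show ?thesis by (auto simp: central_cone_def weights_def)
qed

text \<open>The combination with one term: \<open>d = a * w\<close> and
  \<open>q = adj a * a * w\<close> turn the two conditions into statements about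
  \<open>a - X\<close> and \<open>T - a\<close>. Since \<open>u\<close> is central and selfadjoint,
  the first is the positivity of the square of \<open>(a - X) * u\<close>.\<close>

lemma square_in_weights:
  assumes A: "unital_subalgebra A" "center \<subseteq> A" "a \<in> A"
    and u: "u \<in> center" "adj u = u"
    and le: "pos (\<epsilon>\<^sup>2 *\<^sub>R (u * u) - adj (T - a) * (T - a) * (u * u))"
  shows "u * u \<in> weights A T \<epsilon>"
proof -
  define w where "w = u * u"
  define d where "d = a * w"
  have w: "w \<in> center" "pos w" "adj w = w"
    using u by (simp_all add: w_def center_mult pos_square adj_simps)
  have d: "d \<in> A" using A w(1) by (auto simp: d_def unital_subalgebra_def)
  have ad: "adj d * X = adj a * (X * w)" for X
    using centerD[OF w(1), of "adj a * X"] by (simp add: d_def adj_simps w(3) mult.assoc)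
  have expand: "adj a * a * w - adj d * X - adj X * d + adj X * X * w = adj (a - X) * (a - X) * w" for X
    unfolding ad by (simp add: d_def adj_simps algebra_simps)
  have "pos (adj (a - X) * (a - X) * w)" for X
    using pos_adj_mult_self[of "(a - X) * u"] unfolding center_sandwich[OF u] w_def .
  then have "\<forall>X. pos (adj a * a * w - adj d * X - adj X * d + adj X * X * w)"
    unfolding expand by blast
  moreover have "adj T * T * w - adj T * d - adj d * T + adj a * a * w = adj (T - a) * (T - a) * w"
    unfolding ad by (simp add: d_def adj_simps algebra_simps)
  ultimately show ?thesis
    using w d le unfolding weights_def w_def[symmetric]
    by (auto intro!: bexI[of _ d] exI[of _ "adj a * a * w"])
qed

text \<open>For \<open>X\<close> the quotient of \<open>d\<close> by \<open>w\<close>, the condition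
  on \<open>q\<close> at this \<open>X\<close> reads \<open>q \<ge> adj X * X * w\<close>, the
  convexity of the square. So \<open>adj (T - X) * (T - X) * w\<close> is at most
  \<open>\<epsilon>^2 * w\<close>, and the central \<open>w\<close> cancels.\<close>

lemma approximation_of_invertible_weight:
  assumes A: "unital_subalgebra A" "center \<subseteq> A" and w: "w \<in> weights A T \<epsilon>"
    and M: "pos (M *\<^sub>R w - 1)" and \<epsilon>: "0 \<le> \<epsilon>"
  obtains X where "X \<in> A" "norm (T - X) \<le> \<epsilon>"
proof -
  obtain d q where wc: "w \<in> center" "pos w" and d: "d \<in> A"
    and q: "\<forall>X. pos (q - adj d * X - adj X * d + adj X * X * w)"
    and le: "pos (\<epsilon>\<^sup>2 *\<^sub>R w - (adj T * T * w - adj T * d - adj d * T + q))"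
    using w by (auto simp: weights_def)
  \<comment> \<open>Here \<open>M * w\<close> is the positive element \<open>M * w - 1\<close>
    shifted by 1, the form in which \<open>pos_shift_inverse\<close> inverts it.\<close>
  obtain r where r: "(M *\<^sub>R w - 1 + 1 *\<^sub>R 1) * r = 1" "r * (M *\<^sub>R w - 1 + 1 *\<^sub>R 1) = 1" "pos r"
    and comm: "\<forall>x. x * (M *\<^sub>R w - 1) = (M *\<^sub>R w - 1) * x \<longrightarrow> x * r = r * x"
    using pos_shift_inverse[OF M, of 1] by (metis zero_less_one)
  define v where "v = M *\<^sub>R r"
  have wv: "w * v = 1" using r(1) by (simp add: v_def)
  have rc: "r \<in> center"
  proof (rule centerI)
    fix b show "r * b = b * r"
      using comm[rule_format, of b] centerD[OF wc(1), of b]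
      by (simp add: left_diff_distrib right_diff_distrib)
  qed
  then have vc: "v \<in> center" by (simp add: v_def center_scaleR)
  have vw: "v * w = 1" using centerD[OF vc, of w] wv by simp
  have va: "adj v = v" using pos_adj[OF r(3)] by (simp add: v_def adj_simps)
  have "pos (w * (v * v))"
    using wc va by (intro pos_mult pos_square centerD) auto
  then have vp: "pos v" by (simp add: mult.assoc[symmetric] wv)
  define X where "X = d * v"
  have XA: "X \<in> A" using A d vc by (auto simp: X_def unital_subalgebra_def)
  have Xw: "X * w = d" by (simp add: X_def mult.assoc vw)
  have wa: "adj w = w" using wc(2) by (rule pos_adj)
  have aX: "adj d * Y = adj X * (Y * w)" for Y
  proof -
    have "adj d = w * adj X" using arg_cong[OF Xw, of adj] by (simp add: adj_simps wa)
    then show ?thesis using centerD[OF wc(1), of "adj X * Y"] by (simp add: mult.assoc)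
  qed
  have "pos (q - adj d * X - adj X * d + adj X * X * w)" using q by blast
  also have "q - adj d * X - adj X * d + adj X * X * w = q - adj X * (X * w)"
    unfolding aX unfolding Xw[symmetric] by (simp add: mult.assoc)
  finally have "pos ((\<epsilon>\<^sup>2 *\<^sub>R w - (adj T * T * w - adj T * d - adj d * T + q)) + (q - adj X * (X * w)))"
    using le by (intro pos_add)
  also have "(\<epsilon>\<^sup>2 *\<^sub>R w - (adj T * T * w - adj T * d - adj d * T + q)) + (q - adj X * (X * w))
      = (\<epsilon>\<^sup>2 *\<^sub>R 1 - adj (T - X) * (T - X)) * w"
    unfolding aX unfolding Xw[symmetric] by (simp add: adj_simps algebra_simps)
  finally have "pos ((\<epsilon>\<^sup>2 *\<^sub>R 1 - adj (T - X) * (T - X)) * w * v)"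
  proof (rule pos_mult[OF _ vp])
    show "(\<epsilon>\<^sup>2 *\<^sub>R 1 - adj (T - X) * (T - X)) * w * v = v * ((\<epsilon>\<^sup>2 *\<^sub>R 1 - adj (T - X) * (T - X)) * w)"
      by (rule centerD[OF vc, symmetric])
  qed
  then have "pos (\<epsilon>\<^sup>2 *\<^sub>R 1 - adj (T - X) * (T - X))" by (simp add: mult.assoc wv)
  then have "(norm (T - X))\<^sup>2 \<le> \<epsilon>\<^sup>2"
    using pos_norm_le[OF pos_adj_mult_self, of "\<epsilon>\<^sup>2" "T - X"] by (simp add: cstar_identity)
  then have "norm (T - X) \<le> \<epsilon>" using \<epsilon> by (rule power2_le_imp_le)
  then show thesis using XA that by blast
qed

text \<open>
  The weight below is the square of \<open>2 (g - 1/2)\<^sub>+\<close>, where \<open>g = 1\<close> modulo \<open>P\<close> and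
  \<open>(T - a) g\<close> is small.
\<close>

lemma weight_not_in_primitive_ideal:
  assumes A: "unital_subalgebra A" "center \<subseteq> A" "a \<in> A"
    and J: "closed_ideal J" "J \<subseteq> closure (dominated (central_part J))" "T - a \<in> J"
    and P: "primitive_ideal P" "J \<subseteq> P" and \<epsilon>: "0 < \<epsilon>"
  obtains u where "adj u * u \<in> weights A T \<epsilon>" "u \<notin> P"
proof -
  define y where "y = T - a"
  have y: "finite {y}" "{y} \<subseteq> closure (dominated (central_part J))" "\<epsilon> / 2 > 0"
    using J \<epsilon> by (auto simp: y_def)
  obtain g w c where g: "g \<in> center" "pos g" "norm g \<le> 1" "w \<in> central_part J" "1 - g = w * c"
    "\<forall>x\<in>{y}. norm (x * g) < \<epsilon> / 2"
    by (rule central_approximate_unit[OF central_cone_central_part[OF J(1)] y]) (rule that)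
  have ga: "adj g = g" using g(2) by (rule pos_adj)
  have gP: "1 - g \<in> P" using g(4,5) closed_ideal_mult_right[OF J(1)] P(2) by auto
  define k where "k = g - (1/2) *\<^sub>R 1"
  have kc: "k \<in> center" using g(1) by (simp add: k_def center_diff center_scaleR center_one)
  have ka: "adj k = k" by (simp add: k_def adj_simps ga)
  obtain a' where a': "pos a'" "a' * a' = k * k" "pos (a' + k)" "pos (a' - k)"
    "\<forall>x. x * k = k * x \<longrightarrow> x * a' = a' * x"
    by (rule pos_abs[OF ka]) (rule that)
  have a'c: "a' \<in> center"
  proof (rule centerI)
    fix b show "a' * b = b * a'" using a'(5)[rule_format, of b] centerD[OF kc, of b] by simp
  qed
  define u where "u = a' + k"
  have uc: "u \<in> center" using a'c kc by (simp add: u_def center_add)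
  have ua: "adj u = u" using a'(1) ka by (simp add: u_def adj_simps pos_adj)
  have ku: "k * u = a' * u"
    using a'(2) centerD[OF a'c, of k] by (simp add: u_def distrib_left)
  have "u \<notin> P"
  \<comment> \<open>Modulo \<open>P\<close> the element \<open>u\<close> equals
    \<open>u + (1 - g) = a' + 1/2\<close>, which is invertible because \<open>a'\<close> is
    positive.\<close>
  proof
    assume "u \<in> P"
    then have "u + (1 - g) \<in> P" using gP primitive_ideal_props(2)[OF P(1)] by blast
    moreover have "u + (1 - g) = a' + (1/2) *\<^sub>R 1"
      using scaleR_add_left[of "1/2" "1/2" "1::'a"] by (simp add: u_def k_def algebra_simps)
    moreover obtain r where "(a' + (1/2) *\<^sub>R 1) * r = 1"
      using pos_shift_inverse[OF a'(1), of "1/2"] by (metis half_gt_zero zero_less_one)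
    ultimately have "1 \<in> P" using primitive_ideal_props(3)[OF P(1), of "a' + (1/2) *\<^sub>R 1" r] by simp
    then show False using primitive_ideal_props(1)[OF P(1)] by blast
  qed
  moreover have "u * u \<in> weights A T \<epsilon>"
  proof (rule square_in_weights[OF A uc ua])
    \<comment> \<open>Since \<open>a' * u = k * u\<close>, this is
      \<open>(4 * k + 4 * k^2) * u^2\<close>, and \<open>k = g - 1/2\<close> makes the factor
      \<open>4 * g^2 - 1\<close>. So positivity of \<open>E\<close> says
      \<open>u^2 \<le> 4 * g^2 * u^2\<close>: \<open>u\<close> lives where
      \<open>g \<ge> 1/2\<close>. The 4 is absorbed by the bound \<open>\<epsilon> / 2\<close> on
      \<open>norm (y * g)\<close>.\<close>
    define E where "E = 4 *\<^sub>R (a' * (u * u)) + 4 *\<^sub>R (k * k * (u * u))"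
    have "pos E"
      unfolding E_def using a'(1) ka ua centerD[OF a'c] centerD[OF center_mult[OF kc kc]]
      by (intro pos_add pos_scaleR pos_mult pos_square) auto
    have "a' * (u * u) = k * (u * u)" using ku by (simp add: mult.assoc[symmetric])
    moreover have four: "4 *\<^sub>R z = z + z + (z + z)" for z :: 'a
      using scaleR_add_left[of 2 2 z] by (simp add: scaleR_2)
    ultimately have E: "E = 4 *\<^sub>R (g * g * (u * u)) - u * u"
      unfolding E_def k_def
      by (simp add: left_diff_distrib right_diff_distrib scaleR_diff_right mult.assoc)
        (simp add: four scaleR_2)
    have "pos (adj y * E * y)" using \<open>pos E\<close> by (rule pos_conjugate)
    moreover have "adj y * E * y = 4 *\<^sub>R (adj y * y * (g * g * (u * u))) - adj y * y * (u * u)"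
      unfolding E using centerD[OF center_mult[OF center_mult[OF g(1) g(1)] center_mult[OF uc uc]], of y]
        centerD[OF center_mult[OF uc uc], of y]
      by (simp add: left_diff_distrib right_diff_distrib mult.assoc)
    ultimately have 1: "pos (4 *\<^sub>R (adj y * y * (g * g * (u * u))) - adj y * y * (u * u))" by simp
    have "(norm (y * g))\<^sup>2 \<le> (\<epsilon> / 2)\<^sup>2" using g(6) by (intro power_mono) auto
    then have "pos (((\<epsilon> / 2)\<^sup>2 - (norm (y * g))\<^sup>2) *\<^sub>R 1 + ((norm (y * g))\<^sup>2 *\<^sub>R 1 - adj (y * g) * (y * g)))"
      by (intro pos_add pos_scaleR_one pos_norm_sq_diff) simp
    then have "pos ((\<epsilon> / 2)\<^sup>2 *\<^sub>R 1 - adj (y * g) * (y * g))" by (simp add: scaleR_diff_left)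
    then have "pos ((u * u) * ((\<epsilon> / 2)\<^sup>2 *\<^sub>R 1 - adj y * y * (g * g)))"
      unfolding center_sandwich[OF g(1) ga]
      by (intro pos_mult pos_square ua centerD center_mult uc)
    then have "pos (4 *\<^sub>R ((u * u) * ((\<epsilon> / 2)\<^sup>2 *\<^sub>R 1 - adj y * y * (g * g))))"
      by (rule pos_scaleR) simp
    also have "4 *\<^sub>R ((u * u) * ((\<epsilon> / 2)\<^sup>2 *\<^sub>R 1 - adj y * y * (g * g)))
        = \<epsilon>\<^sup>2 *\<^sub>R (u * u) - 4 *\<^sub>R (adj y * y * (g * g * (u * u)))"
      using centerD[OF center_mult[OF uc uc], of "adj y * y * (g * g)"]
      by (simp add: right_diff_distrib scaleR_diff_right power_divide mult.assoc)
    finally have "pos (\<epsilon>\<^sup>2 *\<^sub>R (u * u) - 4 *\<^sub>R (adj y * y * (g * g * (u * u))))" .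
    from pos_trans[OF 1 this]
    show "pos (\<epsilon>\<^sup>2 *\<^sub>R (u * u) - adj (T - a) * (T - a) * (u * u))" by (simp add: y_def)
  qed
  ultimately show thesis using ua that by metis
qed

lemma glue_over_center:
  fixes A :: "'a::unital_cstar_algebra set"
  assumes sep: "separable_space (euclidean :: 'a topology)"
    and A: "unital_subalgebra A" "center \<subseteq> A" "closed A"
    and loc: "\<And>P. primitive_ideal P \<Longrightarrow> \<exists>J. closed_ideal J \<and> J \<subseteq> closure (dominated (central_part J))
      \<and> J \<subseteq> P \<and> (\<exists>a\<in>A. T - a \<in> J)"
  shows "T \<in> A"
proof -
  have "\<exists>X\<in>A. dist X T < e" if e: "e > 0" for e
  proof -
    define \<epsilon> where "\<epsilon> = e / 2"
    have \<epsilon>: "\<epsilon> > 0" using e by (simp add: \<epsilon>_def)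
    define W where "W = weights A T \<epsilon>"
    have W: "central_cone W" unfolding W_def by (rule central_cone_weights[OF A(1)])
    have "1 \<in> closure (dominated W)"
    proof (rule ccontr)
      assume "1 \<notin> closure (dominated W)"
      then obtain P where P: "primitive_ideal P" "closure (dominated W) \<subseteq> P"
        by (rule primitive_ideal_separates[OF sep closed_ideal_dominated[OF W]])
      obtain J a where J: "closed_ideal J" "J \<subseteq> closure (dominated (central_part J))" "J \<subseteq> P"
        "a \<in> A" "T - a \<in> J"
        using loc[OF P(1)] by blast
      obtain u where u: "adj u * u \<in> W" "u \<notin> P"
        unfolding W_def by (rule weight_not_in_primitive_ideal[OF A(1,2) J(4,1,2,5) P(1) J(3) \<epsilon>])
      have "u \<in> dominated W" by (rule dominated_self[OF u(1)])
      then show False using u(2) closure_subset[of "dominated W"] P(2) by blast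
    qed
    \<comment> \<open>The closure is removed by invertibility near 1: some dominated
      \<open>x\<close> has an inverse, so 1 itself is dominated, which means
      \<open>1 \<le> M * w\<close> for a single weight.\<close>
    then obtain x where x: "x \<in> dominated W" "dist x 1 < 1"
      using closure_approachable[of 1 "dominated W"] by (meson zero_less_one)
    then obtain r where "x * r = 1"
      using neumann_inverse[of x] by (metis dist_norm norm_minus_commute)
    then have "1 \<in> dominated W" using dominated_mult_right[OF W x(1), of r] by simp
    then obtain w M where w: "w \<in> W" "pos (M *\<^sub>R w - 1)" by (auto simp: dominated_def)
    obtain X where "X \<in> A" "norm (T - X) \<le> \<epsilon>"
      using approximation_of_invertible_weight[OF A(1,2) w(1)[unfolded W_def] w(2)] \<epsilon> by (metis less_imp_le)
    then show ?thesis using e by (intro bexI[of _ X]) (auto simp: dist_norm norm_minus_commute \<epsilon>_def)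
  qed
  then have "T \<in> closure A" by (simp add: closure_approachable)
  then show ?thesis using A(3) by simp
qed

theorem theorem25:
  fixes A :: "'a::unital_cstar_algebra set"
    and I :: "'i set"
    and J :: "'i \<Rightarrow> 'a set"
  assumes "separable_space (euclidean :: 'a topology)"
    and "unital_subalgebra A"
    and "commutative_set A"
    and "closed A"
    and "center \<subseteq> A"
    and "\<And>i. i \<in> I \<Longrightarrow> closed_ideal (J i)"
    and "\<And>i j. i \<in> I \<Longrightarrow> j \<in> I \<Longrightarrow> i \<noteq> j \<Longrightarrow>
           {x + y | x y. x \<in> center \<inter> J i \<and> y \<in> center \<inter> J j} = center"
    and "\<And>i. i \<in> I \<Longrightarrow> approximately_normal (quotient_alg (J i)) (coset (J i) ` A)"
    and "\<And>P. primitive_ideal P \<Longrightarrow> \<exists>i\<in>I. J i \<subseteq> P"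
  shows "approximately_normal whole A"
proof -
  have central: "J i \<subseteq> closure (dominated (central_part (J i)))" if i: "i \<in> I" for i
  proof (rule closed_ideal_le_central[OF assms(1) assms(6)[OF i]])
    fix P :: "'a set" assume "primitive_ideal P"
    then obtain j where j: "j \<in> I" "J j \<subseteq> P" using assms(9) by blast
    show "J i \<subseteq> P \<or> (\<exists>x\<in>center \<inter> J i. 1 - x \<in> P)"
    proof (cases "i = j")
      case False
      \<comment> \<open>Comaximality splits the unit, and the summand in \<open>J j\<close> lies in
        \<open>P\<close>.\<close>
      then have "1 \<in> {x + y | x y. x \<in> center \<inter> J i \<and> y \<in> center \<inter> J j}"
        using assms(7)[OF i j(1)] center_one by simp
      then obtain x y where x: "1 = x + y" "x \<in> center \<inter> J i" "y \<in> J j" by blast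
      then have "1 - x = y" by (metis add_diff_cancel_left')
      then show ?thesis using x j(2) by blast
    qed (use j in simp)
  qed
  have "T \<in> A" if T: "T \<in> appr_double_commutant whole A" for T
  proof (rule glue_over_center[OF assms(1,2,5,4)])
    fix P :: "'a set" assume "primitive_ideal P"
    then obtain i where i: "i \<in> I" "J i \<subseteq> P" using assms(9) by blast
    note J = assms(6)[OF i(1)]
    have "coset (J i) T \<in> coset (J i) ` A"
      using appr_double_commutant_quotient[OF J central[OF i(1)] T] assms(8)[OF i(1)]
      by (simp add: approximately_normal_def)
    then obtain a where a: "a \<in> A" "coset (J i) T = coset (J i) a" by blast
    have "T + 0 \<in> coset (J i) T" using closed_ideal_zero[OF J] unfolding coset_def by blast
    then have "T - a \<in> J i" unfolding a(2) by (auto simp: coset_def)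
    then show "\<exists>J. closed_ideal J \<and> J \<subseteq> closure (dominated (central_part J)) \<and> J \<subseteq> P \<and> (\<exists>a\<in>A. T - a \<in> J)"
      using J central[OF i(1)] i(2) a(1) by blast
  qed
  moreover have "A \<subseteq> appr_double_commutant whole A"
    by (auto simp: appr_double_commutant_def whole_def)
  ultimately show ?thesis unfolding approximately_normal_def by blast
qed

end
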